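(* As $\lambda\to0^+$, the orbits of $F$ that correspond to the regular fixed points of $L$ form an infinite family of stable symmetric cycles (that is, each such orbit is a periodic orbit which is invariant under $G$ and whose points are surrounded by cells of positive area, and the number of these orbits tends to infinity as $\lambda\to0^+$), with the property that the total area of the associated islands approaches a positive limit as $\lambda\to 0^+$.
   Context: Let $0<\lambda<\lambda_+$, where $\lambda_+=2\cos(4\pi/9)\approx0.347$. Let $\Omega=[0,1)^2$, $F:\Omega\to\Omega$, $F(x,y)=(\lambda x-y+\iota(x,y),x)$, $\iota(x,y)=-\lfloor\lambda x-y\rfloor\in\{0,1\}$, and $G(x,y)=(y,x)$; $F$ is a bijection with $F^{-1}=G\circ F\circ G$. Let $\mathcal Q(U,V)=U_xV_x+U_yV_y-\frac\lambda2(U_xV_y+U_yV_x)$; areas are taken in this metric. Put $\theta=\arcsin(\lambda/2)$, $N=\lfloor\frac{\pi}{8\theta}-\frac14\rfloor$, $M=\lfloor\frac{\pi}{4\theta}-\frac12\rfloor$. Sector and induced maps. Let $c=(\frac1{2-\lambda},\frac1{2-\lambda})$ and let $\mathcal E$ be the ellipse $\mathcal Q(z-c,z-c)=(1-\lambda^2/4)(\frac{1-\lambda}{2-\lambda})^2$, tangent to $y=1$ at $T_0=(\frac{1+\lambda}2,1)$ and to $x=1$ at $G(T_0)$. $\Sigma$ is the open region near the corner $(1,1)$ bounded by the segments $[T_0,(1,1)]$, $[(1,1),G(T_0)]$ and the arc of $\mathcal E$ from $T_0$ clockwise to $G(T_0)$. Put $\Lambda=\Sigma\setminus F^4(\Sigma)$.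 For $z\in\Lambda$ let $\bar L^{\rm in}(z)=F^t(z)$ with $t\ge0$ minimal such that $F^t(z)\in G(\Lambda)$; for $z\in G(\Lambda)$ let $\bar L^{\rm out}(z)=F^t(z)$ with $t\ge1$ minimal such that $F^t(z)\in\Lambda$ (defined up to measure zero). $L^{\rm in}=G\circ\bar L^{\rm in}$, $L^{\rm out}=\bar L^{\rm out}\circ G$, and $L=L^{\rm out}\circ L^{\rm in}=\bar L^{\rm out}\circ\bar L^{\rm in}$. Regular atoms of $L^{\rm in}$. For $n\ge0$ let $\ell_n$ be the image of the line $y=1$ under $z\mapsto c+C^{4n}(z-c)$, $C=\begin{pmatrix}\lambda&-1\\1&0\end{pmatrix}$; $Q_0(n)=\ell_0\cap G(\ell_n)$, $Q_1(n)=\ell_1\cap G(\ell_n)$. For $1\le n\le N-1$, $\Lambda_n^{\rm in}$ is the quadrilateral with consecutive vertices $Q_0(n),Q_0(n-1),Q_1(n-1),Q_1(n)$; the set of fixed points of $L^{\rm in}$ in it is the segment $[Q_0(n-1),Q_1(n)]$. Regular atoms of $L^{\rm out}$. Let $P_0(m)=\left(\frac12\left(1+2\lambda+\frac{\tan\theta}{\tan(2m+1)\theta}\right),1\right)$ for $1\le m\le M$; $P_1(m)=\left(\frac12\left(1+2\lambda-\lambda^2+\lambda^4+(1-3\lambda^2+\lambda^4)\frac{\tan\theta}{\tan(2m-1)\theta}\right),\,1+\frac{\lambda^3}2+\frac\lambda2(\lambda^2-2)\frac{\tan\theta}{\tan(2m-1)\theta}\right)$ for $2\le m\le M$; $P_1(0)=\left(1,\frac{2-\lambda-\lambda^2}{2-4\lambda^2+\lambda^4}\right)$,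 $P_1(1)=\left(1,\frac{2-2\lambda-4\lambda^2+\lambda^3+\lambda^4}{2-9\lambda^2+6\lambda^4-\lambda^6}\right)$. For $3\le m\le M$, $\Lambda_m^{\rm out}$ is the quadrilateral $[P_0(m),P_0(m-1),P_1(m-1),P_1(m)]$; $\Lambda_1^{\rm out}$ is the quadrilateral $[P_0(1),(1,1),P_1(0),P']$ with $P'=(1-2\lambda^2+6\lambda^3+\lambda^4-5\lambda^5+\lambda^7,\ 1-\lambda+3\lambda^2+\lambda^3-4\lambda^4+\lambda^6)$; $\Lambda_2^{\rm out}$ is the hexagon $[P_0(2),P_0(1),P'',P_1(1),P''',P_1(2)]$ with $D=1-6\lambda^2+5\lambda^4-\lambda^6$, $P''=\left(1,\frac{1-\lambda-3\lambda^2+\lambda^3+\lambda^4}{D}\right)$ and $P'''=\left(\frac{1-6\lambda^2-3\lambda^3+11\lambda^4+4\lambda^5-12\lambda^6-\lambda^7+6\lambda^8-\lambda^{10}}{D},\frac{1-\lambda-4\lambda^2+3\lambda^3+4\lambda^4-7\lambda^5-\lambda^6+5\lambda^7-\lambda^9}{D}\right)$. The set of fixed points of $L^{\rm out}$ in $\Lambda_m^{\rm out}$ is the segment $[P_0(m),P_1(m-1)]$. Regular fixed points. Put $\Lambda_{m,n}=\Lambda_m^{\rm out}\cap\Lambda_n^{\rm in}$. A regular fixed point $Z(m,n)$ of $L$ is a point of $\Lambda_{m,n}$ at which the segments $[P_0(m),P_1(m-1)]$ and $[Q_0(n-1),Q_1(n)]$ intersect; it is a periodic point of $F$ of period $t(m,n)=4(m+n)-1$.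 The islands of its $F$-orbit are the $t(m,n)$ congruent (in the metric $\mathcal Q$) ellipses centred at the orbit points: $\mathcal Q(z-p,z-p)\le(1-\lambda^2/4)r^2$ with $p$ an orbit point and $r=\min\{x,1-x\}$ minimized over all points $(x,y)$ of the orbit; points inside an island have the same itinerary (sequence of $\iota$-values) as its centre. *)

theory Defs
  imports "HOL-Analysis.Analysis"
begin

type_synonym point = "real \<times> real"

definition lam_plus :: real where
  "lam_plus = 2 * cos (4 * pi / 9)"

definition Omega :: "point set" where
  "Omega = {0..<1} \<times> {0..<1}"

definition iota :: "real \<Rightarrow> point \<Rightarrow> int" where
  "iota lam = (\<lambda>(x, y). - \<lfloor>lam * x - y\<rfloor>)"

text \<open>\<open>F\<close> and \<open>G\<close> are total functions on the plane, but are only meant to act on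
  \<^const>\<open>Omega\<close>, which both preserve.\<close>

definition F :: "real \<Rightarrow> point \<Rightarrow> point" where
  "F lam = (\<lambda>(x, y). (lam * x - y + of_int (iota lam (x, y)), x))"

definition G :: "point \<Rightarrow> point" where
  "G = (\<lambda>(x, y). (y, x))"

definition Q :: "real \<Rightarrow> point \<Rightarrow> point \<Rightarrow> real" where
  "Q lam = (\<lambda>(ux, uy) (vx, vy). ux * vx + uy * vy - lam / 2 * (ux * vy + uy * vx))"

text \<open>Area in the metric \<open>Q\<close>: the Gram matrix of \<open>Q\<close> has determinant \<open>1 - lam\<^sup>2 / 4\<close>.\<close>

definition area :: "real \<Rightarrow> point set \<Rightarrow> real" where
  "area lam S = sqrt (1 - lam\<^sup>2 / 4) * measure lborel S"

definition theta :: "real \<Rightarrow> real" where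
  "theta lam = arcsin (lam / 2)"

definition N :: "real \<Rightarrow> nat" where
  "N lam = nat \<lfloor>pi / (8 * theta lam) - 1 / 4\<rfloor>"

definition M :: "real \<Rightarrow> nat" where
  "M lam = nat \<lfloor>pi / (4 * theta lam) - 1 / 2\<rfloor>"

definition ctr :: "real \<Rightarrow> point" where
  "ctr lam = (1 / (2 - lam), 1 / (2 - lam))"

definition ellipse_level :: "real \<Rightarrow> real" where
  "ellipse_level lam = (1 - lam\<^sup>2 / 4) * ((1 - lam) / (2 - lam))\<^sup>2"

definition ellipse :: "real \<Rightarrow> point set" where
  "ellipse lam = {z. Q lam (z - ctr lam) (z - ctr lam) = ellipse_level lam}"

text \<open>The open region bounded by the two sides of the unit square at the corner \<open>(1, 1)\<close> and the
  arc of the ellipse joining its points of tangency \<open>((1 + lam) / 2, 1)\<close> and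
  \<open>(1, (1 + lam) / 2)\<close>. Along this arc \<open>x\<close> increases and \<open>y\<close> decreases, so
  it lies in the square spanned by its end points and \<open>(1, 1)\<close>, and the region is the part
  of that open square outside the ellipse.\<close>

definition sector :: "real \<Rightarrow> point set" where
  "sector lam = {(x, y). (1 + lam) / 2 < x \<and> x < 1 \<and> (1 + lam) / 2 < y \<and> y < 1 \<and>
     Q lam ((x, y) - ctr lam) ((x, y) - ctr lam) > ellipse_level lam}"

definition Lambda :: "real \<Rightarrow> point set" where
  "Lambda lam = sector lam - (F lam ^^ 4) ` sector lam"

text \<open>The transit maps are defined only up to measure zero; where no transit time exists, the
  value below is irrelevant.\<close>

definition Lbar_in :: "real \<Rightarrow> point \<Rightarrow> point" where
  "Lbar_in lam z = (F lam ^^ (LEAST t. (F lam ^^ t) z \<in> G ` Lambda lam)) z"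

definition Lbar_out :: "real \<Rightarrow> point \<Rightarrow> point" where
  "Lbar_out lam z = (F lam ^^ (LEAST t. t \<ge> 1 \<and> (F lam ^^ t) z \<in> Lambda lam)) z"

definition L_in :: "real \<Rightarrow> point \<Rightarrow> point" where
  "L_in lam = G \<circ> Lbar_in lam"

definition L_out :: "real \<Rightarrow> point \<Rightarrow> point" where
  "L_out lam = Lbar_out lam \<circ> G"

definition L :: "real \<Rightarrow> point \<Rightarrow> point" where
  "L lam = L_out lam \<circ> L_in lam"

definition Cmap :: "real \<Rightarrow> point \<Rightarrow> point" where
  "Cmap lam = (\<lambda>(x, y). (lam * x - y, x))"

definition ell :: "real \<Rightarrow> nat \<Rightarrow> point set" where
  "ell lam n = (\<lambda>z. ctr lam + (Cmap lam ^^ (4 * n)) (z - ctr lam)) ` {(x, y). y = 1}"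

text \<open>\<open>Qpt lam i n\<close> is the intersection point of \<open>ell lam i\<close> and \<open>G ` ell lam n\<close>. All these lines are
  tangent to the ellipse. When \<open>pi / (8 * theta lam) - 1 / 4\<close> is an integer,
  \<open>ell lam 1\<close> and \<open>G ` ell lam (N lam - 1)\<close> are the same line, and \<open>Qpt lam 1 (N lam - 1)\<close> is then
  its point of tangency, which is the limit of the intersection points for nearby parameters.\<close>

definition Qpt :: "real \<Rightarrow> nat \<Rightarrow> nat \<Rightarrow> point" where
  "Qpt lam i n = (THE z. z \<in> ell lam i \<inter> G ` ell lam n \<and>
     (ell lam i = G ` ell lam n \<longrightarrow> z \<in> ellipse lam))"

text \<open>The atoms are open polygons. For the admissible parameters and indices all of them are
  convex, so they are the interiors of the convex hulls of their vertices.\<close>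

definition in_atom :: "real \<Rightarrow> nat \<Rightarrow> point set" where
  "in_atom lam n = interior (convex hull
     {Qpt lam 0 n, Qpt lam 0 (n - 1), Qpt lam 1 (n - 1), Qpt lam 1 n})"

text \<open>If \<open>(2 * m + 1) * theta lam = pi / 2\<close>, which can happen for \<open>m = M lam\<close>, the quotient of tangents is
  \<open>0\<close> both by continuity and by the conventions \<open>tan (pi / 2) = 0\<close> and \<open>a / 0 = 0\<close>.\<close>

definition P0 :: "real \<Rightarrow> nat \<Rightarrow> point" where
  "P0 lam m =
     (1 / 2 * (1 + 2 * lam + tan (theta lam) / tan ((2 * real m + 1) * theta lam)), 1)"

definition P1 :: "real \<Rightarrow> nat \<Rightarrow> point" where
  "P1 lam m =
    (if m = 0 then (1, (2 - lam - lam^2) / (2 - 4 * lam^2 + lam^4))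
     else if m = 1 then
       (1, (2 - 2 * lam - 4 * lam^2 + lam^3 + lam^4) / (2 - 9 * lam^2 + 6 * lam^4 - lam^6))
     else
       (1 / 2 * (1 + 2 * lam - lam^2 + lam^4 +
          (1 - 3 * lam^2 + lam^4) * (tan (theta lam) / tan ((2 * real m - 1) * theta lam))),
        1 + lam^3 / 2 +
          lam / 2 * (lam^2 - 2) * (tan (theta lam) / tan ((2 * real m - 1) * theta lam))))"

definition P' :: "real \<Rightarrow> point" where
  "P' lam = (1 - 2 * lam^2 + 6 * lam^3 + lam^4 - 5 * lam^5 + lam^7,
             1 - lam + 3 * lam^2 + lam^3 - 4 * lam^4 + lam^6)"

definition D :: "real \<Rightarrow> real" where
  "D lam = 1 - 6 * lam^2 + 5 * lam^4 - lam^6"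

definition P'' :: "real \<Rightarrow> point" where
  "P'' lam = (1, (1 - lam - 3 * lam^2 + lam^3 + lam^4) / D lam)"

definition P''' :: "real \<Rightarrow> point" where
  "P''' lam =
    ((1 - 6 * lam^2 - 3 * lam^3 + 11 * lam^4 + 4 * lam^5 - 12 * lam^6 - lam^7 + 6 * lam^8
        - lam^10) / D lam,
     (1 - lam - 4 * lam^2 + 3 * lam^3 + 4 * lam^4 - 7 * lam^5 - lam^6 + 5 * lam^7
        - lam^9) / D lam)"

definition out_atom :: "real \<Rightarrow> nat \<Rightarrow> point set" where
  "out_atom lam m = interior (convex hull
    (if m = 1 then {P0 lam 1, (1, 1), P1 lam 0, P' lam}
     else if m = 2 then {P0 lam 2, P0 lam 1, P'' lam, P1 lam 1, P''' lam, P1 lam 2}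
     else {P0 lam m, P0 lam (m - 1), P1 lam (m - 1), P1 lam m}))"

definition regular_fixed_point :: "real \<Rightarrow> nat \<Rightarrow> nat \<Rightarrow> point \<Rightarrow> bool" where
  "regular_fixed_point lam m n z \<longleftrightarrow>
     1 \<le> m \<and> m \<le> M lam \<and> 1 \<le> n \<and> n + 1 \<le> N lam \<and>
     z \<in> Lambda lam \<and> L lam z = z \<and>
     z \<in> out_atom lam m \<inter> in_atom lam n \<and>
     z \<in> closed_segment (P0 lam m) (P1 lam (m - 1)) \<inter>
         closed_segment (Qpt lam 0 (n - 1)) (Qpt lam 1 n)"

definition orbit :: "real \<Rightarrow> point \<Rightarrow> point set" where
  "orbit lam z = range (\<lambda>k. (F lam ^^ k) z)"

definition regular_orbits :: "real \<Rightarrow> point set set" where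
  "regular_orbits lam = {orbit lam z | m n z. regular_fixed_point lam m n z}"

text \<open>The cell of a point: all points with the same itinerary.\<close>

definition cell :: "real \<Rightarrow> point \<Rightarrow> point set" where
  "cell lam p = {z \<in> Omega. \<forall>k. iota lam ((F lam ^^ k) z) = iota lam ((F lam ^^ k) p)}"

definition stable_symmetric_cycle :: "real \<Rightarrow> point set \<Rightarrow> bool" where
  "stable_symmetric_cycle lam S \<longleftrightarrow>
     S \<subseteq> Omega \<and>
     (\<exists>z t. t \<ge> 1 \<and> (F lam ^^ t) z = z \<and> S = orbit lam z) \<and>
     G ` S = S \<and>
     (\<forall>p\<in>S. p \<in> interior (cell lam p) \<and> area lam (cell lam p) > 0)"

definition island_radius :: "point set \<Rightarrow> real" where
  "island_radius S = (INF (x, y)\<in>S. min x (1 - x))"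

definition island :: "real \<Rightarrow> point set \<Rightarrow> point \<Rightarrow> point set" where
  "island lam S p = {z. Q lam (z - p) (z - p) \<le> (1 - lam\<^sup>2 / 4) * (island_radius S)\<^sup>2}"

definition total_island_area :: "real \<Rightarrow> real" where
  "total_island_area lam = (\<Sum>S\<in>regular_orbits lam. \<Sum>p\<in>S. area lam (island lam S p))"

end

theory Submission
  imports Defs
begin

text \<open>On the coordinate sequence \<open>x\<close> of an orbit (each point is \<open>(x\<^sub>i, x\<^sub>i\<^sub>-\<^sub>1)\<close>) the map is the
  recurrence \<open>x\<^sub>i\<^sub>+\<^sub>1 = lam * x\<^sub>i - x\<^sub>i\<^sub>-\<^sub>1 + \<iota>\<^sub>i\<close>, and \<open>\<iota>\<^sub>i\<close> is the integer that keeps the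
  sequence in the unit interval. Since \<open>lam = 2 * sin \<theta>\<close>, all orbit segments with a known
  itinerary are explicit trigonometric expressions. A regular cycle consists of two such segments,
  both palindromic.

  In the inner phase \<open>\<iota> = 1\<close>, and every four steps rotate the point by the angle \<open>-4 * \<theta>\<close>
  about \<open>ctr lam\<close>. The point \<open>z\<close> reaches its mirror image \<open>G z\<close> after \<open>4 * (n - 1)\<close>
  steps exactly if it lies on a certain ray from \<open>ctr lam\<close>, the ray through the segment of fixed points
  of \<open>L_in\<close>. In the outer phase, which leads from \<open>G z\<close> back to \<open>z\<close> in \<open>4 * m + 3\<close> steps, the
  itinerary is \<open>1110\<close>, then \<open>m - 1\<close> times \<open>1010\<close>, then \<open>111\<close>, so the orbit rotates about a point of period two near
  the middle of a side. It closes exactly if \<open>z\<close> lies on a certain line, the line through the segment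
  of fixed points of \<open>L_out\<close>. A regular fixed point is the intersection of ray and line, which
  Cramer's rule gives in closed form. The locale \<open>regular_cycle\<close> collects the inequalities
  that make this itinerary the actual one; lemma \<open>regular_imp_cycle\<close> derives them from the
  definition of a regular fixed point for all parameters, and \<open>regular_cycle.regular\<close> leads back
  for small ones.

  In a regular cycle all coordinates keep a positive distance from 0 and 1, so the orbit is surrounded by
  discs of the metric \<open>Q\<close> on which the itinerary is constant. The cycle contains \<open>G z\<close>, hence
  it is symmetric. Finally it meets \<open>Lambda\<close> only in \<open>z\<close> (lemma \<open>not_in_Lambda\<close>). This gives the
  transit times of \<open>L\<close>, the least period \<open>4 * (m + n) - 1\<close>, and shows that different pairs
  \<open>(m, n)\<close> have different cycles.

  For the limit \<open>lam \<rightarrow> 0\<close>, the island radius is the minimum of two coordinates of the orbit,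
  the distance \<open>height\<close> of \<open>z\<close> from the side \<open>y = 1\<close> and the coordinate \<open>fourth\<close> reached when the
  orbit has crossed from one side of the torus to the other. Both are of order \<open>lam\<close> if \<open>m\<close> is
  fixed and \<open>n * lam\<close> tends to some \<open>u\<close>, and the period is about \<open>4 * u / lam\<close>. So for fixed \<open>m\<close>
  the sum of the island areas over \<open>n\<close> is a Riemann sum, with mesh \<open>lam\<close>, of a function that
  converges to \<open>density m u\<close>. The bound \<open>5 * lam / m\<close> for the radii (lemma \<open>island_radius_le\<close>)
  allows dominated convergence in \<open>u\<close> and Tannery's theorem in \<open>m\<close>. As the limit is positive
  and a single cycle contributes at most \<open>1000 * lam\<close>, the number of cycles tends to infinity.\<close>

section \<open>The map, its symmetry and its cells\<close>

lemma F_eqI: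
  assumes "x' = lam * x - y + of_int i" "0 \<le> x'" "x' < 1"
  shows "F lam (x, y) = (x', x)" and "iota lam (x, y) = i"
proof -
  have "\<lfloor>lam * x - y\<rfloor> = - i" using assms by (intro floor_unique) auto
  then show "F lam (x, y) = (x', x)" "iota lam (x, y) = i" using assms by (auto simp: F_def iota_def)
qed

lemma F_Pair: "F lam (x, y) = (lam * x - y - of_int \<lfloor>lam * x - y\<rfloor>, x)"
  by (simp add: F_def iota_def)

lemma F_in_Omega: "z \<in> Omega \<Longrightarrow> F lam z \<in> Omega"
  by (cases z) (auto simp: F_Pair Omega_def; linarith)

lemma F_power_in_Omega: "z \<in> Omega \<Longrightarrow> (F lam ^^ k) z \<in> Omega"
  by (induction k) (auto intro: F_in_Omega)

lemma G_Pair [simp]: "G (x, y) = (y, x)"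
  by (simp add: G_def)

lemma G_G [simp]: "G (G z) = z"
  by (cases z) simp

lemma fst_G [simp]: "fst (G z) = snd z" and snd_G [simp]: "snd (G z) = fst z"
  by (cases z; simp)+

lemma G_in_Omega [simp]: "G z \<in> Omega \<longleftrightarrow> z \<in> Omega"
  by (cases z) (auto simp: Omega_def)

lemma snd_F [simp]: "snd (F lam z) = fst z"
  by (cases z) (simp add: F_Pair)

text \<open>The recurrence for the coordinate sequence is symmetric under time reversal, and \<open>G\<close> reverses
  the order of two consecutive coordinates.\<close>

lemma F_G_F: "z \<in> Omega \<Longrightarrow> F lam (G (F lam z)) = G z"
proof (cases z)
  case (Pair x y)
  assume "z \<in> Omega"
  then have "0 \<le> y" "y < 1" using Pair by (auto simp: Omega_def)
  then have "F lam (x, lam * x - y - of_int \<lfloor>lam * x - y\<rfloor>) = (y, x)"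
    by (intro F_eqI(1)[where i = "- \<lfloor>lam * x - y\<rfloor>"]) auto
  then show ?thesis unfolding Pair F_Pair G_Pair .
qed

lemma F_power_G_F_power: "z \<in> Omega \<Longrightarrow> (F lam ^^ k) (G ((F lam ^^ k) z)) = G z"
proof (induction k)
  case (Suc k)
  have "(F lam ^^ Suc k) (G ((F lam ^^ Suc k) z)) = (F lam ^^ k) (F lam (G (F lam ((F lam ^^ k) z))))"
    by (simp add: funpow_swap1)
  also have "\<dots> = G z" using Suc F_G_F[OF F_power_in_Omega[OF Suc.prems]] by simp
  finally show ?case .
qed simp

lemma F_power_inj:
  assumes "z \<in> Omega" "z' \<in> Omega" "(F lam ^^ k) z = (F lam ^^ k) z'"
  shows "z = z'"
  using F_power_G_F_power[OF assms(1), of k lam] F_power_G_F_power[OF assms(2), of k lam] assms(3)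
  by (metis G_G)

lemma Q_diag: "Q lam (dx, dy) (dx, dy) = (1 - lam\<^sup>2 / 4) * dx\<^sup>2 + (dy - lam / 2 * dx)\<^sup>2"
  by (simp add: Q_def power2_eq_square algebra_simps)

lemma Q_diag': "Q lam (dx, dy) (dx, dy) = (1 - lam\<^sup>2 / 4) * dy\<^sup>2 + (dx - lam / 2 * dy)\<^sup>2"
  by (simp add: Q_def power2_eq_square algebra_simps)

lemma Q_Cmap: "Q lam (Cmap lam d) (Cmap lam d) = Q lam d d"
  by (cases d) (simp add: Q_def Cmap_def power2_eq_square algebra_simps)

lemma discr_pos: "\<bar>lam\<bar> < 2 \<Longrightarrow> 0 < 1 - lam\<^sup>2 / (4 :: real)"
  using abs_square_less_1[of "lam / 2"] by (simp add: power_divide)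

lemma Q_less_imp_abs_less:
  assumes "\<bar>lam\<bar> < 2" "Q lam d d < (1 - lam\<^sup>2 / 4) * r\<^sup>2" "0 < r"
  shows "\<bar>fst d\<bar> < r" and "\<bar>snd d\<bar> < r"
proof -
  obtain dx dy where d: "d = (dx, dy)" by (cases d)
  have p: "0 < 1 - lam\<^sup>2 / 4" using discr_pos[OF assms(1)] .
  have "(1 - lam\<^sup>2 / 4) * dx\<^sup>2 < (1 - lam\<^sup>2 / 4) * r\<^sup>2"
    using assms(2) unfolding d Q_diag by (smt (verit) zero_le_power2)
  then have "dx\<^sup>2 < r\<^sup>2" using p by (simp add: mult_less_cancel_left_pos)
  then show "\<bar>fst d\<bar> < r" using assms(3) d by (intro power2_less_imp_less[of "\<bar>fst d\<bar>" r]) auto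
  have "(1 - lam\<^sup>2 / 4) * dy\<^sup>2 < (1 - lam\<^sup>2 / 4) * r\<^sup>2"
    using assms(2) unfolding d Q_diag' by (smt (verit) zero_le_power2)
  then have "dy\<^sup>2 < r\<^sup>2" using p by (simp add: mult_less_cancel_left_pos)
  then show "\<bar>snd d\<bar> < r" using assms(3) d by (intro power2_less_imp_less[of "\<bar>snd d\<bar>" r]) auto
qed

text \<open>On a set where two points share their itinerary, \<open>F\<close> acts on their difference by the
  \<open>Q\<close>-isometry \<open>Cmap\<close>. An orbit at distance \<open>\<mu>\<close> from the sides of the square
  is therefore surrounded by \<open>Q\<close>-discs that never meet the discontinuity.\<close>

lemma Q_disc_subset_cell:
  assumes lam: "\<bar>lam\<bar> < 2" and mu: "0 < \<mu>"
    and x: "\<And>k. fst ((F lam ^^ k) p) \<in> {\<mu>..1 - \<mu>}" and y: "snd p \<in> {\<mu>..1 - \<mu>}"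
  shows "{z. Q lam (z - p) (z - p) < (1 - lam\<^sup>2 / 4) * \<mu>\<^sup>2} \<subseteq> cell lam p"
proof
  fix z assume "z \<in> {z. Q lam (z - p) (z - p) < (1 - lam\<^sup>2 / 4) * \<mu>\<^sup>2}"
  then have z: "Q lam (z - p) (z - p) < (1 - lam\<^sup>2 / 4) * \<mu>\<^sup>2" by simp
  let ?p = "\<lambda>k. (F lam ^^ k) p" and ?z = "\<lambda>k. (F lam ^^ k) z"
  have step: "?z (Suc k) - ?p (Suc k) = Cmap lam (?z k - ?p k) \<and> iota lam (?z k) = iota lam (?p k)"
    if Qk: "Q lam (?z k - ?p k) (?z k - ?p k) < (1 - lam\<^sup>2 / 4) * \<mu>\<^sup>2" for k
  proof -
    obtain x0 y0 where p0: "?p k = (x0, y0)" by (cases "?p k")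
    obtain x1 y1 where z1: "?z k = (x1, y1)" by (cases "?z k")
    define i where "i = iota lam (?p k)"
    define d where "d = Cmap lam (?z k - ?p k)"
    have "\<bar>fst d\<bar> < \<mu>"
      using Q_less_imp_abs_less(1)[OF lam _ mu, of d] Qk unfolding d_def Q_Cmap by blast
    moreover have "fst (?p (Suc k)) = lam * x0 - y0 + of_int i" "snd (?p (Suc k)) = x0"
      using p0 by (simp_all add: i_def F_def)
    moreover have d: "d = (lam * (x1 - x0) - (y1 - y0), x1 - x0)"
      by (simp add: d_def p0 z1 Cmap_def)
    ultimately have *: "fst (?p (Suc k)) + fst d = lam * x1 - y1 + of_int i"
        "0 \<le> fst (?p (Suc k)) + fst d" "fst (?p (Suc k)) + fst d < 1"
      using x[of "Suc k"] by (auto simp: algebra_simps abs_less_iff)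
    have "F lam (x1, y1) = (fst (?p (Suc k)) + fst d, x1)" "iota lam (x1, y1) = i"
      using F_eqI[OF *] .
    then show ?thesis
      using z1 p0 \<open>snd (?p (Suc k)) = x0\<close> d
      by (auto simp: i_def d_def[symmetric] prod_eq_iff)
  qed
  have Qk: "Q lam (?z k - ?p k) (?z k - ?p k) < (1 - lam\<^sup>2 / 4) * \<mu>\<^sup>2" for k
  proof (induction k)
    case 0
    then show ?case using z by simp
  next
    case (Suc k)
    then show ?case using step[OF Suc] by (simp only: Q_Cmap)
  qed
  have "\<bar>fst (z - p)\<bar> < \<mu>" "\<bar>snd (z - p)\<bar> < \<mu>" using Q_less_imp_abs_less[OF lam z mu] .
  then have "z \<in> Omega" using x[of 0] y by (cases z; cases p) (auto simp: Omega_def)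
  then show "z \<in> cell lam p" using step[OF Qk] by (auto simp: cell_def)
qed

lemma open_Q_disc: "open {z. Q lam (z - p) (z - p) < c}"
proof -
  have "Q lam (z - p) (z - p) = (fst z - fst p) * (fst z - fst p) + (snd z - snd p) * (snd z - snd p)
      - lam / 2 * ((fst z - fst p) * (snd z - snd p) + (snd z - snd p) * (fst z - fst p))" for z
    by (cases z; cases p) (simp add: Q_def)
  then show ?thesis by (simp only:) (intro open_Collect_less continuous_intros)
qed

lemma borel_measurable_fst_point [measurable]: "(fst :: point \<Rightarrow> real) \<in> borel_measurable borel"
  and borel_measurable_snd_point [measurable]: "(snd :: point \<Rightarrow> real) \<in> borel_measurable borel"
  by (intro borel_measurable_continuous_onI continuous_intros)+

lemma F_measurable [measurable]: "F lam \<in> borel_measurable borel"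
proof -
  have [measurable]: "(\<lambda>z::point. lam * fst z - snd z - of_int \<lfloor>lam * fst z - snd z\<rfloor>) \<in> borel_measurable borel"
    by measurable
  have "F lam = (\<lambda>z. (lam * fst z - snd z - of_int \<lfloor>lam * fst z - snd z\<rfloor>, fst z))"
    by (auto simp: fun_eq_iff F_Pair)
  also have "\<dots> \<in> borel_measurable borel"
    by (intro borel_measurable_Pair) measurable
  finally show ?thesis .
qed

lemma F_power_measurable [measurable]: "F lam ^^ k \<in> borel_measurable borel"
  by (induction k) (auto intro: measurable_comp[of _ borel borel])

lemma cell_borel: "cell lam p \<in> sets borel"
proof -
  have "(\<lambda>z. real_of_int (iota lam z)) = (\<lambda>z. - of_int \<lfloor>lam * fst z - snd z\<rfloor>)"
    by (auto simp: fun_eq_iff iota_def)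
  moreover have "\<dots> \<in> borel_measurable borel" by measurable
  ultimately have [measurable]: "(\<lambda>z. real_of_int (iota lam z)) \<in> borel_measurable borel" by simp
  have "{z \<in> space borel. real_of_int (iota lam ((F lam ^^ k) z)) = of_int i} \<in> sets borel" for k i
    by measurable
  then have k: "{z. iota lam ((F lam ^^ k) z) = i} \<in> sets borel" for k i by simp
  have "cell lam p = Omega \<inter> (\<Inter>k. {z. iota lam ((F lam ^^ k) z) = iota lam ((F lam ^^ k) p)})"
    by (auto simp: cell_def)
  moreover have "Omega \<in> sets borel"
    unfolding Omega_def by (intro borel_Times) auto
  ultimately show ?thesis using k by auto
qed

lemma area_cell_pos:
  assumes lam: "\<bar>lam\<bar> < 2" and p: "p \<in> interior (cell lam p)"
  shows "0 < area lam (cell lam p)"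
proof -
  obtain e where e: "e > 0" "ball p e \<subseteq> cell lam p"
    using p by (auto simp: mem_interior)
  have "bounded (cell lam p)"
    by (rule bounded_subset[OF bounded_cbox[of "(0, 0)" "(1, 1)"]]) (auto simp: cell_def Omega_def cbox_Pair_eq)
  then have "emeasure lborel (cell lam p) < \<infinity>" by (rule emeasure_bounded_finite)
  then have "cell lam p \<in> fmeasurable lborel"
    using cell_borel by (intro fmeasurableI) auto
  then have "measure lborel (ball p e) \<le> measure lborel (cell lam p)"
    using e by (intro measure_mono_fmeasurable) auto
  moreover have "0 < measure lborel (ball p e)"
    using e by (simp add: content_ball)
  ultimately have "0 < measure lborel (cell lam p)" by linarith
  then show ?thesis using discr_pos[OF lam] unfolding area_def by (intro mult_pos_pos) auto
qed

section \<open>Area of a disc of the metric\<close>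

text \<open>By Cavalieri's principle: a shear moves the vertical slices of a disc, and \<open>k\<close> scales
  their lengths.\<close>

lemma emeasure_sheared_disc:
  fixes p :: point
  assumes r: "0 \<le> r" and k: "0 \<le> k"
  defines "A \<equiv> \<lambda>k e. {z. (fst z - fst p)\<^sup>2 \<le> r\<^sup>2 \<and>
     \<bar>snd z - snd p - e * (fst z - fst p)\<bar> \<le> k * sqrt (r\<^sup>2 - (fst z - fst p)\<^sup>2)}"
  shows "emeasure lborel (A k e) = ennreal k * emeasure lborel (A 1 0)"
proof -
  have slices: "emeasure lborel (A k e) =
      (\<integral>\<^sup>+x. ennreal k * (if (x - fst p)\<^sup>2 \<le> r\<^sup>2 then ennreal (2 * sqrt (r\<^sup>2 - (x - fst p)\<^sup>2)) else 0) \<partial>lborel)"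
    if k: "0 \<le> k" for k e
  proof -
    have "closed (A k e)" unfolding A_def
      by (intro closed_Collect_conj closed_Collect_le continuous_intros)
    then have "A k e \<in> sets (lborel \<Otimes>\<^sub>M lborel)" unfolding lborel_prod by simp
    then have "emeasure lborel (A k e) = (\<integral>\<^sup>+x. emeasure lborel (Pair x -` A k e) \<partial>lborel)"
      by (subst lborel_prod[symmetric]) (rule lborel.emeasure_pair_measure_alt)
    also have "\<dots> = (\<integral>\<^sup>+x. ennreal k *
        (if (x - fst p)\<^sup>2 \<le> r\<^sup>2 then ennreal (2 * sqrt (r\<^sup>2 - (x - fst p)\<^sup>2)) else 0) \<partial>lborel)"
    proof (intro nn_integral_cong)
      fix x :: real
      let ?c = "snd p + e * (x - fst p)" and ?l = "sqrt (r\<^sup>2 - (x - fst p)\<^sup>2)"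
      show "emeasure lborel (Pair x -` A k e) =
        ennreal k * (if (x - fst p)\<^sup>2 \<le> r\<^sup>2 then ennreal (2 * ?l) else 0)"
      proof (cases "(x - fst p)\<^sup>2 \<le> r\<^sup>2")
        case True
        then have "Pair x -` A k e = {?c - k * ?l..?c + k * ?l}"
          by (auto simp: A_def abs_le_iff)
        then show ?thesis using True k
          by (simp add: ennreal_mult'[symmetric] mult.left_commute)
      qed (simp add: A_def)
    qed
    finally show ?thesis .
  qed
  show ?thesis
    unfolding slices[OF k] slices[OF zero_le_one, simplified]
    by (simp add: nn_integral_cmult)
qed

lemma area_Q_disc:
  assumes lam: "\<bar>lam\<bar> < 2" and r: "0 \<le> r"
  shows "area lam {z. Q lam (z - p) (z - p) \<le> (1 - lam\<^sup>2 / 4) * r\<^sup>2} = pi * r\<^sup>2 * (1 - lam\<^sup>2 / 4)"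
proof -
  define k where "k = sqrt (1 - lam\<^sup>2 / 4)"
  define A where "A = (\<lambda>k e. {z. (fst z - fst p)\<^sup>2 \<le> r\<^sup>2 \<and>
     \<bar>snd z - snd p - e * (fst z - fst p)\<bar> \<le> k * sqrt (r\<^sup>2 - (fst z - fst p)\<^sup>2)})"
  have p: "0 < 1 - lam\<^sup>2 / 4" using discr_pos[OF lam] .
  then have k: "0 < k" "k\<^sup>2 = 1 - lam\<^sup>2 / 4" by (simp_all add: k_def)
  have slope: "k\<^sup>2 * u\<^sup>2 + v\<^sup>2 \<le> k\<^sup>2 * r\<^sup>2 \<longleftrightarrow> u\<^sup>2 \<le> r\<^sup>2 \<and> \<bar>v\<bar> \<le> k * sqrt (r\<^sup>2 - u\<^sup>2)" if "0 < k" for k u v :: real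
  proof -
    have "k\<^sup>2 * u\<^sup>2 + v\<^sup>2 \<le> k\<^sup>2 * r\<^sup>2 \<longleftrightarrow> v\<^sup>2 \<le> k\<^sup>2 * (r\<^sup>2 - u\<^sup>2)" by (simp add: algebra_simps)
    also have "\<dots> \<longleftrightarrow> u\<^sup>2 \<le> r\<^sup>2 \<and> v\<^sup>2 \<le> k\<^sup>2 * (r\<^sup>2 - u\<^sup>2)"
    proof -
      have "0 \<le> v\<^sup>2" "0 < k\<^sup>2" using that by auto
      then have "v\<^sup>2 \<le> k\<^sup>2 * (r\<^sup>2 - u\<^sup>2) \<Longrightarrow> 0 \<le> r\<^sup>2 - u\<^sup>2"
        by (meson order_trans zero_le_mult_iff not_le order.asym)
      then show ?thesis by auto
    qed
    also have "\<dots> \<longleftrightarrow> u\<^sup>2 \<le> r\<^sup>2 \<and> \<bar>v\<bar> \<le> sqrt (k\<^sup>2 * (r\<^sup>2 - u\<^sup>2))"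
      by (metis real_sqrt_abs real_sqrt_le_iff)
    also have "sqrt (k\<^sup>2 * (r\<^sup>2 - u\<^sup>2)) = k * sqrt (r\<^sup>2 - u\<^sup>2)"
      using that by (simp add: real_sqrt_mult)
    finally show ?thesis .
  qed
  have "{z. Q lam (z - p) (z - p) \<le> (1 - lam\<^sup>2 / 4) * r\<^sup>2} = A k (lam / 2)"
    using slope[OF k(1)] by (auto simp: A_def Q_diag k(2)[symmetric] minus_prod_def)
  then have "emeasure lborel {z. Q lam (z - p) (z - p) \<le> (1 - lam\<^sup>2 / 4) * r\<^sup>2} =
      ennreal k * emeasure lborel (A 1 0)"
    using emeasure_sheared_disc[OF r, of k p "lam / 2"] k by (simp add: A_def)
  moreover have "A 1 0 = cball p r"
  proof -
    have "z \<in> cball p r \<longleftrightarrow> (fst z - fst p)\<^sup>2 + (snd z - snd p)\<^sup>2 \<le> r\<^sup>2" for z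
    proof -
      have "z \<in> cball p r \<longleftrightarrow> sqrt ((fst z - fst p)\<^sup>2 + (snd z - snd p)\<^sup>2) \<le> sqrt (r\<^sup>2)"
        using r by (simp add: dist_prod_def dist_real_def power2_commute)
      then show ?thesis by (simp only: real_sqrt_le_iff)
    qed
    then show ?thesis using slope[of 1] by (auto simp: A_def)
  qed
  moreover have "emeasure lborel (cball p r) = ennreal (pi * r\<^sup>2)"
    using emeasure_cball[OF r, of p] by (simp add: unit_ball_vol_2 power2_eq_square)
  ultimately have "measure lborel {z. Q lam (z - p) (z - p) \<le> (1 - lam\<^sup>2 / 4) * r\<^sup>2} = k * (pi * r\<^sup>2)"
    using k(1) by (simp add: measure_def ennreal_mult'[symmetric] enn2real_mult)
  then have "area lam {z. Q lam (z - p) (z - p) \<le> (1 - lam\<^sup>2 / 4) * r\<^sup>2} = k * (k * (pi * r\<^sup>2))"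
    unfolding area_def by (simp only: k_def)
  also have "\<dots> = pi * r\<^sup>2 * k\<^sup>2" by (simp add: power2_eq_square)
  finally show ?thesis by (simp only: k(2))
qed

section \<open>Rotation angle and polar coordinates\<close>

lemma funpow_4: "(f ^^ 4) x = f (f (f (f x)))"
  by (simp add: eval_nat_numeral)

text \<open>Points on a circle of the metric \<open>Q\<close>. The second coordinate is the cosine of the angle
  \<open>\<alpha> - (pi / 2 - theta lam)\<close>, so that \<open>Cmap\<close>, which passes the first coordinate on to the
  second, is the rotation by \<open>pi / 2 - theta lam\<close>.\<close>

definition polar :: "real \<Rightarrow> real \<Rightarrow> point" where
  "polar lam \<alpha> = (cos \<alpha>, sin (\<alpha> + theta lam))"

text \<open>Both coordinates of \<open>ctr lam\<close>.\<close>

definition kap :: "real \<Rightarrow> real" where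
  "kap lam = 1 / (2 - lam)"

text \<open>The outer phase oscillates about the cycle \<open>(eb lam, ea lam)\<close>, \<open>(ea lam, eb lam)\<close> of period two,
  where \<open>\<iota> = 1\<close> at the first point and \<open>\<iota> = 0\<close> at the second. For small \<open>lam\<close> the two points
  are close to the midpoints of the left and of the lower side.\<close>

definition ea :: "real \<Rightarrow> real" where
  "ea lam = 2 / (4 - lam\<^sup>2)"

definition eb :: "real \<Rightarrow> real" where
  "eb lam = lam / (4 - lam\<^sup>2)"

locale admissible =
  fixes lam :: real
  assumes lam_pos: "0 < lam" and lam_less: "lam < lam_plus"
begin

abbreviation "\<theta> \<equiv> theta lam"
abbreviation "\<kappa> \<equiv> kap lam"
abbreviation "a \<equiv> ea lam"
abbreviation "b \<equiv> eb lam"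

lemma lam_plus_eq: "lam_plus = 2 * sin (pi / 18)"
  unfolding lam_plus_def by (simp add: sin_cos_eq field_simps)

lemma lam_bounds: "lam < 7 / 20" "\<bar>lam\<bar> < 2"
proof -
  have "sin (pi / 18) \<le> pi / 18" by (rule sin_x_le_x) simp
  moreover have "pi < 315 / 100" using pi_approx by simp
  ultimately show "lam < 7 / 20" using lam_less lam_plus_eq by simp
  then show "\<bar>lam\<bar> < 2" using lam_pos by simp
qed

lemma sin_theta: "sin \<theta> = lam / 2"
  using lam_bounds lam_pos by (simp add: theta_def)

lemma theta_bounds: "0 < \<theta>" "\<theta> < pi / 18"
proof -
  show "0 < \<theta>" using lam_bounds lam_pos unfolding theta_def
    using arcsin_less_arcsin[of 0 "lam / 2"] by simp
  have "lam / 2 < sin (pi / 18)" using lam_less lam_plus_eq by simp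
  then have "arcsin (lam / 2) < arcsin (sin (pi / 18))"
    using lam_bounds lam_pos by (intro arcsin_less_arcsin) auto
  then show "\<theta> < pi / 18" by (simp add: theta_def arcsin_sin)
qed

lemma cos_theta_pos: "0 < cos \<theta>"
  using theta_bounds pi_gt_zero by (intro cos_gt_zero_pi) linarith+

lemma cos_theta_sq: "(cos \<theta>)\<^sup>2 = 1 - lam\<^sup>2 / 4"
  by (simp add: cos_squared_eq sin_theta power_divide)

lemma lam_sq: "0 < lam\<^sup>2" "lam\<^sup>2 < 49 / 400"
  using lam_pos power_strict_mono[OF lam_bounds(1), of 2] by (auto simp: power2_eq_square)

lemma kap_eq: "lam * \<kappa> = 2 * \<kappa> - 1" and kap_bounds: "1 / 2 < \<kappa>" "\<kappa> < 1"
  and kap_less: "\<kappa> < (1 + lam) / 2" and one_minus_kap: "1 - \<kappa> = (1 - lam) / (2 - lam)"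
  and ctr_eq: "ctr lam = (\<kappa>, \<kappa>)"
proof -
  have "0 < lam * (1 - lam)" using lam_pos lam_bounds by simp
  then show "\<kappa> < (1 + lam) / 2"
    using lam_bounds by (simp add: kap_def field_simps)
qed (use lam_pos lam_bounds in \<open>simp_all add: kap_def ctr_def field_simps\<close>)

lemma two_b: "2 * b = lam * a" and two_a: "2 * a = lam * b + 1"
  and b_bounds: "0 < b" "b < 1 / 10" and a_bounds: "1 / 2 < a" "a < 13 / 25"
proof -
  have p: "0 < 4 - lam\<^sup>2" using lam_sq by simp
  show "2 * b = lam * a" by (simp add: ea_def eb_def)
  show "2 * a = lam * b + 1" using p by (simp add: ea_def eb_def field_simps power2_eq_square)
  show "0 < b" "b < 1 / 10" "1 / 2 < a" "a < 13 / 25"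
    using p lam_pos lam_bounds lam_sq by (simp_all add: ea_def eb_def field_simps)
qed

lemma Cmap_polar: "Cmap lam (r *\<^sub>R polar lam \<alpha>) = r *\<^sub>R polar lam (\<alpha> + (pi / 2 - \<theta>))"
proof -
  have "cos (\<alpha> + (pi / 2 - \<theta>)) = - sin (\<alpha> - \<theta>)"
    by (simp add: cos_add sin_diff cos_diff sin_add algebra_simps)
  also have "\<dots> = 2 * sin \<theta> * cos \<alpha> - sin (\<alpha> + \<theta>)"
    by (simp add: sin_add sin_diff)
  finally have 1: "cos (\<alpha> + (pi / 2 - \<theta>)) = lam * cos \<alpha> - sin (\<alpha> + \<theta>)"
    by (simp add: sin_theta)
  have 2: "sin (\<alpha> + (pi / 2 - \<theta>) + \<theta>) = cos \<alpha>" by (simp add: sin_add)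
  show ?thesis unfolding polar_def 1 2 by (simp add: Cmap_def right_diff_distrib)
qed

lemma Cmap4_polar: "(Cmap lam ^^ 4) (r *\<^sub>R polar lam \<alpha>) = r *\<^sub>R polar lam (\<alpha> - 4 * \<theta>)"
proof -
  have "(Cmap lam ^^ 4) (r *\<^sub>R polar lam \<alpha>) = r *\<^sub>R polar lam ((\<alpha> - 4 * \<theta>) + 2 * pi)"
    by (simp add: funpow_4 Cmap_polar) (simp add: algebra_simps)
  also have "polar lam ((\<alpha> - 4 * \<theta>) + 2 * pi) = polar lam (\<alpha> - 4 * \<theta>)"
    unfolding polar_def add.assoc[of "\<alpha> - 4 * \<theta>" "2 * pi" \<theta>] add.commute[of "2 * pi" \<theta>]
    unfolding add.assoc[symmetric] by simp
  finally show ?thesis .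
qed

lemma G_polar: "G (ctr lam + r *\<^sub>R polar lam \<alpha>) = ctr lam + r *\<^sub>R polar lam (pi / 2 - \<theta> - \<alpha>)"
proof -
  have "cos (pi / 2 - \<theta> - \<alpha>) = sin (\<alpha> + \<theta>)"
    by (subst cos_sin_eq) (simp add: algebra_simps)
  moreover have "sin (pi / 2 - \<theta> - \<alpha> + \<theta>) = cos \<alpha>" by (simp add: sin_diff)
  ultimately show ?thesis by (simp add: polar_def ctr_eq)
qed

lemma Q_polar: "Q lam (r *\<^sub>R polar lam \<alpha>) (r *\<^sub>R polar lam \<alpha>) = (1 - lam\<^sup>2 / 4) * r\<^sup>2"
proof -
  have "r * sin (\<alpha> + \<theta>) - lam / 2 * (r * cos \<alpha>) = r * sin \<alpha> * cos \<theta>"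
    by (simp add: sin_add sin_theta algebra_simps)
  then have "Q lam (r *\<^sub>R polar lam \<alpha>) (r *\<^sub>R polar lam \<alpha>) =
      (cos \<theta>)\<^sup>2 * (r * cos \<alpha>)\<^sup>2 + (r * sin \<alpha> * cos \<theta>)\<^sup>2"
    by (simp add: polar_def Q_diag cos_theta_sq)
  also have "\<dots> = (cos \<theta>)\<^sup>2 * r\<^sup>2 * ((sin \<alpha>)\<^sup>2 + (cos \<alpha>)\<^sup>2)"
    by (simp add: power_mult_distrib distrib_left mult_ac del: sin_cos_squared_add)
  finally show ?thesis by (simp add: cos_theta_sq)
qed

lemma polar_in_sector_iff:
  assumes "0 \<le> R"
  shows "ctr lam + R *\<^sub>R polar lam \<alpha> \<in> sector lam \<longleftrightarrow>
    \<kappa> + R * cos \<alpha> \<in> {(1 + lam) / 2<..<1} \<and> \<kappa> + R * sin (\<alpha> + \<theta>) \<in> {(1 + lam) / 2<..<1} \<and> 1 - \<kappa> < R"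
proof -
  have p: "0 < 1 - lam\<^sup>2 / 4" using discr_pos[OF lam_bounds(2)] .
  have "ellipse_level lam = (1 - lam\<^sup>2 / 4) * (1 - \<kappa>)\<^sup>2"
    by (simp add: ellipse_level_def one_minus_kap)
  moreover have "(1 - \<kappa>)\<^sup>2 < R\<^sup>2 \<longleftrightarrow> 1 - \<kappa> < R"
    using assms kap_bounds by (auto intro: power_strict_mono power2_less_imp_less)
  moreover have "(\<kappa> + R * cos \<alpha>, \<kappa> + R * sin (\<alpha> + \<theta>)) - (\<kappa>, \<kappa>) = R *\<^sub>R polar lam \<alpha>"
    by (simp add: polar_def)
  ultimately have "Q lam ((\<kappa> + R * cos \<alpha>, \<kappa> + R * sin (\<alpha> + \<theta>)) - ctr lam)
      ((\<kappa> + R * cos \<alpha>, \<kappa> + R * sin (\<alpha> + \<theta>)) - ctr lam) > ellipse_level lam \<longleftrightarrow> 1 - \<kappa> < R"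
    using p by (simp add: ctr_eq Q_polar mult_less_cancel_left_pos del: minus_prod_def diff_Pair)
  moreover have "ctr lam + R *\<^sub>R polar lam \<alpha> = (\<kappa> + R * cos \<alpha>, \<kappa> + R * sin (\<alpha> + \<theta>))"
    by (simp add: polar_def ctr_eq)
  ultimately show ?thesis by (auto simp: sector_def)
qed

section \<open>Four steps from the corner\<close>

text \<open>A point of the sector leaves it for three steps, all of them in the branch \<open>\<iota> = 1\<close>. None of the
  new first coordinates is closer to 0 or 1 than the point itself is to the sides at the corner, so the inner phase
  contributes only \<open>height\<close> to the island radius.\<close>

lemma sector_steps:
  assumes "(1 + lam) / 2 < x" "x < 1" "(1 + lam) / 2 < y" "y < 1"
  defines "x1 \<equiv> lam * x - y + 1"
  defines "x2 \<equiv> lam * x1 - x + 1"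
  defines "x3 \<equiv> lam * x2 - x1 + 1"
  shows "F lam (x, y) = (x1, x)" "F lam (x1, x) = (x2, x1)" "F lam (x2, x1) = (x3, x2)"
    and "1 - y \<le> x1" "x1 < (1 + lam) / 2" "1 - x \<le> x2" "x2 < (1 + lam) / 2"
    and "(1 - lam) / 2 < x3" "x3 \<le> y"
proof -
  have x1: "0 < lam * x" "lam * x < lam" using assms lam_pos lam_bounds by simp_all
  then show b1: "1 - y \<le> x1" "x1 < (1 + lam) / 2"
    using assms(3,4) by (simp_all add: x1_def field_simps)
  have x1': "0 < lam * x1" "lam * x1 < lam * ((1 + lam) / 2)"
    using b1 assms(4) lam_pos by (auto intro: mult_strict_left_mono)
  moreover have "lam * ((1 + lam) / 2) < lam * 1"
    using lam_pos lam_bounds by (intro mult_strict_left_mono) auto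
  ultimately show b2: "1 - x \<le> x2" "x2 < (1 + lam) / 2"
    using assms(1,2) by (simp_all add: x2_def field_simps)
  have x2': "0 < lam * x2" "lam * x2 < lam * x"
    using b2 assms(1,2) lam_pos by (auto intro: mult_strict_left_mono)
  then show b3: "(1 - lam) / 2 < x3" "x3 \<le> y"
    using b1 by (simp_all add: x3_def field_simps) (simp add: x1_def algebra_simps)
  have l1: "(1 + lam) / 2 < 1" "0 < (1 - lam) / 2" using lam_bounds by simp_all
  have r: "0 \<le> x1" "x1 < 1" "0 \<le> x2" "x2 < 1" "0 \<le> x3" "x3 < 1"
    using b1 b2 b3 l1 assms(2,4) by linarith+
  show "F lam (x, y) = (x1, x)"
    using r(1,2) by (intro F_eqI(1)[where i = 1]) (simp_all add: x1_def)
  show "F lam (x1, x) = (x2, x1)"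
    using r(3,4) by (intro F_eqI(1)[where i = 1]) (simp_all add: x2_def)
  show "F lam (x2, x1) = (x3, x2)"
    using r(5,6) by (intro F_eqI(1)[where i = 1]) (simp_all add: x3_def)
qed

text \<open>As long as the fourth iterate of the affine branch around \<open>ctr lam\<close> stays in the square,
  it is also the fourth iterate of \<open>F\<close>: the coordinate can only be correct modulo 1.\<close>

lemma F4_polar:
  assumes z: "ctr lam + R *\<^sub>R polar lam \<alpha> = (x, y)"
    and box: "(1 + lam) / 2 < x" "x < 1" "(1 + lam) / 2 < y" "y < 1"
    and x4: "0 \<le> \<kappa> + R * cos (\<alpha> - 4 * \<theta>)" "\<kappa> + R * cos (\<alpha> - 4 * \<theta>) < 1"
  shows "(F lam ^^ 4) (x, y) = ctr lam + R *\<^sub>R polar lam (\<alpha> - 4 * \<theta>)"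
proof -
  define x1 x2 x3 x4 where "x1 = lam * x - y + 1" and "x2 = lam * x1 - x + 1"
    and "x3 = lam * x2 - x1 + 1" and "x4 = lam * x3 - x2 + 1"
  have C: "Cmap lam (u - \<kappa>, v - \<kappa>) = (lam * u - v + 1 - \<kappa>, u - \<kappa>)" for u v
    using kap_eq by (simp add: Cmap_def algebra_simps)
  have "R *\<^sub>R polar lam \<alpha> = (x - \<kappa>, y - \<kappa>)"
    using z by (auto simp: ctr_eq prod_eq_iff polar_def)
  then have "(Cmap lam ^^ 4) (R *\<^sub>R polar lam \<alpha>) = (x4 - \<kappa>, x3 - \<kappa>)"
    by (simp add: funpow_4 C x1_def x2_def x3_def x4_def)
  then have eq: "ctr lam + R *\<^sub>R polar lam (\<alpha> - 4 * \<theta>) = (x4, x3)"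
    by (simp add: Cmap4_polar[symmetric] ctr_eq)
  then have "x4 = \<kappa> + R * cos (\<alpha> - 4 * \<theta>)" by (simp add: polar_def ctr_eq)
  then have "F lam (x3, x2) = (x4, x3)"
    using x4 by (intro F_eqI(1)[where i = 1]) (auto simp: x4_def)
  then show ?thesis
    using eq sector_steps(1-3)[OF box] by (simp add: funpow_4 x1_def x2_def x3_def)
qed

end

context admissible
begin

section \<open>The two phases of a regular orbit\<close>

text \<open>The direction, seen from \<open>ctr lam\<close>, of the segment of fixed points of \<open>L_in\<close> in the atom
  \<open>n\<close>: the angle \<open>\<alpha>\<close> for which the rotation by \<open>-4 * (n - 1) * \<theta>\<close> and the reflection \<open>G\<close>
  agree.\<close>

definition in_angle :: "nat \<Rightarrow> real" where
  "in_angle n = pi / 4 + (2 * real n - 5 / 2) * \<theta>"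

text \<open>The line of the segment of fixed points of \<open>L_out\<close> in the atom \<open>m\<close>, parametrised by the
  amplitude \<open>B\<close> of the oscillation about the outer cycle of period two.\<close>

definition out_pt :: "nat \<Rightarrow> real \<Rightarrow> point" where
  "out_pt m B = (a + lam + B * cos ((2 * real m + 2) * \<theta>), 1 + b - B * sin ((2 * real m + 1) * \<theta>))"

text \<open>If \<open>\<iota>\<close> is alternately 0 and 1, the solutions of the recurrence oscillate with frequency
  \<open>pi / 2 - \<theta>\<close> about the values \<open>b\<close> and \<open>a\<close>. The quarter turns are absorbed into the change
  between sine and cosine.\<close>

lemma osc_even: "lam * (a + A * cos \<psi>) - (b + A * sin (\<psi> + \<theta>)) = b - A * sin (\<psi> - \<theta>)"
proof -
  have "lam * cos \<psi> = sin (\<psi> + \<theta>) - sin (\<psi> - \<theta>)"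
    by (simp add: sin_add sin_diff sin_theta)
  then have "A * (lam * cos \<psi>) = A * (sin (\<psi> + \<theta>) - sin (\<psi> - \<theta>))" by simp
  then show ?thesis using two_b by (simp add: algebra_simps)
qed

lemma osc_odd: "lam * (b + A * sin \<psi>) - (a - A * cos (\<psi> + \<theta>)) + 1 = a + A * cos (\<psi> - \<theta>)"
proof -
  have "lam * sin \<psi> = cos (\<psi> - \<theta>) - cos (\<psi> + \<theta>)"
    by (simp add: cos_add cos_diff sin_theta)
  then have "A * (lam * sin \<psi>) = A * (cos (\<psi> - \<theta>) - cos (\<psi> + \<theta>))" by simp
  then show ?thesis using two_a by (simp add: algebra_simps)
qed

lemma sin_3: "sin (3 * \<theta>) = lam / 2 * (3 - lam\<^sup>2)"
proof -
  have "sin (3 * \<theta>) = sin (2 * \<theta> + \<theta>)" by simp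
  also have "\<dots> = sin \<theta> * (2 * (cos \<theta>)\<^sup>2 + (1 - 2 * (sin \<theta>)\<^sup>2))"
    unfolding sin_add sin_double cos_double_sin power2_eq_square by (simp only: algebra_simps)
  also have "\<dots> = lam / 2 * (3 - lam\<^sup>2)"
    by (simp add: cos_theta_sq sin_theta power_divide)
  finally show ?thesis .
qed

text \<open>For \<open>m \<le> 2\<close> the amplitude is bounded by the side \<open>x = 1\<close> of the square. The factor
  \<open>cos (6 * \<theta>) \<ge> 1 - 9 / 2 * lam\<^sup>2\<close> costs less than the term \<open>lam\<close> gains.\<close>

lemma small_m_bound:
  assumes m: "m \<le> 2" and B: "0 < B" and less: "a + lam + B * cos ((2 * real m + 2) * \<theta>) < 1"
  shows "B < 1 - a"
proof -
  have "cos (6 * \<theta>) \<le> cos ((2 * real m + 2) * \<theta>)"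
  proof (rule cos_monotone_0_pi_le)
    show "(2 * real m + 2) * \<theta> \<le> 6 * \<theta>" using m theta_bounds by simp
  qed (use theta_bounds pi_gt_zero in \<open>simp_all\<close>)
  moreover have "cos (6 * \<theta>) = 1 - 2 * (sin (3 * \<theta>))\<^sup>2"
    using cos_double_sin[of "3 * \<theta>"] by simp
  moreover have "(sin (3 * \<theta>))\<^sup>2 \<le> (3 / 2 * lam)\<^sup>2"
    unfolding sin_3 using lam_pos lam_sq by (intro power_mono mult_nonneg_nonneg) (auto simp: field_simps)
  ultimately have c: "1 - 9 / 2 * lam\<^sup>2 \<le> cos ((2 * real m + 2) * \<theta>)"
    by (simp add: power_mult_distrib power_divide)
  show ?thesis
  proof (rule ccontr)
    assume "\<not> B < 1 - a"
    then have "(1 - a) * (1 - 9 / 2 * lam\<^sup>2) \<le> B * cos ((2 * real m + 2) * \<theta>)"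
      using c a_bounds lam_sq B by (intro mult_mono) auto
    then have "(1 - a) * (1 - 9 / 2 * lam\<^sup>2) < 1 - a - lam"
      using less by simp
    then have "lam < (1 - a) * (9 / 2 * lam\<^sup>2)" by (simp add: algebra_simps)
    also have "\<dots> \<le> 1 / 2 * (9 / 2 * lam\<^sup>2)" using a_bounds by (intro mult_right_mono) auto
    finally have "lam * 1 < lam * (9 / 4 * lam)" by (simp add: power2_eq_square)
    then have "1 < 9 / 4 * lam" using lam_pos by (simp only: mult_less_cancel_left_pos)
    then show False using lam_bounds by simp
  qed
qed

end

text \<open>The point \<open>z\<close> is the intersection of the ray and the line. Near \<open>z\<close> the upper side
  of \<open>Lambda\<close> is the side \<open>y = 1\<close> of the square; the last assumption places \<open>z\<close> on the inner side
  of its opposite boundary line, because the fourth image of \<open>G z\<close> has this expression as first coordinate.\<close>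

locale regular_cycle = admissible +
  fixes m n :: nat and R B :: real and z :: point
  assumes m: "1 \<le> m" "(2 * real m + 1) * \<theta> \<le> pi / 2"
    and n: "1 \<le> n" "(4 * real n + 5) * \<theta> \<le> pi / 2"
    and z_in: "z = ctr lam + R *\<^sub>R polar lam (in_angle n)"
    and z_out: "z = out_pt m B"
    and z_sector: "z \<in> sector lam"
    and fourth_pos: "0 < b - B * sin ((2 * real m - 3) * \<theta>)"
begin

text \<open>The distance of \<open>z\<close> from the side \<open>y = 1\<close>, the first coordinate of the fourth image of
  \<open>G z\<close>, a lower bound for the distances of all orbit coordinates from 0 and 1, and the first coordinate of
  \<open>z\<close>.\<close>

definition height :: real where "height = B * sin ((2 * real m + 1) * \<theta>) - b"

definition fourth :: real where "fourth = b - B * sin ((2 * real m - 3) * \<theta>)"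

definition gap :: real where "gap = min height (min fourth (1 - a - B))"

definition s :: real where "s = a + lam + B * cos ((2 * real m + 2) * \<theta>)"

lemma z_eq: "z = (s, 1 - height)"
  using z_out by (simp add: out_pt_def height_def s_def)

lemma box: "(1 + lam) / 2 < s" "s < 1" "(1 + lam) / 2 < 1 - height" "1 - height < 1"
  using z_sector by (auto simp: z_eq sector_def)

lemma B_pos: "0 < B"
proof -
  have "0 < sin ((2 * real m + 1) * \<theta>)"
    using m theta_bounds by (intro sin_gt_zero) (auto intro: order_le_less_trans)
  moreover have "0 < B * sin ((2 * real m + 1) * \<theta>)"
    using box(4) b_bounds by (simp add: height_def)
  ultimately show ?thesis by (simp add: zero_less_mult_iff)
qed

lemma B_less_fifth: "B < 1 / 5" if "3 \<le> m"
proof -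
  have "sin (3 * \<theta>) \<le> sin ((2 * real m - 3) * \<theta>)"
  proof (rule sin_monotone_2pi_le)
    have "(2 * real m - 3) * \<theta> \<le> (2 * real m + 1) * \<theta>" using theta_bounds by simp
    then show "(2 * real m - 3) * \<theta> \<le> pi / 2" using m by linarith
    show "- (pi / 2) \<le> 3 * \<theta>" using theta_bounds pi_gt_zero by linarith
    show "3 * \<theta> \<le> (2 * real m - 3) * \<theta>" using that theta_bounds by simp
  qed
  then have "B * sin (3 * \<theta>) < b"
    using fourth_pos mult_left_mono[OF _ less_imp_le[OF B_pos], of "sin (3 * \<theta>)" "sin ((2 * real m - 3) * \<theta>)"] by linarith
  then have "lam * (B * (3 - lam\<^sup>2)) < lam * a" using two_b unfolding sin_3 by (simp add: algebra_simps)
  then have "B * (3 - lam\<^sup>2) < a" using lam_pos by simp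
  moreover have "B * (3 - 49 / 400) \<le> B * (3 - lam\<^sup>2)"
    using B_pos lam_sq by (intro mult_left_mono) auto
  ultimately show ?thesis using a_bounds by simp
qed

text \<open>The amplitude leaves room between the oscillation about \<open>a\<close> and the sides of the square. For
  \<open>m \<ge> 3\<close> this follows from the positivity of the fourth image, for smaller \<open>m\<close> from \<open>s < 1\<close>.\<close>

lemma B_less: "B < 1 - a"
proof (cases "3 \<le> m")
  case True
  then show ?thesis using B_less_fifth a_bounds by linarith
next
  case False
  then show ?thesis using small_m_bound[of m B] B_pos box(2) by (simp add: s_def)
qed

lemma gap_pos: "0 < gap"
  using box(4) fourth_pos B_less by (auto simp: gap_def fourth_def)

lemma gap_le: "gap \<le> height" "gap \<le> fourth" "gap \<le> 1 - a - B" "gap < (1 - lam) / 2"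
  using box(3) by (auto simp: gap_def min_def field_simps)

lemma even_upper: "b + B * sin ((2 * real m - 1) * \<theta>) < 1 / 2"
proof (cases "3 \<le> m")
  case True
  have "B * sin ((2 * real m - 1) * \<theta>) \<le> B * 1" using B_pos by (intro mult_left_mono) auto
  then show ?thesis using B_less_fifth[OF True] b_bounds by simp
next
  case False
  have "sin ((2 * real m - 1) * \<theta>) \<le> sin (pi / 6)"
  proof (rule sin_monotone_2pi_le)
    have "(2 * real m - 1) * \<theta> \<le> 3 * \<theta>" using False theta_bounds by simp
    then show "(2 * real m - 1) * \<theta> \<le> pi / 6" using theta_bounds by linarith
    have "0 \<le> (2 * real m - 1) * \<theta>" using m theta_bounds by simp
    then show "- (pi / 2) \<le> (2 * real m - 1) * \<theta>" using pi_gt_zero by linarith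
  qed (simp)
  then have "B * sin ((2 * real m - 1) * \<theta>) \<le> B * (1 / 2)"
    using B_pos by (intro mult_left_mono) (auto simp: sin_30)
  then show ?thesis using B_less a_bounds b_bounds by simp
qed

text \<open>The coordinates near 0 are \<open>b - B * sin (j * \<theta>)\<close> for odd \<open>j\<close>. The phase \<open>(2 * m + 1) * \<theta>\<close>
  stays below \<open>pi / 2\<close>, so the sine is monotone in \<open>j\<close> and the smallest of them is the one with the largest
  \<open>j\<close>, which is \<open>fourth\<close>.\<close>

lemma even_bounds:
  fixes j :: real
  assumes "\<bar>j\<bar> \<le> 2 * real m - 1"
  shows "b + B * sin (j * \<theta>) < 1 / 2" "j \<le> 2 * real m - 3 \<Longrightarrow> fourth \<le> b - B * sin (j * \<theta>)"
proof -
  have top: "(2 * real m - 1) * \<theta> \<le> pi / 2"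
    using m theta_bounds by (simp add: algebra_simps)
  have "- ((2 * real m - 1) * \<theta>) \<le> j * \<theta>" "j * \<theta> \<le> (2 * real m - 1) * \<theta>"
    using assms theta_bounds mult_right_mono[of "- j" "2 * real m - 1" \<theta>]
      mult_right_mono[of j "2 * real m - 1" \<theta>] by (simp_all add: abs_le_iff)
  then have j: "- (pi / 2) \<le> j * \<theta>" "j * \<theta> \<le> (2 * real m - 1) * \<theta>" using top by linarith+
  then have "B * sin (j * \<theta>) \<le> B * sin ((2 * real m - 1) * \<theta>)"
    using B_pos top by (intro mult_left_mono sin_monotone_2pi_le) auto
  then show "b + B * sin (j * \<theta>) < 1 / 2" using even_upper by linarith
  assume "j \<le> 2 * real m - 3"
  moreover have "(2 * real m - 3) * \<theta> \<le> pi / 2" using top theta_bounds by (simp add: algebra_simps)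
  ultimately have "B * sin (j * \<theta>) \<le> B * sin ((2 * real m - 3) * \<theta>)"
    using B_pos j theta_bounds by (intro mult_left_mono sin_monotone_2pi_le) auto
  then show "fourth \<le> b - B * sin (j * \<theta>)" by (simp add: fourth_def)
qed

lemma odd_bounds: "gap \<le> a + B * cos \<psi>" "a + B * cos \<psi> \<le> 1 - gap"
  "gap \<le> a - B * cos \<psi>" "a - B * cos \<psi> \<le> 1 - gap"
proof -
  have "\<bar>B * cos \<psi>\<bar> \<le> B * 1" unfolding abs_mult using B_pos by (intro mult_mono) auto
  then show "gap \<le> a + B * cos \<psi>" "a + B * cos \<psi> \<le> 1 - gap"
    "gap \<le> a - B * cos \<psi>" "a - B * cos \<psi> \<le> 1 - gap"
    using gap_le(3) a_bounds by linarith+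
qed

end

context regular_cycle
begin

subsection \<open>Rotation around the central island\<close>

definition arc_angle :: "nat \<Rightarrow> real" where
  "arc_angle k = in_angle n - 4 * real k * \<theta>"

definition arc :: "nat \<Rightarrow> point" where
  "arc k = ctr lam + R *\<^sub>R polar lam (arc_angle k)"

text \<open>The inner phase is palindromic: \<open>G\<close> exchanges its \<open>k\<close>-th point with the \<open>k\<close>-th
  point from the end.\<close>

lemma arc_angle_reflect: "k \<le> n - 1 \<Longrightarrow> pi / 2 - \<theta> - arc_angle k = arc_angle (n - 1 - k)"
  using n by (simp add: arc_angle_def in_angle_def of_nat_diff algebra_simps)

lemma arc_angle_bounds:
  assumes "k \<le> n - 1"
  shows "0 \<le> arc_angle (n - 1)" "arc_angle (n - 1) \<le> arc_angle k" "arc_angle k \<le> arc_angle 0" "arc_angle 0 \<le> pi / 2"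
proof -
  show "arc_angle (n - 1) \<le> arc_angle k" "arc_angle k \<le> arc_angle 0"
    using assms theta_bounds by (auto simp: arc_angle_def)
  show "arc_angle 0 \<le> pi / 2" "0 \<le> arc_angle (n - 1)"
    using n theta_bounds by (simp_all add: arc_angle_def in_angle_def of_nat_diff algebra_simps)
qed

lemma arc_0: "arc 0 = z"
  by (simp add: arc_def arc_angle_def z_in)

lemma G_arc: "k \<le> n - 1 \<Longrightarrow> G (arc k) = arc (n - 1 - k)"
  by (simp add: arc_def G_polar arc_angle_reflect)

lemma fst_arc: "fst (arc k) = \<kappa> + R * cos (arc_angle k)"
  by (simp add: arc_def polar_def ctr_eq)

lemma R_gt: "1 - \<kappa> < R"
proof -
  have "\<kappa> + R * cos (arc_angle 0) = s" using fst_arc[of 0] by (simp add: arc_0 z_eq)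
  then have "0 < R * cos (arc_angle 0)" using box(1) kap_less by linarith
  moreover have "0 \<le> cos (arc_angle 0)"
    using arc_angle_bounds[of 0] by (intro cos_ge_zero) linarith+
  ultimately have "0 \<le> R" by (simp add: zero_less_mult_iff)
  then show ?thesis using polar_in_sector_iff z_sector z_in by simp
qed

text \<open>Along the arc the first coordinate increases from \<open>s\<close> to \<open>1 - height\<close>, because the angles
  lie in the first quadrant. Hence the whole arc stays in the sector.\<close>

lemma arc_between:
  assumes "k \<le> n - 1"
  shows "s \<le> fst (arc k)" "fst (arc k) \<le> 1 - height" "s \<le> snd (arc k)" "snd (arc k) \<le> 1 - height"
proof -
  have R: "0 \<le> R" using R_gt kap_bounds by linarith
  have *: "s \<le> fst (arc k) \<and> fst (arc k) \<le> 1 - height" if k: "k \<le> n - 1" for k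
  proof -
    have "cos (arc_angle 0) \<le> cos (arc_angle k)" "cos (arc_angle k) \<le> cos (arc_angle (n - 1))"
      using arc_angle_bounds[OF k] pi_gt_zero by (auto intro!: cos_monotone_0_pi_le)
    then have "fst (arc 0) \<le> fst (arc k)" "fst (arc k) \<le> fst (arc (n - 1))"
      using R by (auto simp: fst_arc intro: mult_left_mono)
    moreover have "arc (n - 1) = (1 - height, s)"
      using G_arc[of 0] by (simp add: arc_0 z_eq)
    ultimately show ?thesis by (simp add: arc_0 z_eq)
  qed
  show "s \<le> fst (arc k)" "fst (arc k) \<le> 1 - height" using *[OF assms] by auto
  have "snd (arc k) = fst (arc (n - 1 - k))" using G_arc[OF assms] by (metis fst_G)
  then show "s \<le> snd (arc k)" "snd (arc k) \<le> 1 - height" using *[of "n - 1 - k"] by auto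
qed

lemma arc_in_sector: "k \<le> n - 1 \<Longrightarrow> arc k \<in> sector lam"
proof -
  assume k: "k \<le> n - 1"
  have "fst (arc k) = \<kappa> + R * cos (arc_angle k)" "snd (arc k) = \<kappa> + R * sin (arc_angle k + \<theta>)"
    by (simp_all add: arc_def polar_def ctr_eq)
  then show ?thesis
    using arc_between[OF k] box R_gt kap_bounds polar_in_sector_iff[of R "arc_angle k"]
    by (simp add: arc_def)
qed

lemma F_arc: "k \<le> n - 1 \<Longrightarrow> (F lam ^^ (4 * k)) z = arc k"
proof (induction k)
  case 0
  then show ?case by (simp add: arc_0)
next
  case (Suc k)
  obtain x y where xy: "arc k = (x, y)" by (cases "arc k")
  have "arc_angle (Suc k) = arc_angle k - 4 * \<theta>" by (simp add: arc_angle_def algebra_simps)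
  moreover have "(F lam ^^ 4) (arc k) = ctr lam + R *\<^sub>R polar lam (arc_angle k - 4 * \<theta>)"
    unfolding xy
  proof (rule F4_polar)
    show "ctr lam + R *\<^sub>R polar lam (arc_angle k) = (x, y)" using xy by (simp add: arc_def)
    show "0 \<le> \<kappa> + R * cos (arc_angle k - 4 * \<theta>)" "\<kappa> + R * cos (arc_angle k - 4 * \<theta>) < 1"
      using arc_between[OF Suc.prems] box lam_pos by (auto simp: fst_arc calculation[symmetric])
  qed (use arc_between[of k] xy Suc.prems box in auto)
  ultimately have "(F lam ^^ 4) (arc k) = arc (Suc k)" by (simp add: arc_def)
  then show ?case using Suc by (simp add: funpow_add[of 4 "4 * k", simplified])
qed

lemma F_to_G: "(F lam ^^ (4 * (n - 1))) z = G z"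
  using F_arc[of "n - 1"] G_arc[of 0] by (simp add: arc_0)

lemma sector_points:
  assumes p: "p \<in> sector lam" "s \<le> fst p" "fst p \<le> 1 - height" "s \<le> snd p" "snd p \<le> 1 - height"
    and j: "j < 4"
  shows "fst ((F lam ^^ j) p) \<in> {gap..1 - gap}" "j \<noteq> 0 \<Longrightarrow> (F lam ^^ j) p \<notin> sector lam"
proof -
  obtain x y where xy: "p = (x, y)" by (cases p)
  have pbox: "(1 + lam) / 2 < x" "x < 1" "(1 + lam) / 2 < y" "y < 1"
    using p(1) by (auto simp: xy sector_def)
  obtain x1 x2 x3 where st: "F lam (x, y) = (x1, x)" "F lam (x1, x) = (x2, x1)" "F lam (x2, x1) = (x3, x2)"
    "1 - y \<le> x1" "x1 < (1 + lam) / 2" "1 - x \<le> x2" "x2 < (1 + lam) / 2" "(1 - lam) / 2 < x3" "x3 \<le> y"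
    using sector_steps[OF pbox] by blast
  have "(1 - lam) / 2 < (1 + lam) / 2" using lam_pos by simp
  moreover have "1 - (1 + lam) / 2 = (1 - lam) / 2" by (simp add: field_simps)
  ultimately have "gap \<le> x" "x \<le> 1 - gap" "gap \<le> x1" "x1 \<le> 1 - gap" "gap \<le> x2" "x2 \<le> 1 - gap"
    "gap \<le> x3" "x3 \<le> 1 - gap"
    using st(4-9) p(2-5) gap_le pbox unfolding xy fst_conv snd_conv by linarith+
  moreover have "j = 0 \<or> j = 1 \<or> j = 2 \<or> j = 3" using j by linarith
  ultimately show "fst ((F lam ^^ j) p) \<in> {gap..1 - gap}"
    by (elim disjE) (simp_all add: xy numeral_2_eq_2 numeral_3_eq_3 st(1-3))
  assume "j \<noteq> 0"
  then have "j = 1 \<or> j = 2 \<or> j = 3" using j by linarith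
  then show "(F lam ^^ j) p \<notin> sector lam"
    using st(5,7) by (elim disjE) (simp_all add: xy numeral_2_eq_2 numeral_3_eq_3 st(1-3) sector_def)
qed

subsection \<open>Rotation around the outer two-cycle\<close>

text \<open>The first coordinates of the outer phase, in blocks of four consecutive steps, as long as it is a pure
  oscillation about the cycle of period two. The two deviations are at both ends, where one value
  \<open>\<iota> = 1\<close> replaces a 0: the orbit starts at \<open>(1 + even0 0, s)\<close> and ends with the coordinates \<open>1 + even1 m\<close>
  and \<open>lam + odd1 m = s\<close>.\<close>

definition even0 :: "nat \<Rightarrow> real" where
  "even0 k = b - B * sin ((2 * real m + 1 - 4 * real k) * \<theta>)"

definition odd0 :: "nat \<Rightarrow> real" where
  "odd0 k = a - B * cos ((2 * real m - 4 * real k) * \<theta>)"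

definition even1 :: "nat \<Rightarrow> real" where
  "even1 k = b + B * sin ((2 * real m - 1 - 4 * real k) * \<theta>)"

definition odd1 :: "nat \<Rightarrow> real" where
  "odd1 k = a + B * cos ((2 * real m - 2 - 4 * real k) * \<theta>)"

lemma even1_eq: "even1 k = lam * odd0 k - even0 k"
proof -
  have "(2 * real m - 4 * real k) * \<theta> + \<theta> = (2 * real m + 1 - 4 * real k) * \<theta>"
    "(2 * real m - 4 * real k) * \<theta> - \<theta> = (2 * real m - 1 - 4 * real k) * \<theta>"
    by (simp_all add: algebra_simps)
  then show ?thesis using osc_even[of "- B" "(2 * real m - 4 * real k) * \<theta>"]
    by (simp add: even0_def even1_def odd0_def)
qed

lemma odd1_eq: "odd1 k = lam * even1 k - odd0 k + 1"
proof -
  have "(2 * real m - 1 - 4 * real k) * \<theta> + \<theta> = (2 * real m - 4 * real k) * \<theta>"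
    "(2 * real m - 1 - 4 * real k) * \<theta> - \<theta> = (2 * real m - 2 - 4 * real k) * \<theta>"
    by (simp_all add: algebra_simps)
  then show ?thesis using osc_odd[of B "(2 * real m - 1 - 4 * real k) * \<theta>"]
    by (simp add: odd0_def even1_def odd1_def)
qed

lemma even0_Suc_eq: "even0 (Suc k) = lam * odd1 k - even1 k"
proof -
  have "(2 * real m - 2 - 4 * real k) * \<theta> + \<theta> = (2 * real m - 1 - 4 * real k) * \<theta>"
    "(2 * real m - 2 - 4 * real k) * \<theta> - \<theta> = (2 * real m + 1 - 4 * real (Suc k)) * \<theta>"
    by (simp_all add: algebra_simps)
  then show ?thesis using osc_even[of B "(2 * real m - 2 - 4 * real k) * \<theta>"]
    by (simp add: even0_def even1_def odd1_def)
qed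

lemma odd0_Suc_eq: "odd0 (Suc k) = lam * even0 (Suc k) - odd1 k + 1"
proof -
  have "(2 * real m + 1 - 4 * real (Suc k)) * \<theta> + \<theta> = (2 * real m - 2 - 4 * real k) * \<theta>"
    "(2 * real m + 1 - 4 * real (Suc k)) * \<theta> - \<theta> = (2 * real m - 4 * real (Suc k)) * \<theta>"
    by (simp_all add: algebra_simps)
  then show ?thesis using osc_odd[of "- B" "(2 * real m + 1 - 4 * real (Suc k)) * \<theta>"]
    by (simp add: even0_def odd0_def odd1_def)
qed

lemma odd0_0_eq: "odd0 0 = lam * (1 - height) - s + 1"
proof -
  have "(2 * real m + 1) * \<theta> + \<theta> = (2 * real m + 2) * \<theta>"
    "(2 * real m + 1) * \<theta> - \<theta> = (2 * real m) * \<theta>"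
    by (simp_all add: algebra_simps)
  then show ?thesis using osc_odd[of "- B" "(2 * real m + 1) * \<theta>"]
    by (simp add: odd0_def height_def s_def algebra_simps)
qed

lemma even0_0: "even0 0 = - height" and even1_m: "even1 m = - height"
  and odd0_m: "odd0 m = odd0 0" and odd1_m: "odd1 m = s - lam"
  and even0_1: "even0 1 = fourth"
proof -
  have "(2 * real m - 1 - 4 * real m) * \<theta> = - ((2 * real m + 1) * \<theta>)"
    "(2 * real m - 2 - 4 * real m) * \<theta> = - ((2 * real m + 2) * \<theta>)"
    "(2 * real m - 4 * real m) * \<theta> = - (2 * real m * \<theta>)"
    "(2 * real m + 1 - 4 * real 1) * \<theta> = (2 * real m - 3) * \<theta>"
    by (simp_all add: algebra_simps)
  then show "even0 0 = - height" "even1 m = - height" "odd0 m = odd0 0" "odd1 m = s - lam" "even0 1 = fourth"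
    by (simp_all only: even0_def even1_def odd0_def odd1_def fourth_def height_def s_def cos_minus sin_minus)
       simp_all
qed

lemma even0_bounds:
  assumes "1 \<le> k" "k \<le> m"
  shows "fourth \<le> even0 k" "even0 k < 1 / 2"
proof -
  have "(2 * real m + 1 - 4 * real k) * \<theta> = - ((4 * real k - (2 * real m + 1)) * \<theta>)"
    by (simp add: algebra_simps)
  then have "even0 k = b + B * sin ((4 * real k - (2 * real m + 1)) * \<theta>)"
    by (simp only: even0_def sin_minus)
  then show "even0 k < 1 / 2" using even_bounds(1)[of "4 * real k - (2 * real m + 1)"] assms by simp
  show "fourth \<le> even0 k"
    unfolding even0_def using assms by (intro even_bounds(2)) auto
qed

lemma even1_bounds:
  assumes "k < m"
  shows "fourth \<le> even1 k" "even1 k < 1 / 2"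
proof -
  have "(2 * real m - 1 - 4 * real k) * \<theta> = - ((4 * real k - (2 * real m - 1)) * \<theta>)"
    by (simp add: algebra_simps)
  then have "even1 k = b - B * sin ((4 * real k - (2 * real m - 1)) * \<theta>)"
    by (simp only: even1_def sin_minus)
  then show "fourth \<le> even1 k" using even_bounds(2)[of "4 * real k - (2 * real m - 1)"] assms by simp
  show "even1 k < 1 / 2"
    unfolding even1_def using assms by (intro even_bounds(1)) auto
qed

lemma odd_gap: "gap \<le> odd0 k" "odd0 k \<le> 1 - gap" "gap \<le> odd1 k" "odd1 k \<le> 1 - gap"
  using odd_bounds by (auto simp: odd0_def odd1_def)

lemma F_odd0:
  assumes "k < m" shows "F lam (odd0 k, even0 k) = (even1 k, odd0 k)"
    and "F lam (even1 k, odd0 k) = (odd1 k, even1 k)"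
    and "F lam (odd1 k, even1 k) = (even0 (Suc k), odd1 k)"
proof -
  have f: "0 < fourth" using fourth_pos by (simp add: fourth_def)
  show "F lam (odd0 k, even0 k) = (even1 k, odd0 k)"
    using even1_bounds[OF assms] f by (intro F_eqI(1)[where i = 0]) (auto simp: even1_eq)
  show "F lam (even1 k, odd0 k) = (odd1 k, even1 k)"
    using odd_gap[of k] gap_pos by (intro F_eqI(1)[where i = 1]) (auto simp: odd1_eq)
  show "F lam (odd1 k, even1 k) = (even0 (Suc k), odd1 k)"
    using even0_bounds[of "Suc k"] assms f by (intro F_eqI(1)[where i = 0]) (auto simp: even0_Suc_eq)
qed

lemma F_even0: "F lam (even0 (Suc k), odd1 k) = (odd0 (Suc k), even0 (Suc k))"
  using odd_gap[of "Suc k"] gap_pos by (intro F_eqI(1)[where i = 1]) (auto simp: odd0_Suc_eq)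

lemma G_z: "G z = (1 - height, s)"
  by (simp add: z_eq)

lemma F_outer_0: "F lam (G z) = (odd0 0, 1 - height)" "F lam (odd0 0, 1 - height) = (even1 0, odd0 0)"
proof -
  have pbox: "(1 + lam) / 2 < 1 - height" "1 - height < 1" "(1 + lam) / 2 < s" "s < 1"
    using box by auto
  show "F lam (G z) = (odd0 0, 1 - height)" "F lam (odd0 0, 1 - height) = (even1 0, odd0 0)"
    using sector_steps(1,2)[OF pbox] unfolding odd0_0_eq[symmetric] G_z
    by (simp_all add: even1_eq even0_0)
qed

lemma F_outer: "(F lam ^^ (4 * Suc k)) (G z) = (even0 (Suc k), odd1 k)" if "k < m"
  using that
proof (induction k)
  case 0
  then show ?case using F_odd0(2,3)[OF 0] F_outer_0 by (simp add: eval_nat_numeral)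
next
  case (Suc k)
  have "(F lam ^^ (4 * Suc (Suc k))) (G z) = (F lam ^^ 4) ((F lam ^^ (4 * Suc k)) (G z))"
    by (simp add: funpow_add[of 4 "4 * Suc k", simplified])
  also have "\<dots> = (even0 (Suc (Suc k)), odd1 (Suc k))"
    using Suc F_odd0[of "Suc k"] by (simp add: funpow_4 F_even0)
  finally show ?case .
qed

lemma F_outer_steps:
  assumes "k < m"
  shows "(F lam ^^ (4 * Suc k + 1)) (G z) = (odd0 (Suc k), even0 (Suc k))"
    and "Suc k < m \<Longrightarrow> (F lam ^^ (4 * Suc k + 2)) (G z) = (even1 (Suc k), odd0 (Suc k))"
    and "Suc k < m \<Longrightarrow> (F lam ^^ (4 * Suc k + 3)) (G z) = (odd1 (Suc k), even1 (Suc k))"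
proof -
  have step: "(F lam ^^ (4 * Suc k + 1)) (G z) = F lam ((F lam ^^ (4 * Suc k)) (G z))"
    "(F lam ^^ (4 * Suc k + 2)) (G z) = F lam ((F lam ^^ (4 * Suc k + 1)) (G z))"
    "(F lam ^^ (4 * Suc k + 3)) (G z) = F lam ((F lam ^^ (4 * Suc k + 2)) (G z))"
    by (simp_all add: eval_nat_numeral)
  show 1: "(F lam ^^ (4 * Suc k + 1)) (G z) = (odd0 (Suc k), even0 (Suc k))"
    unfolding step(1) F_outer[OF assms] F_even0 ..
  show 2: "(F lam ^^ (4 * Suc k + 2)) (G z) = (even1 (Suc k), odd0 (Suc k))" if "Suc k < m"
    unfolding step(2) 1 F_odd0(1)[OF that] ..
  show "(F lam ^^ (4 * Suc k + 3)) (G z) = (odd1 (Suc k), even1 (Suc k))" if "Suc k < m"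
    unfolding step(3) 2[OF that] F_odd0(2)[OF that] ..
qed

lemma F_outer_last: "(F lam ^^ (4 * m + 2)) (G z) = (1 - height, odd0 0)"
  "(F lam ^^ (4 * m + 3)) (G z) = z"
proof -
  obtain k where k: "m = Suc k" using m by (cases m) auto
  have step: "(F lam ^^ (4 * m + 2)) (G z) = F lam ((F lam ^^ (4 * m + 1)) (G z))"
    "(F lam ^^ (4 * m + 3)) (G z) = F lam ((F lam ^^ (4 * m + 2)) (G z))"
    by (simp_all add: eval_nat_numeral)
  have "(F lam ^^ (4 * m + 1)) (G z) = (odd0 m, even0 m)"
    using F_outer_steps(1)[of k] by (simp add: k)
  moreover have "F lam (odd0 m, even0 m) = (1 - height, odd0 m)"
    using even1_m even1_eq[of m] box lam_pos by (intro F_eqI(1)[where i = 1]) auto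
  ultimately show 2: "(F lam ^^ (4 * m + 2)) (G z) = (1 - height, odd0 0)"
    unfolding step(1) by (simp add: odd0_m)
  have "F lam (1 - height, odd0 0) = (s, 1 - height)"
    using odd1_m odd1_eq[of m] even1_m odd0_m box lam_pos
    by (intro F_eqI(1)[where i = 1]) (auto simp: algebra_simps)
  then show "(F lam ^^ (4 * m + 3)) (G z) = z"
    unfolding step(2) 2 by (simp add: z_eq)
qed

text \<open>From the fourth step on, one of any two consecutive coordinates is less than one half, until the orbit is
  one step before \<open>z\<close>.\<close>

lemma outer_points:
  assumes "4 \<le> j" "j \<le> 4 * m + 2"
  shows "fst ((F lam ^^ j) (G z)) \<in> {gap..1 - gap}" "(F lam ^^ j) (G z) \<notin> sector lam"
proof -
  obtain k where k: "j div 4 = Suc k" using assms(1) by (cases "j div 4") auto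
  have j: "j = 4 * Suc k + j mod 4" using k by (metis mult.commute div_mult_mod_eq add.commute)
  have "4 * Suc k \<le> j" by (subst j) simp
  then have km: "k < m" using assms(2) by presburger
  have half: "gap < 1 / 2" using gap_le(4) lam_pos by simp
  have low: "x < 1 / 2 \<Longrightarrow> (x, y) \<notin> sector lam" "x < 1 / 2 \<Longrightarrow> (y, x) \<notin> sector lam" for x y
    using lam_pos by (auto simp: sector_def)
  have f: "gap \<le> fourth" using gap_le by simp
  consider "j mod 4 = 0" | "j mod 4 = 1" | "j mod 4 = 2" "Suc k < m" | "j mod 4 = 3" "Suc k < m"
    | "j = 4 * m + 2"
    using assms(2) j km by fastforce
  then have "fst ((F lam ^^ j) (G z)) \<in> {gap..1 - gap} \<and> (F lam ^^ j) (G z) \<notin> sector lam"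
  proof cases
    case 1
    then have "(F lam ^^ j) (G z) = (even0 (Suc k), odd1 k)" using F_outer[OF km] j by simp
    then show ?thesis using even0_bounds[of "Suc k"] km low f half by auto
  next
    case 2
    then have "(F lam ^^ j) (G z) = (odd0 (Suc k), even0 (Suc k))" using F_outer_steps(1)[OF km] j by simp
    then show ?thesis using even0_bounds[of "Suc k"] odd_gap[of "Suc k"] km low by auto
  next
    case 3
    then have "(F lam ^^ j) (G z) = (even1 (Suc k), odd0 (Suc k))" using F_outer_steps(2)[OF km] j by simp
    then show ?thesis using even1_bounds[of "Suc k"] 3 low f half by auto
  next
    case 4
    then have "(F lam ^^ j) (G z) = (odd1 (Suc k), even1 (Suc k))" using F_outer_steps(3)[OF km] j by simp
    then show ?thesis using even1_bounds[of "Suc k"] odd_gap[of "Suc k"] 4 low by auto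
  next
    case 5
    have pbox: "(1 + lam) / 2 < 1 - height" "1 - height < 1" "(1 + lam) / 2 < s" "s < 1"
      using box by auto
    have "odd0 0 < (1 + lam) / 2"
      using sector_steps(5)[OF pbox] by (simp add: odd0_0_eq)
    then have "(1 - height, odd0 0) \<notin> sector lam" by (simp add: sector_def)
    then show ?thesis using 5 F_outer_last(1) gap_le box lam_pos by auto
  qed
  then show "fst ((F lam ^^ j) (G z)) \<in> {gap..1 - gap}" "(F lam ^^ j) (G z) \<notin> sector lam" by auto
qed

end

lemma sector_subset_Omega: "-1 < lam \<Longrightarrow> sector lam \<subseteq> Omega"
  by (auto simp: sector_def Omega_def)

lemma G_sector [simp]: "G z \<in> sector lam \<longleftrightarrow> z \<in> sector lam"
proof (cases z)
  case (Pair x y)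
  have "Q lam ((y, x) - ctr lam) ((y, x) - ctr lam) = Q lam ((x, y) - ctr lam) ((x, y) - ctr lam)"
    by (simp add: Q_def ctr_def)
  then show ?thesis by (auto simp: Pair sector_def)
qed

lemma G_image_iff: "z \<in> G ` A \<longleftrightarrow> G z \<in> A"
  by (metis G_G imageE imageI)

context regular_cycle
begin

subsection \<open>The periodic orbit\<close>

definition period :: nat where "period = 4 * (m + n) - 1"

lemma period_eq: "period = 4 * (n - 1) + (4 * m + 3)"
  using m n by (simp add: period_def)

lemma period_pos: "0 < period"
  by (simp add: period_eq)

lemma z_Omega: "z \<in> Omega"
  using z_sector sector_subset_Omega lam_pos by force

lemma F_phase: "(F lam ^^ (4 * (n - 1) + j)) z = (F lam ^^ j) (G z)"
  by (simp add: F_to_G add.commute[of _ j] funpow_add del: One_nat_def)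

lemma F_period: "(F lam ^^ period) z = z"
  unfolding period_eq F_phase by (rule F_outer_last)

lemma F_period_mod: "(F lam ^^ i) z = (F lam ^^ (i mod period)) z"
  using F_period by (simp add: funpow_mod_eq)

text \<open>By reversibility the fourth preimage of \<open>z\<close> is the mirror image of the fourth image of
  \<open>G z\<close>, which has left the sector.\<close>

lemma z_in_Lambda: "z \<in> Lambda lam"
proof -
  have "z \<noteq> (F lam ^^ 4) q" if q: "q \<in> sector lam" for q
  proof
    assume z: "z = (F lam ^^ 4) q"
    have "q \<in> Omega" using q sector_subset_Omega lam_pos by force
    then have "G q = (F lam ^^ 4) (G z)" unfolding z by (simp add: F_power_G_F_power)
    also have "\<dots> \<notin> sector lam" using outer_points(2)[of 4] m by simp
    finally show False using q by simp
  qed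
  then show ?thesis using z_sector by (auto simp: Lambda_def)
qed

lemma phase_cases:
  assumes "i < period"
  obtains (inner) k j where "k < n - 1" "j < 4" "i = 4 * k + j" "(F lam ^^ i) z = (F lam ^^ j) (arc k)"
  | (entry) j where "j < 4" "i = 4 * (n - 1) + j" "(F lam ^^ i) z = (F lam ^^ j) (arc (n - 1))"
  | (outer) j where "4 \<le> j" "j \<le> 4 * m + 2" "i = 4 * (n - 1) + j" "(F lam ^^ i) z = (F lam ^^ j) (G z)"
proof (cases "i < 4 * (n - 1)")
  case True
  define k j where "k = i div 4" and "j = i mod 4"
  have "k < n - 1" "j < 4" "i = 4 * k + j" using True by (auto simp: k_def j_def)
  moreover have "(F lam ^^ i) z = (F lam ^^ j) (arc k)"
    using F_arc[of k] \<open>k < n - 1\<close> by (simp add: \<open>i = 4 * k + j\<close> add.commute[of _ j] funpow_add)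
  ultimately show thesis by (rule inner)
next
  case False
  define j where "j = i - 4 * (n - 1)"
  have ij: "i = 4 * (n - 1) + j" using False by (simp add: j_def)
  have F: "(F lam ^^ i) z = (F lam ^^ j) (G z)" unfolding ij by (rule F_phase)
  have le: "j \<le> 4 * m + 2" using assms unfolding ij period_eq by simp
  show thesis
  proof (cases "j < 4")
    case True
    then show thesis using entry ij F G_arc[of 0] by (simp add: arc_0)
  next
    case False
    then show thesis using outer[of j] ij F le by simp
  qed
qed

lemma orbit_gap: "fst ((F lam ^^ i) z) \<in> {gap..1 - gap}"
proof -
  have "i mod period < period" using period_pos by simp
  then have "fst ((F lam ^^ (i mod period)) z) \<in> {gap..1 - gap}"
  proof (cases rule: phase_cases)
    case (inner k j)
    then show ?thesis
      using sector_points(1)[OF arc_in_sector arc_between[of k], of j] by simp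
  next
    case (entry j)
    then show ?thesis
      using sector_points(1)[OF arc_in_sector arc_between[of "n - 1"], of j] by simp
  next
    case (outer j)
    then show ?thesis using outer_points(1) by simp
  qed
  then show ?thesis using F_period_mod[of i] by simp
qed

text \<open>In the inner phase every fourth point after \<open>z\<close> is the fourth image of a point of the sector, and
  such points are removed from \<open>Lambda\<close>. The remaining points of the cycle are outside the sector.\<close>

lemma not_in_Lambda:
  assumes "0 < i" "i < period"
  shows "(F lam ^^ i) z \<notin> Lambda lam"
proof -
  have arc: "(F lam ^^ j) (arc k) \<notin> Lambda lam" if k: "k \<le> n - 1" and j: "j < 4" and pos: "0 < 4 * k + j" for k j
  proof (cases "j = 0")
    case True
    then obtain l where l: "k = Suc l" using pos by (cases k) auto
    have "arc k = (F lam ^^ (4 + 4 * l)) z" using F_arc[OF k] by (simp add: l)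
    also have "\<dots> = (F lam ^^ 4) (arc l)" unfolding funpow_add using F_arc[of l] k by (simp add: l)
    finally have "arc k \<in> (F lam ^^ 4) ` sector lam" using arc_in_sector[of l] k l by auto
    then show ?thesis using True by (simp add: Lambda_def)
  next
    case False
    then show ?thesis
      using sector_points(2)[OF arc_in_sector[OF k] arc_between[OF k] j] by (auto simp: Lambda_def)
  qed
  show ?thesis
    using assms(2)
  proof (cases rule: phase_cases)
    case (outer j)
    then show ?thesis using outer_points(2)[of j] by (simp add: Lambda_def)
  qed (use arc assms(1) in auto)
qed

lemma F_power_eq_iff:
  assumes "(F lam ^^ (i + j)) z = (F lam ^^ i) z"
  shows "(F lam ^^ j) z = z"
proof -
  have "(F lam ^^ i) ((F lam ^^ j) z) = (F lam ^^ i) z" using assms by (simp add: funpow_add)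
  then show ?thesis using F_power_inj[OF F_power_in_Omega[OF z_Omega] z_Omega] by simp
qed

text \<open>The reflected orbit is the orbit of \<open>G z\<close> backwards, which is a point of the cycle.\<close>

lemma G_F_power: "G ((F lam ^^ i) z) = (F lam ^^ (4 * (n - 1) + i * (period - 1))) z"
proof -
  define k where "k = 4 * (n - 1) + i * (period - 1)"
  have k: "i + k = 4 * (n - 1) + i * period"
    using period_pos by (cases period) (simp_all add: k_def)
  have "(F lam ^^ i) ((F lam ^^ k) z) = (F lam ^^ (i + k)) z" by (simp add: funpow_add)
  also have "\<dots> = (F lam ^^ ((4 * (n - 1) + i * period) mod period)) z"
    unfolding k by (rule F_period_mod)
  also have "\<dots> = (F lam ^^ (4 * (n - 1))) z"
    unfolding mod_mult_self1 by (rule F_period_mod[symmetric])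
  also have "\<dots> = G z" by (rule F_to_G)
  also have "\<dots> = (F lam ^^ i) (G ((F lam ^^ i) z))" by (simp add: F_power_G_F_power z_Omega)
  finally have eq: "(F lam ^^ i) ((F lam ^^ k) z) = (F lam ^^ i) (G ((F lam ^^ i) z))" .
  show ?thesis
    unfolding k_def[symmetric]
    by (rule F_power_inj[OF _ _ eq, symmetric]) (simp_all add: F_power_in_Omega z_Omega)
qed

lemma Lambda_times: "(F lam ^^ i) z \<in> Lambda lam \<longleftrightarrow> period dvd i"
proof -
  have "i mod period < period" using period_pos by simp
  then show ?thesis
    using F_period_mod[of i] not_in_Lambda[of "i mod period"] z_in_Lambda by (auto simp: dvd_eq_mod_eq_0)
qed

text \<open>By symmetry the cycle meets \<open>G ` Lambda lam\<close> only in \<open>G z\<close>.\<close>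

lemma G_Lambda_first: "(LEAST t. (F lam ^^ t) z \<in> G ` Lambda lam) = 4 * (n - 1)"
proof (rule Least_equality)
  show "(F lam ^^ (4 * (n - 1))) z \<in> G ` Lambda lam"
    using F_to_G z_in_Lambda by simp
next
  fix t assume "(F lam ^^ t) z \<in> G ` Lambda lam"
  then have t: "G ((F lam ^^ t) z) \<in> Lambda lam" by (simp add: G_image_iff)
  show "4 * (n - 1) \<le> t"
  proof (rule ccontr)
    assume less: "\<not> 4 * (n - 1) \<le> t"
    have "(F lam ^^ t) ((F lam ^^ (4 * (n - 1) - t)) z) = (F lam ^^ (t + (4 * (n - 1) - t))) z"
      by (simp only: funpow_add comp_apply)
    also have "t + (4 * (n - 1) - t) = 4 * (n - 1)" using less by simp
    also have "(F lam ^^ (4 * (n - 1))) z = (F lam ^^ t) (G ((F lam ^^ t) z))"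
      by (simp only: F_to_G F_power_G_F_power[OF z_Omega])
    finally have eq: "(F lam ^^ t) ((F lam ^^ (4 * (n - 1) - t)) z) = (F lam ^^ t) (G ((F lam ^^ t) z))" .
    have "(F lam ^^ (4 * (n - 1) - t)) z = G ((F lam ^^ t) z)"
      by (rule F_power_inj[OF _ _ eq]) (simp_all add: F_power_in_Omega z_Omega)
    then have "period dvd 4 * (n - 1) - t" using t by (simp only: Lambda_times[symmetric])
    then have "period \<le> 4 * (n - 1) - t" using less by (intro dvd_imp_le) auto
    then show False by (simp add: period_eq)
  qed
qed

lemma Lambda_first_after: "(LEAST t. t \<ge> 1 \<and> (F lam ^^ t) (G z) \<in> Lambda lam) = 4 * m + 3"
proof (rule Least_equality)
  show "4 * m + 3 \<ge> 1 \<and> (F lam ^^ (4 * m + 3)) (G z) \<in> Lambda lam"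
    using F_outer_last z_in_Lambda by simp
next
  fix t assume "t \<ge> 1 \<and> (F lam ^^ t) (G z) \<in> Lambda lam"
  then have "t \<ge> 1" "period dvd 4 * (n - 1) + t" using Lambda_times[of "4 * (n - 1) + t"] F_phase[of t] by auto
  then show "4 * m + 3 \<le> t"
    using dvd_imp_le[of period "4 * (n - 1) + t"] by (simp add: period_eq)
qed

lemma L_fixed: "L lam z = z"
proof -
  have "Lbar_in lam z = G z" by (simp only: Lbar_in_def G_Lambda_first F_to_G)
  moreover have "Lbar_out lam (G z) = z" by (simp only: Lbar_out_def Lambda_first_after F_outer_last)
  ultimately show ?thesis by (simp add: L_def L_in_def L_out_def)
qed

lemma orbit_eq: "orbit lam z = (\<lambda>i. (F lam ^^ i) z) ` {..<period}"
proof -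
  have "(F lam ^^ i) z \<in> (\<lambda>i. (F lam ^^ i) z) ` {..<period}" for i
    using F_period_mod[of i] period_pos by (intro image_eqI[of _ _ "i mod period"]) auto
  then show ?thesis by (auto simp: orbit_def)
qed

lemma card_orbit: "card (orbit lam z) = period"
proof -
  have "i = j" if "i \<le> j" "j < period" "(F lam ^^ i) z = (F lam ^^ j) z" for i j
  proof -
    have "(F lam ^^ (j - i)) z = z" using that by (intro F_power_eq_iff[of i]) auto
    then have "period dvd j - i" using z_in_Lambda Lambda_times by metis
    then show ?thesis using that dvd_imp_le[of period "j - i"] by (cases "i < j") auto
  qed
  then have "inj_on (\<lambda>i. (F lam ^^ i) z) {..<period}"
    by (intro inj_onI) (metis lessThan_iff nat_le_linear)
  then show ?thesis by (simp add: orbit_eq card_image)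
qed

lemma orbit_Lambda: "orbit lam z \<inter> Lambda lam = {z}"
proof -
  have "(F lam ^^ i) z = z" if "(F lam ^^ i) z \<in> Lambda lam" for i
    using that F_period_mod[of i] by (simp add: Lambda_times dvd_eq_mod_eq_0)
  moreover have "z \<in> orbit lam z" unfolding orbit_def by (metis funpow_0 rangeI)
  ultimately show ?thesis using z_in_Lambda by (auto simp: orbit_def)
qed

lemma snd_orbit: "snd ((F lam ^^ i) z) \<in> {gap..1 - gap}"
proof -
  have "(F lam ^^ i) z = (F lam ^^ (i + period)) z"
    using F_period_mod[of "i + period"] F_period_mod[of i] by (simp only: mod_add_self2)
  also have "i + period = Suc (i + (period - 1))" using period_pos by simp
  finally show ?thesis using orbit_gap[of "i + (period - 1)"] by simp
qed

lemma stable: "stable_symmetric_cycle lam (orbit lam z)"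
proof -
  have "(F lam ^^ period) z = z" "period \<ge> 1" using F_period period_pos by auto
  moreover have "orbit lam z \<subseteq> Omega" using F_power_in_Omega[OF z_Omega] by (auto simp: orbit_def)
  moreover have "G ` orbit lam z = orbit lam z"
  proof -
    have "G p \<in> orbit lam z" if "p \<in> orbit lam z" for p
      using that by (auto simp: orbit_def G_F_power)
    then show ?thesis by (auto simp: G_image_iff)
  qed
  moreover have "p \<in> interior (cell lam p) \<and> area lam (cell lam p) > 0" if p: "p \<in> orbit lam z" for p
  proof -
    obtain i where i: "p = (F lam ^^ i) z" using p by (auto simp: orbit_def)
    have "(F lam ^^ k) p = (F lam ^^ (k + i)) z" for k by (simp add: i funpow_add)
    then have "{q. Q lam (q - p) (q - p) < (1 - lam\<^sup>2 / 4) * gap\<^sup>2} \<subseteq> cell lam p"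
      using orbit_gap snd_orbit i by (intro Q_disc_subset_cell lam_bounds gap_pos) auto
    moreover have "p \<in> {q. Q lam (q - p) (q - p) < (1 - lam\<^sup>2 / 4) * gap\<^sup>2}"
      using discr_pos[OF lam_bounds(2)] gap_pos by (simp add: Q_def zero_prod_def)
    ultimately have "p \<in> interior (cell lam p)" using interior_maximal[OF _ open_Q_disc] by blast
    then show ?thesis using area_cell_pos[OF lam_bounds(2)] by blast
  qed
  ultimately show ?thesis unfolding stable_symmetric_cycle_def by blast
qed

lemma island_radius_bounds:
  "gap \<le> island_radius (orbit lam z)" "island_radius (orbit lam z) \<le> height"
  "island_radius (orbit lam z) \<le> fourth"
proof -
  let ?f = "\<lambda>p::point. min (fst p) (1 - fst p)"
  have r: "island_radius (orbit lam z) = Inf (?f ` orbit lam z)"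
    by (simp add: island_radius_def case_prod_unfold)
  have low: "gap \<le> ?f p" if p: "p \<in> orbit lam z" for p
  proof -
    obtain i where "p = (F lam ^^ i) z" using p by (auto simp: orbit_def)
    then show ?thesis using orbit_gap[of i] by simp
  qed
  show "gap \<le> island_radius (orbit lam z)"
    unfolding r using low by (intro cINF_greatest) (auto simp: orbit_def)
  have bdd: "bdd_below (?f ` orbit lam z)" using low by (rule bdd_belowI2)
  have up: "island_radius (orbit lam z) \<le> min x (1 - x)" if "(F lam ^^ i) z = (x, y)" for i x y
  proof -
    have "(x, y) \<in> orbit lam z" unfolding orbit_def using that by (metis rangeI)
    from cINF_lower[OF bdd this] show ?thesis unfolding r by simp
  qed
  have "(F lam ^^ (4 * (n - 1))) z = (1 - height, s)" by (simp only: F_to_G G_z)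
  from up[OF this] show "island_radius (orbit lam z) \<le> height" by simp
  have "(F lam ^^ (4 * (n - 1) + 4 * Suc 0)) z = (even0 (Suc 0), odd1 0)"
    unfolding F_phase using F_outer[of 0] m by simp
  from up[OF this] show "island_radius (orbit lam z) \<le> fourth" using even0_1 by simp
qed

end

context admissible
begin

section \<open>The segments of fixed points\<close>

lemma M_bound: "m \<le> M lam \<Longrightarrow> 1 \<le> m \<Longrightarrow> (2 * real m + 1) * \<theta> \<le> pi / 2"
proof -
  assume "m \<le> M lam" "1 \<le> m"
  then have "int m \<le> \<lfloor>pi / (4 * \<theta>) - 1 / 2\<rfloor>" by (simp add: M_def)
  then have "real m \<le> pi / (4 * \<theta>) - 1 / 2" by (simp add: le_floor_iff)
  then show ?thesis using theta_bounds by (simp add: field_simps)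
qed

lemma N_bound: "n + 1 \<le> N lam \<Longrightarrow> (4 * real n + 5) * \<theta> \<le> pi / 2"
proof -
  assume "n + 1 \<le> N lam"
  then have "int (n + 1) \<le> \<lfloor>pi / (8 * \<theta>) - 1 / 4\<rfloor>" by (simp add: N_def)
  then have "real (n + 1) \<le> pi / (8 * \<theta>) - 1 / 4" by (simp add: le_floor_iff del: of_nat_add of_nat_1)
  then show ?thesis using theta_bounds by (simp add: field_simps)
qed

lemma le_M: "(2 * real m + 1) * \<theta> \<le> pi / 2 \<Longrightarrow> m \<le> M lam"
  using theta_bounds by (simp add: M_def le_nat_iff le_floor_iff field_simps)

lemma le_N: "(4 * real n + 5) * \<theta> \<le> pi / 2 \<Longrightarrow> n + 1 \<le> N lam"
proof -
  assume "(4 * real n + 5) * \<theta> \<le> pi / 2"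
  then have "real (n + 1) \<le> pi / (8 * \<theta>) - 1 / 4" using theta_bounds by (simp add: field_simps)
  then have "int (n + 1) \<le> \<lfloor>pi / (8 * \<theta>) - 1 / 4\<rfloor>" by (simp add: le_floor_iff del: of_nat_add of_nat_1)
  then show ?thesis unfolding N_def by linarith
qed

lemma cos_4: "cos (4 * \<theta>) = 1 - 2 * lam\<^sup>2 + lam ^ 4 / 2"
  and sin_4: "sin (4 * \<theta>) = lam * (2 - lam\<^sup>2) * cos \<theta>"
  and cos_5: "cos (5 * \<theta>) = (1 - 3 * lam\<^sup>2 + lam ^ 4) * cos \<theta>"
  and sin_5: "sin (5 * \<theta>) = lam / 2 * (5 - 5 * lam\<^sup>2 + lam ^ 4)"
  and cos_6: "cos (6 * \<theta>) = 1 - lam\<^sup>2 / 2 * (3 - lam\<^sup>2)\<^sup>2"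
proof -
  have s2: "sin (2 * \<theta>) = lam * cos \<theta>" by (simp add: sin_double sin_theta)
  have c2: "cos (2 * \<theta>) = 1 - lam\<^sup>2 / 2" by (simp add: cos_double_sin sin_theta power_divide)
  have c4: "cos (4 * \<theta>) = 1 - 2 * (lam * cos \<theta>)\<^sup>2"
    using cos_double_sin[of "2 * \<theta>"] by (simp add: s2)
  show cos4: "cos (4 * \<theta>) = 1 - 2 * lam\<^sup>2 + lam ^ 4 / 2"
    unfolding c4 power_mult_distrib cos_theta_sq by (simp add: algebra_simps eval_nat_numeral)
  show sin4: "sin (4 * \<theta>) = lam * (2 - lam\<^sup>2) * cos \<theta>"
  proof -
    have "sin (4 * \<theta>) = 2 * sin (2 * \<theta>) * cos (2 * \<theta>)" using sin_double[of "2 * \<theta>"] by simp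
    then show ?thesis unfolding s2 c2 by (simp add: algebra_simps)
  qed
  have five: "5 * \<theta> = 4 * \<theta> + \<theta>" by simp
  show "cos (5 * \<theta>) = (1 - 3 * lam\<^sup>2 + lam ^ 4) * cos \<theta>"
    unfolding five cos_add cos4 sin4 by (simp add: sin_theta algebra_simps eval_nat_numeral)
  have "sin (5 * \<theta>) = lam * (2 - lam\<^sup>2) * (cos \<theta>)\<^sup>2 + (1 - 2 * lam\<^sup>2 + lam ^ 4 / 2) * (lam / 2)"
    unfolding five sin_add cos4 sin4 by (simp add: sin_theta power2_eq_square)
  then show "sin (5 * \<theta>) = lam / 2 * (5 - 5 * lam\<^sup>2 + lam ^ 4)"
    unfolding cos_theta_sq by (simp add: algebra_simps eval_nat_numeral)
  show "cos (6 * \<theta>) = 1 - lam\<^sup>2 / 2 * (3 - lam\<^sup>2)\<^sup>2"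
    using cos_double_sin[of "3 * \<theta>"] by (simp add: sin_3 power_mult_distrib power_divide)
qed

lemma four_minus: "4 - lam\<^sup>2 = 4 * (cos \<theta>)\<^sup>2"
  by (simp add: cos_theta_sq)

lemma b_cos: "b * cos \<theta> = tan \<theta> / 2"
proof -
  have "b = lam / (4 * (cos \<theta>)\<^sup>2)" by (simp only: eb_def four_minus)
  then show ?thesis using cos_theta_pos by (simp add: tan_def sin_theta power2_eq_square)
qed

lemma quotient_cos_add: "sin \<psi> \<noteq> 0 \<Longrightarrow> c / sin \<psi> * cos (\<psi> + \<delta>) = c * cos \<delta> * (cos \<psi> / sin \<psi>) - c * sin \<delta>"
  for c \<psi> \<delta> :: real
  by (simp add: cos_add field_simps)

lemma quotient_sin_add: "sin \<psi> \<noteq> 0 \<Longrightarrow> c / sin \<psi> * sin (\<psi> + \<delta>) = c * cos \<delta> + c * sin \<delta> * (cos \<psi> / sin \<psi>)"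
  for c \<psi> \<delta> :: real
  by (simp add: sin_add field_simps)

lemma a_mult: "(4 - lam\<^sup>2) * a = 2" and b_mult: "(4 - lam\<^sup>2) * b = lam" and four_minus_nonzero: "4 - lam\<^sup>2 \<noteq> 0"
proof -
  show p: "4 - lam\<^sup>2 \<noteq> 0" using lam_sq by simp
  show "(4 - lam\<^sup>2) * a = 2" "(4 - lam\<^sup>2) * b = lam"
    unfolding ea_def eb_def times_divide_eq_right by (rule nonzero_mult_div_cancel_left[OF p])+
qed

lemma tan_quotient: "tan \<theta> / tan \<psi> = tan \<theta> * (cos \<psi> / sin \<psi>)"
  by (simp add: tan_def)

text \<open>The end points of the segments of fixed points of \<open>L_out\<close> are the points where the
  orbit touches a side of the square: in \<open>P0 lam m\<close> the point itself, in \<open>P1 lam m\<close> the fourth iterate of its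
  mirror image if \<open>2 \<le> m\<close>, and the point itself otherwise.\<close>

lemma P0_eq:
  assumes "sin ((2 * real m + 1) * \<theta>) \<noteq> 0"
  shows "P0 lam m = out_pt m (b / sin ((2 * real m + 1) * \<theta>))"
proof -
  define \<psi> where "\<psi> = (2 * real m + 1) * \<theta>"
  have angle: "(2 * real m + 2) * \<theta> = \<psi> + \<theta>" by (simp add: \<psi>_def algebra_simps)
  have sin: "sin \<psi> \<noteq> 0" using assms by (simp add: \<psi>_def)
  have "b / sin \<psi> * cos (\<psi> + \<theta>) = b * cos \<theta> * (cos \<psi> / sin \<psi>) - b * sin \<theta>"
    using sin by (rule quotient_cos_add)
  moreover have "a - b * sin \<theta> = 1 / 2"
    using two_a by (simp add: sin_theta algebra_simps)
  ultimately have "a + lam + b / sin \<psi> * cos (\<psi> + \<theta>) = 1 / 2 * (1 + 2 * lam + tan \<theta> * (cos \<psi> / sin \<psi>))"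
    unfolding b_cos by argo
  then show ?thesis using sin
    unfolding P0_def out_pt_def tan_quotient angle \<psi>_def[symmetric] by simp
qed

lemma P1_eq:
  assumes m: "2 \<le> m" and sin: "sin ((2 * real m - 1) * \<theta>) \<noteq> 0"
  shows "P1 lam m = out_pt (m + 1) (b / sin ((2 * real m - 1) * \<theta>))"
proof -
  let ?\<psi> = "(2 * real m - 1) * \<theta>"
  let ?c = "cos ?\<psi> / sin ?\<psi>"
  have angles: "(2 * real (m + 1) + 2) * \<theta> = ?\<psi> + 5 * \<theta>" "(2 * real (m + 1) + 1) * \<theta> = ?\<psi> + 4 * \<theta>"
    by (simp_all add: algebra_simps)
  note p = four_minus_nonzero
  have "b / sin ?\<psi> * cos (?\<psi> + 5 * \<theta>) = b * cos (5 * \<theta>) * ?c - b * sin (5 * \<theta>)"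
    using sin by (rule quotient_cos_add)
  also have "b * cos (5 * \<theta>) = (1 - 3 * lam\<^sup>2 + lam ^ 4) * tan \<theta> / 2"
    using b_cos by (simp add: cos_5 mult.left_commute)
  finally have x: "b / sin ?\<psi> * cos (?\<psi> + 5 * \<theta>) =
      (1 - 3 * lam\<^sup>2 + lam ^ 4) * tan \<theta> / 2 * ?c - b * sin (5 * \<theta>)" .
  have x0: "a - b * sin (5 * \<theta>) = 1 / 2 * (1 - lam\<^sup>2 + lam ^ 4)"
  proof -
    have "(4 - lam\<^sup>2) * (a - b * sin (5 * \<theta>)) = 2 - lam * sin (5 * \<theta>)"
      using a_mult b_mult by (simp add: right_diff_distrib mult.assoc[symmetric])
    also have "\<dots> = (4 - lam\<^sup>2) * (1 / 2 * (1 - lam\<^sup>2 + lam ^ 4))"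
      unfolding sin_5 by (simp add: field_simps eval_nat_numeral)
    finally show ?thesis using p by (simp only: mult_cancel_left) simp
  qed
  have "b / sin ?\<psi> * sin (?\<psi> + 4 * \<theta>) = b * cos (4 * \<theta>) + b * sin (4 * \<theta>) * ?c"
    using sin by (rule quotient_sin_add)
  also have "b * sin (4 * \<theta>) = lam / 2 * (2 - lam\<^sup>2) * tan \<theta>"
  proof -
    have "b * sin (4 * \<theta>) = lam * (2 - lam\<^sup>2) * (b * cos \<theta>)" by (simp add: sin_4)
    then show ?thesis unfolding b_cos by simp
  qed
  finally have y: "b / sin ?\<psi> * sin (?\<psi> + 4 * \<theta>) = b * cos (4 * \<theta>) + lam / 2 * (2 - lam\<^sup>2) * tan \<theta> * ?c" .
  have y0: "b - b * cos (4 * \<theta>) = lam ^ 3 / 2"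
  proof -
    have "(4 - lam\<^sup>2) * (b - b * cos (4 * \<theta>)) = lam - lam * cos (4 * \<theta>)"
      using b_mult by (simp add: right_diff_distrib mult.assoc[symmetric])
    also have "\<dots> = (4 - lam\<^sup>2) * (lam ^ 3 / 2)"
      unfolding cos_4 by (simp add: field_simps eval_nat_numeral)
    finally show ?thesis using p by (simp only: mult_cancel_left) simp
  qed
  define q where "q = tan \<theta> * ?c"
  have "P1 lam m = (1 / 2 * (1 + 2 * lam - lam\<^sup>2 + lam ^ 4 + (1 - 3 * lam\<^sup>2 + lam ^ 4) * q),
      1 + lam ^ 3 / 2 + lam / 2 * (lam\<^sup>2 - 2) * q)"
    using m by (simp add: P1_def tan_quotient q_def)
  also have "\<dots> = (1 / 2 * (1 - lam\<^sup>2 + lam ^ 4) + lam + (1 - 3 * lam\<^sup>2 + lam ^ 4) * q / 2,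
      1 + lam ^ 3 / 2 - lam / 2 * (2 - lam\<^sup>2) * q)"
    by (simp add: field_simps)
  finally show ?thesis
    unfolding out_pt_def angles x y x0[symmetric] y0[symmetric] q_def by simp
qed

lemma quotient_eqI:
  fixes c d :: real
  assumes "x * d = y * (2 * c) - w * (2 * t)" "d * p = y" "d * q = w" "d \<noteq> 0" "c \<noteq> 0"
  shows "x / (2 * c) = p - q / c * t"
proof -
  have "d * x = d * (2 * (c * p - q * t))"
    using assms(1) unfolding assms(2,3)[symmetric] by (simp add: algebra_simps)
  then have "x = 2 * (c * p - q * t)" using assms(4) by (simp only: mult_cancel_left) simp
  then show ?thesis using assms(5) by (simp add: field_simps)
qed

lemma P1_0_eq: "P1 lam 0 = out_pt 1 ((1 - a - lam) / cos (4 * \<theta>))"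
  and P1_1_eq: "P1 lam 1 = out_pt 2 ((1 - a - lam) / cos (6 * \<theta>))"
  and cos_4_pos: "0 < cos (4 * \<theta>)" and cos_6_pos: "0 < cos (6 * \<theta>)"
proof -
  show c: "0 < cos (4 * \<theta>)" "0 < cos (6 * \<theta>)"
    using theta_bounds pi_gt_zero by (auto intro!: cos_gt_zero_pi)
  note p = four_minus_nonzero
  have e4: "2 - 4 * lam\<^sup>2 + lam ^ 4 = 2 * cos (4 * \<theta>)" by (simp add: cos_4)
  have e6: "2 - 9 * lam\<^sup>2 + 6 * lam ^ 4 - lam ^ 6 = 2 * cos (6 * \<theta>)"
    unfolding cos_6 by (simp add: algebra_simps eval_nat_numeral)
  have "(2 - lam - lam\<^sup>2) * (4 - lam\<^sup>2) =
      (4 - lam\<^sup>2 + lam) * (2 * cos (4 * \<theta>)) - ((4 - lam\<^sup>2) * (1 - lam) - 2) * (2 * sin (3 * \<theta>))"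
    by (simp add: e4[symmetric] sin_3) (simp add: algebra_simps eval_nat_numeral)
  then have "(2 - lam - lam\<^sup>2) / (2 * cos (4 * \<theta>)) = 1 + b - (1 - a - lam) / cos (4 * \<theta>) * sin (3 * \<theta>)"
    by (rule quotient_eqI) (use p c a_mult b_mult in \<open>simp_all add: distrib_left right_diff_distrib\<close>)
  then show "P1 lam 0 = out_pt 1 ((1 - a - lam) / cos (4 * \<theta>))"
    using c by (simp add: P1_def out_pt_def e4)
  have "(2 - 2 * lam - 4 * lam\<^sup>2 + lam ^ 3 + lam ^ 4) * (4 - lam\<^sup>2) =
      (4 - lam\<^sup>2 + lam) * (2 * cos (6 * \<theta>)) - ((4 - lam\<^sup>2) * (1 - lam) - 2) * (2 * sin (5 * \<theta>))"
    by (simp add: e6[symmetric] sin_5) (simp add: algebra_simps eval_nat_numeral)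
  then have "(2 - 2 * lam - 4 * lam\<^sup>2 + lam ^ 3 + lam ^ 4) / (2 * cos (6 * \<theta>)) =
      1 + b - (1 - a - lam) / cos (6 * \<theta>) * sin (5 * \<theta>)"
    by (rule quotient_eqI) (use p c a_mult b_mult in \<open>simp_all add: distrib_left right_diff_distrib\<close>)
  then show "P1 lam 1 = out_pt 2 ((1 - a - lam) / cos (6 * \<theta>))"
    using c by (simp add: P1_def out_pt_def e6)
qed

lemma out_pt_affine: "(1 - u) *\<^sub>R out_pt m B0 + u *\<^sub>R out_pt m B1 = out_pt m ((1 - u) * B0 + u * B1)"
  by (simp add: out_pt_def algebra_simps)

lemma closed_segment_out_pt:
  assumes "z \<in> closed_segment (out_pt m B0) (out_pt m B1)"
  obtains B where "z = out_pt m B" "B \<in> closed_segment B0 B1"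
  using assms out_pt_affine by (auto simp: in_segment)

text \<open>The first coordinate of the fourth image of \<open>G z\<close> for the itinerary \<open>1110\<close>, as an affine function of
  \<open>z\<close>.\<close>

definition fourth_coord :: "point \<Rightarrow> real" where
  "fourth_coord z = (2 * lam - lam ^ 3) * fst z + (lam ^ 4 - 3 * lam\<^sup>2 + 1) * snd z + (lam ^ 3 + lam\<^sup>2 - lam - 1)"

lemma fourth_coord_out_pt: "fourth_coord (out_pt m B) = b - B * sin ((2 * real m - 3) * \<theta>)"
proof -
  define x y where "x = a + lam + B * cos ((2 * real m + 2) * \<theta>)"
    and "y = 1 + b - B * sin ((2 * real m + 1) * \<theta>)"
  have "(2 * real m + 1) * \<theta> + \<theta> = (2 * real m + 2) * \<theta>"
    "(2 * real m + 1) * \<theta> - \<theta> = (2 * real m) * \<theta>"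
    "(2 * real m) * \<theta> + \<theta> = (2 * real m + 1) * \<theta>" "(2 * real m) * \<theta> - \<theta> = (2 * real m - 1) * \<theta>"
    "(2 * real m - 1) * \<theta> + \<theta> = (2 * real m) * \<theta>" "(2 * real m - 1) * \<theta> - \<theta> = (2 * real m - 2) * \<theta>"
    "(2 * real m - 2) * \<theta> + \<theta> = (2 * real m - 1) * \<theta>" "(2 * real m - 2) * \<theta> - \<theta> = (2 * real m - 3) * \<theta>"
    by (simp_all add: algebra_simps)
  note angles = this
  define x1 x2 x3 where "x1 = lam * y - x + 1" and "x2 = lam * x1 - y + 1" and "x3 = lam * x2 - x1 + 1"
  have 1: "x1 = a - B * cos (2 * real m * \<theta>)"
    using osc_odd[of "- B" "(2 * real m + 1) * \<theta>"] unfolding angles by (simp add: x1_def x_def y_def algebra_simps)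
  have 2: "x2 = b + B * sin ((2 * real m - 1) * \<theta>)"
    using osc_even[of "- B" "2 * real m * \<theta>"] unfolding angles by (simp add: x2_def 1 y_def)
  have 3: "x3 = a + B * cos ((2 * real m - 2) * \<theta>)"
    using osc_odd[of B "(2 * real m - 1) * \<theta>"] unfolding angles by (simp add: x3_def 1 2)
  have "lam * x3 - x2 = b - B * sin ((2 * real m - 3) * \<theta>)"
    using osc_even[of B "(2 * real m - 2) * \<theta>"] unfolding angles by (simp add: 2 3)
  moreover have "fourth_coord (x, y) = lam * x3 - x2"
    by (simp add: fourth_coord_def x1_def x2_def x3_def algebra_simps eval_nat_numeral)
  ultimately show ?thesis by (simp add: out_pt_def x_def y_def)
qed

text \<open>For \<open>m \<ge> 3\<close> the closed segment of fixed points of \<open>L_out\<close> contains a vertex whose orbit touches the side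
  \<open>x = 0\<close>. On the atom \<open>fourth_coord\<close> is nonnegative and it vanishes at this vertex, so that the interior of the
  atom excludes it.\<close>

lemma interior_hull_fourth_coord:
  assumes "\<And>v. v \<in> V \<Longrightarrow> 0 \<le> fourth_coord v" "z \<in> interior (convex hull V)"
  shows "0 < fourth_coord z"
proof -
  define c :: point where "c = (2 * lam - lam ^ 3, lam ^ 4 - 3 * lam\<^sup>2 + 1)"
  define d where "d = 1 + lam - lam\<^sup>2 - lam ^ 3"
  have eq: "fourth_coord v = c \<bullet> v - d" for v
    by (cases v) (simp add: fourth_coord_def c_def d_def algebra_simps)
  have "2 * lam - lam ^ 3 = lam * (2 - lam\<^sup>2)" by (simp add: algebra_simps eval_nat_numeral)
  then have "c \<noteq> 0" using lam_pos lam_sq by (auto simp: c_def zero_prod_def)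
  moreover have "convex hull V \<subseteq> {v. d \<le> c \<bullet> v}"
    using assms(1) by (intro hull_minimal convex_halfspace_ge) (auto simp: eq)
  then have "interior (convex hull V) \<subseteq> interior {v. d \<le> c \<bullet> v}" by (rule interior_mono)
  ultimately show ?thesis using assms(2) interior_halfspace_ge[of c d] by (auto simp: eq)
qed

section \<open>The lines tangent to the central ellipse\<close>

lemma sin_half_pi_minus: "sin (pi / 2 - x) = cos x"
  by (simp add: sin_diff)

lemma polar_exists: "\<exists>r \<beta>. d = r *\<^sub>R polar lam \<beta>"
proof -
  obtain r \<beta> where rb: "fst d = r * cos \<beta>" "(snd d - sin \<theta> * fst d) / cos \<theta> = r * sin \<beta>"
    using polar_Ex by blast
  then have "snd d = r * sin (\<beta> + \<theta>)"
    using cos_theta_pos by (simp add: sin_add field_simps)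
  then show ?thesis using rb by (intro exI[of _ r] exI[of _ \<beta>]) (simp add: polar_def prod_eq_iff)
qed

lemma Cmap_power_polar:
  "(Cmap lam ^^ (4 * k)) (r *\<^sub>R polar lam \<beta>) = r *\<^sub>R polar lam (\<beta> - 4 * real k * \<theta>)"
proof (induction k)
  case (Suc k)
  have "(Cmap lam ^^ (4 * Suc k)) (r *\<^sub>R polar lam \<beta>) = (Cmap lam ^^ 4) ((Cmap lam ^^ (4 * k)) (r *\<^sub>R polar lam \<beta>))"
    by (simp add: funpow_add[of 4 "4 * k", simplified])
  then show ?case unfolding Suc Cmap4_polar by (simp add: algebra_simps)
qed simp

lemma Cmap_power_inj: "(Cmap lam ^^ k) u = (Cmap lam ^^ k) v \<Longrightarrow> u = v"
proof (induction k)
  case (Suc k)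
  have "Cmap lam u' = Cmap lam v' \<Longrightarrow> u' = v'" for u' v'
    by (cases u'; cases v') (simp add: Cmap_def)
  then show ?case using Suc by simp
qed simp

lemma ell_polar: "ctr lam + r *\<^sub>R polar lam \<beta> \<in> ell lam k \<longleftrightarrow> r * sin (\<beta> + (4 * real k + 1) * \<theta>) = 1 - \<kappa>"
proof -
  let ?u = "r *\<^sub>R polar lam (\<beta> + 4 * real k * \<theta>)"
  have C: "(Cmap lam ^^ (4 * k)) ?u = r *\<^sub>R polar lam \<beta>" by (simp add: Cmap_power_polar)
  have "ctr lam + r *\<^sub>R polar lam \<beta> \<in> ell lam k \<longleftrightarrow> snd (ctr lam + ?u) = 1"
  proof
    assume "ctr lam + r *\<^sub>R polar lam \<beta> \<in> ell lam k"
    then obtain v where v: "snd v = 1" "(Cmap lam ^^ (4 * k)) (v - ctr lam) = r *\<^sub>R polar lam \<beta>"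
      by (auto simp: ell_def)
    have "v - ctr lam = ?u" by (rule Cmap_power_inj[of "4 * k"]) (simp only: v(2) C)
    then have "v = ctr lam + ?u" by (simp only: diff_eq_eq add.commute)
    then show "snd (ctr lam + ?u) = 1" using v(1) by simp
  next
    assume "snd (ctr lam + ?u) = 1"
    then show "ctr lam + r *\<^sub>R polar lam \<beta> \<in> ell lam k"
      unfolding ell_def by (intro image_eqI[of _ _ "ctr lam + ?u"]) (simp_all only: C add_diff_cancel_left' mem_Collect_eq case_prod_unfold)
  qed
  also have "\<dots> \<longleftrightarrow> r * sin (\<beta> + (4 * real k + 1) * \<theta>) = 1 - \<kappa>"
  proof -
    have "\<beta> + 4 * real k * \<theta> + \<theta> = \<beta> + (4 * real k + 1) * \<theta>" by (simp add: algebra_simps)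
    then have "snd (ctr lam + ?u) = \<kappa> + r * sin (\<beta> + (4 * real k + 1) * \<theta>)"
      by (simp only: polar_def ctr_eq snd_add snd_scaleR snd_conv real_scaleR_def)
    then show ?thesis by linarith
  qed
  finally show ?thesis .
qed

lemma G_ell_polar: "ctr lam + r *\<^sub>R polar lam \<beta> \<in> G ` ell lam k \<longleftrightarrow> r * cos (\<beta> - 4 * real k * \<theta>) = 1 - \<kappa>"
proof -
  have angle: "pi / 2 - \<theta> - \<beta> + (4 * real k + 1) * \<theta> = pi / 2 - (\<beta> - 4 * real k * \<theta>)"
    by (simp add: algebra_simps)
  show ?thesis unfolding G_image_iff G_polar ell_polar angle sin_half_pi_minus ..
qed

lemma ellipse_polar: "ctr lam + r *\<^sub>R polar lam \<beta> \<in> ellipse lam \<longleftrightarrow> r\<^sup>2 = (1 - \<kappa>)\<^sup>2"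
proof -
  have p: "0 < 1 - lam\<^sup>2 / 4" using discr_pos[OF lam_bounds(2)] .
  have "ellipse_level lam = (1 - lam\<^sup>2 / 4) * (1 - \<kappa>)\<^sup>2"
    by (simp add: ellipse_level_def one_minus_kap)
  then show ?thesis using p by (simp add: ellipse_def Q_polar)
qed

text \<open>The two tangents are mirror images of each other in the ray on which they meet, and
  \<open>\<omega>\<close> is the angle between that ray and either point of tangency. They coincide
  exactly if \<open>\<omega> = 0\<close>.\<close>

lemma Qpt_eq:
  fixes i k :: nat
  defines "\<alpha> \<equiv> pi / 4 - \<theta> / 2 + 2 * (real k - real i) * \<theta>"
  defines "\<omega> \<equiv> \<alpha> - 4 * real k * \<theta>"
  assumes le: "(4 * (real i + real k) + 1) * \<theta> \<le> pi / 2"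
  shows "Qpt lam i k = ctr lam + ((1 - \<kappa>) / cos \<omega>) *\<^sub>R polar lam \<alpha>" and "0 \<le> \<omega>" "\<omega> < pi / 2"
proof -
  show w0: "0 \<le> \<omega>" using le by (simp add: \<omega>_def \<alpha>_def algebra_simps)
  have "0 \<le> real i * \<theta>" "0 \<le> real k * \<theta>" using theta_bounds by simp_all
  then show w1: "\<omega> < pi / 2"
  proof -
    have "\<omega> = pi / 4 - \<theta> / 2 - 2 * (real k * \<theta>) - 2 * (real i * \<theta>)"
      by (simp add: \<omega>_def \<alpha>_def algebra_simps)
    then show ?thesis
      using \<open>0 \<le> real i * \<theta>\<close> \<open>0 \<le> real k * \<theta>\<close> theta_bounds pi_gt_zero by linarith
  qed
  have cw: "0 < cos \<omega>" using w0 w1 by (intro cos_gt_zero_pi) auto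
  have k0: "0 < 1 - \<kappa>" using kap_bounds by simp
  have ell: "ctr lam + r *\<^sub>R polar lam (\<alpha> + \<delta>) \<in> ell lam i \<longleftrightarrow> r * cos (\<omega> - \<delta>) = 1 - \<kappa>" for r \<delta>
  proof -
    have "\<alpha> + \<delta> + (4 * real i + 1) * \<theta> = pi / 2 - (\<omega> - \<delta>)"
      by (simp add: \<omega>_def \<alpha>_def algebra_simps)
    then show ?thesis unfolding ell_polar by (simp only: sin_half_pi_minus)
  qed
  have Gell: "ctr lam + r *\<^sub>R polar lam (\<alpha> + \<delta>) \<in> G ` ell lam k \<longleftrightarrow> r * cos (\<omega> + \<delta>) = 1 - \<kappa>" for r \<delta>
    unfolding G_ell_polar by (simp add: \<omega>_def algebra_simps)
  have rep: "\<exists>r \<delta>. z = ctr lam + r *\<^sub>R polar lam (\<alpha> + \<delta>)" for z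
  proof -
    obtain r \<beta> where "z - ctr lam = r *\<^sub>R polar lam \<beta>" using polar_exists by blast
    then show ?thesis by (intro exI[of _ r] exI[of _ "\<beta> - \<alpha>"]) (simp add: algebra_simps)
  qed
  have same: "ell lam i = G ` ell lam k \<longleftrightarrow> \<omega> = 0"
  proof
    assume eq: "ell lam i = G ` ell lam k"
    have "ctr lam + (1 - \<kappa>) *\<^sub>R polar lam (\<alpha> + \<omega>) \<in> ell lam i" by (simp add: ell)
    then have "cos (2 * \<omega>) = 1" using eq k0 by (simp add: Gell)
    then have "sin \<omega> = 0" by (simp add: cos_double_sin)
    then show "\<omega> = 0" using w0 w1 sin_gt_zero[of \<omega>] pi_gt_zero by (cases "\<omega> = 0") auto
  next
    assume "\<omega> = 0"
    then have "z \<in> ell lam i \<longleftrightarrow> z \<in> G ` ell lam k" for z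
    proof -
      obtain r \<delta> where "z = ctr lam + r *\<^sub>R polar lam (\<alpha> + \<delta>)" using rep by blast
      then show ?thesis by (simp only: ell Gell) (simp add: \<open>\<omega> = 0\<close>)
    qed
    then show "ell lam i = G ` ell lam k" by blast
  qed
  show "Qpt lam i k = ctr lam + ((1 - \<kappa>) / cos \<omega>) *\<^sub>R polar lam \<alpha>"
    unfolding Qpt_def same
  proof (rule the_equality)
    let ?z = "ctr lam + ((1 - \<kappa>) / cos \<omega>) *\<^sub>R polar lam \<alpha>"
    show "?z \<in> ell lam i \<inter> G ` ell lam k \<and> (\<omega> = 0 \<longrightarrow> ?z \<in> ellipse lam)"
      using ell[of "(1 - \<kappa>) / cos \<omega>" 0] Gell[of "(1 - \<kappa>) / cos \<omega>" 0] cw by (simp add: ellipse_polar)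
  next
    fix z assume z: "z \<in> ell lam i \<inter> G ` ell lam k \<and> (\<omega> = 0 \<longrightarrow> z \<in> ellipse lam)"
    obtain r \<delta> where rd: "z = ctr lam + r *\<^sub>R polar lam (\<alpha> + \<delta>)" using rep by blast
    have c: "r * cos (\<omega> - \<delta>) = 1 - \<kappa>" "r * cos (\<omega> + \<delta>) = 1 - \<kappa>"
      using z unfolding rd IntE ell[symmetric] Gell[symmetric] by auto
    have "r * cos \<omega> * cos \<delta> + sin \<omega> * (r * sin \<delta>) = 1 - \<kappa>"
      "r * cos \<omega> * cos \<delta> - sin \<omega> * (r * sin \<delta>) = 1 - \<kappa>"
      using c by (simp_all add: cos_add cos_diff algebra_simps)
    then have sum: "r * cos \<omega> * cos \<delta> = 1 - \<kappa>" and diff: "sin \<omega> * (r * sin \<delta>) = 0"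
      by linarith+
    have "r * sin \<delta> = 0"
    proof (cases "\<omega> = 0")
      case True
      then have "r\<^sup>2 = (1 - \<kappa>)\<^sup>2" using z rd ellipse_polar by simp
      moreover have "(r * cos \<delta>)\<^sup>2 = (1 - \<kappa>)\<^sup>2" using sum True by simp
      ultimately have "(r * sin \<delta>)\<^sup>2 = 0"
        by (simp add: power_mult_distrib sin_squared_eq algebra_simps)
      then show ?thesis by simp
    next
      case False
      then have "0 < sin \<omega>" using w0 w1 by (intro sin_gt_zero) auto
      then show ?thesis using diff by simp
    qed
    moreover have "r * cos \<delta> = (1 - \<kappa>) / cos \<omega>" using sum cw by (simp add: field_simps)
    moreover have "r *\<^sub>R polar lam (\<alpha> + \<delta>) = (r * cos \<delta>) *\<^sub>R polar lam \<alpha> + (r * sin \<delta>) *\<^sub>R (- sin \<alpha>, cos (\<alpha> + \<theta>))"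
    proof -
      have "sin (\<alpha> + \<delta> + \<theta>) = sin (\<alpha> + \<theta>) * cos \<delta> + cos (\<alpha> + \<theta>) * sin \<delta>"
        using sin_add[of "\<alpha> + \<theta>" \<delta>] by (simp add: ac_simps)
      then show ?thesis unfolding polar_def cos_add[of \<alpha> \<delta>] by (simp add: algebra_simps)
    qed
    ultimately have "r *\<^sub>R polar lam (\<alpha> + \<delta>) = ((1 - \<kappa>) / cos \<omega>) *\<^sub>R polar lam \<alpha>"
      by (simp only: scaleR_zero_left add_0_right)
    then show "z = ctr lam + ((1 - \<kappa>) / cos \<omega>) *\<^sub>R polar lam \<alpha>" using rd by simp
  qed
qed

lemma Qpt_in_angle:
  assumes "1 \<le> n" "(4 * real n + 5) * \<theta> \<le> pi / 2"
  shows "Qpt lam 0 (n - 1) = ctr lam + ((1 - \<kappa>) / sin (in_angle n + \<theta>)) *\<^sub>R polar lam (in_angle n)"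
    and "Qpt lam 1 n = ctr lam + ((1 - \<kappa>) / sin (in_angle n + 5 * \<theta>)) *\<^sub>R polar lam (in_angle n)"
    and "0 < sin (in_angle n + \<theta>)" "0 < sin (in_angle n + 5 * \<theta>)"
proof -
  have le0: "(4 * (real 0 + real (n - 1)) + 1) * \<theta> \<le> pi / 2"
    using assms theta_bounds by (simp add: of_nat_diff algebra_simps)
  have le1: "(4 * (real 1 + real n) + 1) * \<theta> \<le> pi / 2"
    using assms by (simp add: algebra_simps)
  have \<alpha>: "pi / 4 - \<theta> / 2 + 2 * (real (n - 1) - real 0) * \<theta> = in_angle n"
    "pi / 4 - \<theta> / 2 + 2 * (real n - real 1) * \<theta> = in_angle n"
    using assms(1) by (simp_all add: in_angle_def of_nat_diff algebra_simps)
  have \<omega>: "in_angle n + \<theta> = pi / 2 - (in_angle n - 4 * real (n - 1) * \<theta>)"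
    "in_angle n + 5 * \<theta> = pi / 2 - (in_angle n - 4 * real n * \<theta>)"
    using assms(1) by (simp_all add: in_angle_def of_nat_diff algebra_simps)
  note Q0 = Qpt_eq[OF le0, unfolded \<alpha>] and Q1 = Qpt_eq[OF le1, unfolded \<alpha>]
  show "Qpt lam 0 (n - 1) = ctr lam + ((1 - \<kappa>) / sin (in_angle n + \<theta>)) *\<^sub>R polar lam (in_angle n)"
    "Qpt lam 1 n = ctr lam + ((1 - \<kappa>) / sin (in_angle n + 5 * \<theta>)) *\<^sub>R polar lam (in_angle n)"
    unfolding Q0(1) Q1(1) \<omega> by (simp_all only: sin_half_pi_minus)
  show "0 < sin (in_angle n + \<theta>)" "0 < sin (in_angle n + 5 * \<theta>)"
    unfolding \<omega> sin_half_pi_minus using Q0(2,3) Q1(2,3) by (intro cos_gt_zero_pi; linarith)+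
qed

lemma closed_segment_ray:
  assumes "z \<in> closed_segment (p + r0 *\<^sub>R v) (p + r1 *\<^sub>R v)"
  obtains r where "z = p + r *\<^sub>R v"
proof -
  obtain u where "z = (1 - u) *\<^sub>R (p + r0 *\<^sub>R v) + u *\<^sub>R (p + r1 *\<^sub>R v)"
    using assms by (auto simp: in_segment)
  then have "z = p + ((1 - u) * r0 + u * r1) *\<^sub>R v" by (simp add: algebra_simps)
  then show thesis using that by blast
qed

end

section \<open>Regular fixed points are regular cycles\<close>

context admissible
begin

lemma sin_multiple_pos:
  assumes "(2 * real m + 1) * \<theta> \<le> pi / 2" "0 < x" "x \<le> 2 * real m + 1"
  shows "0 < sin (x * \<theta>)"
proof (rule sin_gt_zero)
  have "x * \<theta> \<le> (2 * real m + 1) * \<theta>" using assms theta_bounds by (intro mult_right_mono) auto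
  then show "x * \<theta> < pi" using assms(1) pi_gt_zero by linarith
qed (use assms theta_bounds in simp)

lemma sin_multiple_mono:
  assumes "(2 * real m + 1) * \<theta> \<le> pi / 2" "- (2 * real m + 1) \<le> x" "x \<le> y" "y \<le> 2 * real m + 1"
  shows "sin (x * \<theta>) \<le> sin (y * \<theta>)"
proof (rule sin_monotone_2pi_le)
  have "y * \<theta> \<le> (2 * real m + 1) * \<theta>" "x * \<theta> \<le> y * \<theta>" "- (2 * real m + 1) * \<theta> \<le> x * \<theta>"
    using assms theta_bounds by (intro mult_right_mono; simp)+
  then show "y * \<theta> \<le> pi / 2" "x * \<theta> \<le> y * \<theta>" "- (pi / 2) \<le> x * \<theta>"
    using assms(1) by linarith+
qed

text \<open>The inequalities for the itinerary come from the position of \<open>z\<close> in the sector and in the open atom.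
  For \<open>m \<ge> 3\<close> the vertices of the outer atom satisfy \<open>fourth_coord \<ge> 0\<close>; for \<open>m \<le> 2\<close> this side of the atom
  is replaced by \<open>x = 1\<close>, and the bound for the amplitude gives the inequality directly.\<close>

lemma regular_imp_cycle:
  assumes reg: "regular_fixed_point lam m n z"
  shows "\<exists>R B. regular_cycle lam m n R B z"
proof -
  have mn: "1 \<le> m" "m \<le> M lam" "1 \<le> n" "n + 1 \<le> N lam"
    and z: "z \<in> Lambda lam" "z \<in> out_atom lam m"
    and seg_out: "z \<in> closed_segment (P0 lam m) (P1 lam (m - 1))"
    and seg_in: "z \<in> closed_segment (Qpt lam 0 (n - 1)) (Qpt lam 1 n)"
    using reg by (auto simp: regular_fixed_point_def)
  have m: "(2 * real m + 1) * \<theta> \<le> pi / 2" using M_bound mn by simp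
  have n: "(4 * real n + 5) * \<theta> \<le> pi / 2" using N_bound mn by simp
  have sec: "z \<in> sector lam" using z(1) by (simp add: Lambda_def)
  obtain R where zR: "z = ctr lam + R *\<^sub>R polar lam (in_angle n)"
    using seg_in closed_segment_ray unfolding Qpt_in_angle(1,2)[OF mn(3) n] by blast
  have sinm: "0 < sin ((2 * real m + 1) * \<theta>)"
    using sin_multiple_pos[OF m, of "2 * real m + 1"] by simp
  note P0m = P0_eq[OF less_imp_neq[OF sinm, symmetric]]
  have B_pos: "0 < B" and s_less: "a + lam + B * cos ((2 * real m + 2) * \<theta>) < 1" if "z = out_pt m B" for B
  proof -
    have "snd z < 1" "fst z < 1" using sec by (auto simp: sector_def)
    then have "0 < B * sin ((2 * real m + 1) * \<theta>)" "a + lam + B * cos ((2 * real m + 2) * \<theta>) < 1"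
      using b_bounds that by (auto simp: out_pt_def)
    then show "0 < B" "a + lam + B * cos ((2 * real m + 2) * \<theta>) < 1"
      using sinm by (auto simp: zero_less_mult_iff)
  qed
  \<comment> \<open>the sign of \<open>2 * m - 3\<close> separates the atoms bounded by the vanishing of the fourth coordinate from the others\<close>
  have "\<exists>B. z = out_pt m B \<and> 0 < b - B * sin ((2 * real m - 3) * \<theta>)"
  proof (cases "3 \<le> m")
    case True
    have m1: "2 * real (m - 1) - 1 = 2 * real m - 3" "m - 1 + 1 = m" using True by (simp_all add: of_nat_diff)
    have sins: "0 < sin ((2 * real m - 3) * \<theta>)" "0 < sin ((2 * real m - 1) * \<theta>)"
      using True by (auto intro!: sin_multiple_pos[OF m])
    have P1: "P1 lam (m - 1) = out_pt m (b / sin ((2 * real m - 3) * \<theta>))"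
      "P1 lam m = out_pt (m + 1) (b / sin ((2 * real m - 1) * \<theta>))"
      using P1_eq[of "m - 1"] P1_eq[of m] sins True unfolding m1 by auto
    have m1': "2 * real (m - 1) + 1 = 2 * real m - 1" using True by (simp add: of_nat_diff)
    have P0': "P0 lam (m - 1) = out_pt (m - 1) (b / sin ((2 * real m - 1) * \<theta>))"
      using P0_eq[of "m - 1"] sins unfolding m1' by simp
    obtain B where B: "z = out_pt m B"
      using seg_out closed_segment_out_pt unfolding P0m P1 by blast
    have quot: "0 \<le> b - b / y * x" if "x \<le> y" "0 < y" for x y :: real
      using mult_left_mono[OF that(1) less_imp_le[OF b_bounds(1)]] that(2) by (simp add: field_simps)
    have "0 \<le> fourth_coord v" if "v \<in> {P0 lam m, P0 lam (m - 1), P1 lam (m - 1), P1 lam m}" for v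
    proof -
      have "0 \<le> fourth_coord (P0 lam m)"
        unfolding P0m fourth_coord_out_pt using sinm True
        by (intro quot sin_multiple_mono[OF m]) auto
      moreover have "0 \<le> fourth_coord (P0 lam (m - 1))"
        unfolding P0' fourth_coord_out_pt using sins True
        by (intro quot sin_multiple_mono[OF m]) (auto simp: of_nat_diff)
      moreover have "0 \<le> fourth_coord (P1 lam (m - 1))"
        unfolding P1 fourth_coord_out_pt using sins by (intro quot) auto
      moreover have "0 \<le> fourth_coord (P1 lam m)"
      proof -
        have "2 * real (m + 1) - 3 = 2 * real m - 1" by simp
        then show ?thesis unfolding P1 fourth_coord_out_pt using sins by (intro quot) auto
      qed
      ultimately show ?thesis using that by auto
    qed
    then have "0 < fourth_coord z"
      using z(2) True by (intro interior_hull_fourth_coord[of "{P0 lam m, P0 lam (m - 1), P1 lam (m - 1), P1 lam m}"])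
        (auto simp: out_atom_def)
    then show ?thesis using B fourth_coord_out_pt by auto
  next
    case False
    then have m12: "m = 1 \<or> m = 2" using mn by auto
    then have "\<exists>C. P1 lam (m - 1) = out_pt m C" using P1_0_eq P1_1_eq by auto
    then obtain C where P1: "P1 lam (m - 1) = out_pt m C" by blast
    obtain B where B: "z = out_pt m B"
      using seg_out closed_segment_out_pt unfolding P0m P1 by blast
    have "B < a" using small_m_bound[of m B] B_pos[OF B] s_less[OF B] m12 a_bounds by linarith
    have "0 < b - B * sin \<theta>"
    proof -
      have "b - B * sin \<theta> = lam / 2 * (a - B)" using two_b by (simp add: sin_theta algebra_simps)
      moreover have "0 < lam / 2 * (a - B)" using \<open>B < a\<close> lam_pos by simp
      ultimately show ?thesis by linarith
    qed
    moreover have "0 < b + B * sin \<theta>"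
      using b_bounds B_pos[OF B] lam_pos by (simp add: sin_theta add_pos_pos)
    ultimately show ?thesis using B m12 by auto
  qed
  then obtain B where "z = out_pt m B" "0 < b - B * sin ((2 * real m - 3) * \<theta>)" by blast
  then have "regular_cycle lam m n R B z"
    using mn m n zR sec by unfold_locales auto
  then show ?thesis by blast
qed

end

subsection \<open>The position of the cycle\<close>

text \<open>The determinant of the linear system for \<open>R\<close> and \<open>B\<close> which says that the ray and the line meet,
  and its solution by Cramer's rule. The determinant is positive since the angle in the sine is less than
  \<open>pi\<close> for all indices that occur.\<close>

definition cycle_det :: "real \<Rightarrow> nat \<Rightarrow> nat \<Rightarrow> real" where
  "cycle_det lam m n = cos (theta lam) * sin (pi / 4 + (2 * (real m + real n) - 1 / 2) * theta lam)"

definition cycle_R :: "real \<Rightarrow> nat \<Rightarrow> nat \<Rightarrow> real" where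
  "cycle_R lam m n = ((ea lam + lam - kap lam) * sin ((2 * real m + 1) * theta lam)
     + (1 + eb lam - kap lam) * cos ((2 * real m + 2) * theta lam)) / cycle_det lam m n"

definition cycle_B :: "real \<Rightarrow> nat \<Rightarrow> nat \<Rightarrow> real" where
  "cycle_B lam m n = ((1 + eb lam - kap lam) * cos (pi / 4 + (2 * real n - 5 / 2) * theta lam)
     - (ea lam + lam - kap lam) * sin (pi / 4 + (2 * real n - 3 / 2) * theta lam)) / cycle_det lam m n"

context admissible
begin

lemma cycle_det_eq:
  "cycle_det lam m n = cos (in_angle n) * sin ((2 * real m + 1) * \<theta>)
     + sin (in_angle n + \<theta>) * cos ((2 * real m + 2) * \<theta>)"
proof -
  define \<alpha> \<delta> where "\<alpha> = in_angle n" and "\<delta> = (2 * real m + 1) * \<theta>"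
  have d: "(2 * real m + 2) * \<theta> = \<delta> + \<theta>" "pi / 4 + (2 * (real m + real n) - 1 / 2) * \<theta> = \<alpha> + \<delta> + \<theta>"
    by (simp_all add: \<alpha>_def \<delta>_def in_angle_def algebra_simps)
  \<comment> \<open>the factor 1 is written so that both sides expand to the same polynomial\<close>
  have "cos \<alpha> * sin \<delta> + sin (\<alpha> + \<theta>) * cos (\<delta> + \<theta>)
      = cos \<alpha> * sin \<delta> * ((sin \<theta>)\<^sup>2 + (cos \<theta>)\<^sup>2) + sin (\<alpha> + \<theta>) * cos (\<delta> + \<theta>)" by simp
  also have "\<dots> = cos \<theta> * sin (\<alpha> + \<delta> + \<theta>)"
    unfolding sin_add cos_add power2_eq_square by (simp only: algebra_simps)
  finally show ?thesis unfolding cycle_det_def d \<alpha>_def[symmetric] \<delta>_def[symmetric] by simp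
qed

lemma cycle_det_pos:
  assumes "1 \<le> m" "(2 * real m + 1) * \<theta> \<le> pi / 2" "1 \<le> n" "(4 * real n + 5) * \<theta> \<le> pi / 2"
  shows "0 < cycle_det lam m n"
proof -
  have "0 < (2 * (real m + real n) - 1 / 2) * \<theta>" using assms theta_bounds by (intro mult_pos_pos) auto
  moreover have "(2 * (real m + real n) - 1 / 2) * \<theta> < 3 * pi / 4"
    using assms(2,4) theta_bounds by (simp add: algebra_simps)
  ultimately have "0 < sin (pi / 4 + (2 * (real m + real n) - 1 / 2) * \<theta>)"
    using pi_gt_zero by (intro sin_gt_zero) linarith+
  then show ?thesis using cos_theta_pos by (simp add: cycle_det_def)
qed

lemma position_iff:
  assumes "cycle_det lam m n \<noteq> 0"
  shows "ctr lam + R *\<^sub>R polar lam (in_angle n) = out_pt m B \<longleftrightarrow> R = cycle_R lam m n \<and> B = cycle_B lam m n"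
proof -
  define c1 s1 c2 s2 u v where "c1 = cos (in_angle n)" and "s1 = sin (in_angle n + \<theta>)"
    and "c2 = cos ((2 * real m + 2) * \<theta>)" and "s2 = sin ((2 * real m + 1) * \<theta>)"
    and "u = a + lam - \<kappa>" and "v = 1 + b - \<kappa>"
  have det: "cycle_det lam m n = c1 * s2 + s1 * c2"
    by (simp add: cycle_det_eq c1_def s1_def c2_def s2_def)
  have s1': "sin (pi / 4 + (2 * real n - 3 / 2) * \<theta>) = s1"
    by (simp add: s1_def in_angle_def algebra_simps)
  have sol: "cycle_R lam m n = (u * s2 + v * c2) / (c1 * s2 + s1 * c2)"
    "cycle_B lam m n = (v * c1 - u * s1) / (c1 * s2 + s1 * c2)"
    unfolding cycle_R_def cycle_B_def s1' det in_angle_def[symmetric]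
    by (simp_all only: c1_def c2_def s2_def u_def v_def)
  have "ctr lam + R *\<^sub>R polar lam (in_angle n) = out_pt m B \<longleftrightarrow> R * c1 - B * c2 = u \<and> R * s1 + B * s2 = v"
    unfolding ctr_eq polar_def out_pt_def c1_def[symmetric] s1_def[symmetric] c2_def[symmetric] s2_def[symmetric]
    by (simp add: u_def v_def) argo
  also have "\<dots> \<longleftrightarrow> R = cycle_R lam m n \<and> B = cycle_B lam m n"
  proof
    assume eq: "R * c1 - B * c2 = u \<and> R * s1 + B * s2 = v"
    have "R * (c1 * s2 + s1 * c2) = u * s2 + v * c2" "B * (c1 * s2 + s1 * c2) = v * c1 - u * s1"
      unfolding conjunct1[OF eq, symmetric] conjunct2[OF eq, symmetric] by (simp_all add: algebra_simps)
    then show "R = cycle_R lam m n \<and> B = cycle_B lam m n"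
      using assms unfolding sol det by (simp add: eq_divide_eq)
  next
    assume "R = cycle_R lam m n \<and> B = cycle_B lam m n"
    then have *: "R * (c1 * s2 + s1 * c2) = u * s2 + v * c2" "B * (c1 * s2 + s1 * c2) = v * c1 - u * s1"
      using assms unfolding sol det by auto
    have "(R * c1 - B * c2) * (c1 * s2 + s1 * c2) = (R * (c1 * s2 + s1 * c2)) * c1 - (B * (c1 * s2 + s1 * c2)) * c2"
      "(R * s1 + B * s2) * (c1 * s2 + s1 * c2) = (R * (c1 * s2 + s1 * c2)) * s1 + (B * (c1 * s2 + s1 * c2)) * s2"
      by (simp_all add: algebra_simps)
    then have "(R * c1 - B * c2) * (c1 * s2 + s1 * c2) = u * (c1 * s2 + s1 * c2)"
      "(R * s1 + B * s2) * (c1 * s2 + s1 * c2) = v * (c1 * s2 + s1 * c2)"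
      unfolding * by (simp_all add: algebra_simps)
    then show "R * c1 - B * c2 = u \<and> R * s1 + B * s2 = v"
      using assms unfolding det by (simp only: mult_cancel_right) simp
  qed
  finally show ?thesis .
qed

definition cycle_pt :: "nat \<Rightarrow> nat \<Rightarrow> point" where
  "cycle_pt m n = out_pt m (cycle_B lam m n)"

lemma regular_cycle_unique:
  assumes "regular_cycle lam m n R B z"
  shows "R = cycle_R lam m n" "B = cycle_B lam m n" "z = cycle_pt m n"
proof -
  interpret regular_cycle lam m n R B z by fact
  have "cycle_det lam m n \<noteq> 0" using cycle_det_pos[OF m n] by simp
  then show RB: "R = cycle_R lam m n" "B = cycle_B lam m n"
    using position_iff[of m n R B] trans[OF z_in[symmetric] z_out] by blast+
  show "z = cycle_pt m n" unfolding cycle_pt_def RB(2)[symmetric] by (rule z_out)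
qed

text \<open>A regular orbit meets \<open>Lambda\<close> once, and its transit times from there determine \<open>n\<close> and \<open>m\<close>.\<close>

lemma orbit_determines:
  assumes "regular_cycle lam m n R B z" "regular_cycle lam m' n' R' B' z'" "orbit lam z = orbit lam z'"
  shows "m = m'" "n = n'"
proof -
  interpret r: regular_cycle lam m n R B z by fact
  interpret r': regular_cycle lam m' n' R' B' z' by fact
  have "{z} = {z'}" using r.orbit_Lambda r'.orbit_Lambda unfolding assms(3) by (rule trans[OF sym])
  then have z: "z = z'" by simp
  have "4 * (n - 1) = 4 * (n' - 1)"
    using r.G_Lambda_first r'.G_Lambda_first unfolding z by (rule trans[OF sym])
  then show "n = n'" using r.n r'.n by linarith
  have "4 * m + 3 = 4 * m' + 3"
    using r.Lambda_first_after r'.Lambda_first_after unfolding z by (rule trans[OF sym])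
  then show "m = m'" by simp
qed

end

section \<open>Existence of regular fixed points\<close>

definition cross :: "point \<Rightarrow> point \<Rightarrow> real" where
  "cross u v = fst u * snd v - snd u * fst v"

text \<open>Moving off the diagonal leads into one of the two triangles over it.\<close>

lemma diagonal_interior_hull:
  fixes p0 p1 q0 q1 :: point
  assumes q0: "0 < cross (p1 - p0) (q0 - p0)" and q1: "cross (p1 - p0) (q1 - p0) < 0"
    and t: "0 < t" "t < 1"
  shows "(1 - t) *\<^sub>R p0 + t *\<^sub>R p1 \<in> interior (convex hull {p0, q0, p1, q1})"
proof -
  define e where "e = p1 - p0"
  have "e \<noteq> 0" using q0 by (auto simp: e_def cross_def)
  then have ee: "0 < e \<bullet> e" by simp
  define w where "w = (\<lambda>q z. cross e (z - p0) / cross e (q - p0))"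
  define \<sigma> where "\<sigma> = (\<lambda>q z. (e \<bullet> (z - p0 - w q z *\<^sub>R (q - p0))) / (e \<bullet> e))"
  have rep: "z = (1 - w q z - \<sigma> q z) *\<^sub>R p0 + w q z *\<^sub>R q + \<sigma> q z *\<^sub>R p1"
    if "cross e (q - p0) \<noteq> 0" for q z
  proof -
    define v where "v = z - p0 - w q z *\<^sub>R (q - p0)"
    have lin: "cross e (x - c *\<^sub>R y) = cross e x - c * cross e y" for x y c
      by (simp add: cross_def algebra_simps)
    have "cross e v = 0"
      unfolding v_def lin using that by (simp add: w_def)
    then have c: "fst e * snd v = snd e * fst v" by (simp add: cross_def)
    have "(e \<bullet> e) *\<^sub>R v = (e \<bullet> v) *\<^sub>R e"
    proof (rule prod_eqI)
      have "(fst e * fst e + snd e * snd e) * fst v = fst e * fst e * fst v + snd e * (snd e * fst v)"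
        by (simp add: algebra_simps)
      also have "\<dots> = (fst e * fst v + snd e * snd v) * fst e" unfolding c[symmetric] by (simp add: algebra_simps)
      finally show "fst ((e \<bullet> e) *\<^sub>R v) = fst ((e \<bullet> v) *\<^sub>R e)" by (simp add: inner_prod_def)
      have "(fst e * fst e + snd e * snd e) * snd v = fst e * (fst e * snd v) + snd e * snd e * snd v"
        by (simp add: algebra_simps)
      also have "\<dots> = (fst e * fst v + snd e * snd v) * snd e" unfolding c by (simp add: algebra_simps)
      finally show "snd ((e \<bullet> e) *\<^sub>R v) = snd ((e \<bullet> v) *\<^sub>R e)" by (simp add: inner_prod_def)
    qed
    then have "(1 / (e \<bullet> e)) *\<^sub>R ((e \<bullet> e) *\<^sub>R v) = (1 / (e \<bullet> e)) *\<^sub>R ((e \<bullet> v) *\<^sub>R e)" by simp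
    then have "v = \<sigma> q z *\<^sub>R e" using ee by (simp add: \<sigma>_def v_def)
    then have v: "z - p0 - w q z *\<^sub>R (q - p0) = \<sigma> q z *\<^sub>R (p1 - p0)"
      by (simp only: v_def e_def)
    have "z = p0 + w q z *\<^sub>R (q - p0) + (z - p0 - w q z *\<^sub>R (q - p0))" by simp
    also have "\<dots> = p0 + w q z *\<^sub>R (q - p0) + \<sigma> q z *\<^sub>R (p1 - p0)" by (simp only: v)
    also have "\<dots> = (1 - w q z - \<sigma> q z) *\<^sub>R p0 + w q z *\<^sub>R q + \<sigma> q z *\<^sub>R p1"
      by (simp add: algebra_simps)
    finally show ?thesis .
  qed
  define U where "U = {z. 0 < \<sigma> q0 z \<and> w q0 z + \<sigma> q0 z < 1 \<and> 0 < \<sigma> q1 z \<and> w q1 z + \<sigma> q1 z < 1}"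
  have "open U"
    unfolding U_def \<sigma>_def w_def cross_def
    by (intro open_Collect_conj open_Collect_less continuous_intros) (use ee q0 q1 in \<open>auto simp: e_def cross_def\<close>)
  moreover have "U \<subseteq> convex hull {p0, q0, p1, q1}"
  proof
    fix z assume z: "z \<in> U"
    have hull3: "z \<in> convex hull {p0, q0, p1, q1}"
      if "q \<in> {q0, q1}" "cross e (q - p0) \<noteq> 0" "0 \<le> w q z" for q
    proof -
      have "z \<in> convex hull {p0, q, p1}"
        unfolding convex_hull_3 using z that rep[OF that(2), of z]
        by (intro CollectI exI[of _ "1 - w q z - \<sigma> q z"] exI[of _ "w q z"] exI[of _ "\<sigma> q z"])
           (auto simp: U_def)
      moreover have "convex hull {p0, q, p1} \<subseteq> convex hull {p0, q0, p1, q1}"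
        using that(1) by (intro hull_mono) auto
      ultimately show ?thesis by blast
    qed
    show "z \<in> convex hull {p0, q0, p1, q1}"
    proof (cases "0 \<le> cross e (z - p0)")
      case True
      then show ?thesis using q0 by (intro hull3[of q0]) (auto simp: w_def e_def)
    next
      case False
      then show ?thesis using q1 by (intro hull3[of q1]) (auto simp: w_def e_def intro: divide_nonpos_neg)
    qed
  qed
  moreover have "(1 - t) *\<^sub>R p0 + t *\<^sub>R p1 \<in> U"
  proof -
    let ?p = "(1 - t) *\<^sub>R p0 + t *\<^sub>R p1"
    have p: "?p - p0 = t *\<^sub>R e" by (simp add: e_def algebra_simps)
    have "w q ?p = 0" for q unfolding w_def p by (simp add: cross_def)
    moreover have "\<sigma> q ?p = t" for q unfolding \<sigma>_def p using ee by (simp add: calculation)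
    ultimately show ?thesis using t by (simp add: U_def)
  qed
  ultimately show ?thesis by (meson interiorI)
qed

lemma diagonal_interior_hull_line:
  fixes c v q0 q1 :: point
  assumes "r0 < r" "r < r1" "0 < cross v (q0 - (c + r0 *\<^sub>R v))" "cross v (q1 - (c + r0 *\<^sub>R v)) < 0"
  shows "c + r *\<^sub>R v \<in> interior (convex hull {c + r0 *\<^sub>R v, q0, c + r1 *\<^sub>R v, q1})"
    and "c + r *\<^sub>R v \<in> closed_segment (c + r0 *\<^sub>R v) (c + r1 *\<^sub>R v)"
proof -
  define t where "t = (r - r0) / (r1 - r0)"
  have t: "0 < t" "t < 1" using assms(1,2) by (simp_all add: t_def)
  have "t * (r1 - r0) = r - r0" using assms(1,2) by (simp add: t_def)
  then have r: "(1 - t) * r0 + t * r1 = r" by (simp add: algebra_simps)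
  have d: "c + r1 *\<^sub>R v - (c + r0 *\<^sub>R v) = (r1 - r0) *\<^sub>R v" by (simp add: algebra_simps)
  have s: "cross (a *\<^sub>R v) u = a * cross v u" for a u by (simp add: cross_def algebra_simps)
  have eq: "c + r *\<^sub>R v = (1 - t) *\<^sub>R (c + r0 *\<^sub>R v) + t *\<^sub>R (c + r1 *\<^sub>R v)"
    unfolding r[symmetric] by (simp add: algebra_simps)
  show "c + r *\<^sub>R v \<in> interior (convex hull {c + r0 *\<^sub>R v, q0, c + r1 *\<^sub>R v, q1})"
    unfolding eq
  proof (rule diagonal_interior_hull)
    show "0 < cross (c + r1 *\<^sub>R v - (c + r0 *\<^sub>R v)) (q0 - (c + r0 *\<^sub>R v))"
      "cross (c + r1 *\<^sub>R v - (c + r0 *\<^sub>R v)) (q1 - (c + r0 *\<^sub>R v)) < 0"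
      unfolding d s using assms by (simp_all add: mult_pos_neg)
  qed (use t in auto)
  show "c + r *\<^sub>R v \<in> closed_segment (c + r0 *\<^sub>R v) (c + r1 *\<^sub>R v)"
    unfolding in_segment using eq t by (intro exI[of _ t]) auto
qed

context admissible
begin

lemma cross_polar: "cross (polar lam \<alpha>) (polar lam \<beta>) = sin (\<beta> - \<alpha>) * cos \<theta>"
  by (simp add: cross_def polar_def sin_add sin_diff algebra_simps)

text \<open>The affine branches with \<open>\<iota> = 1\<close> and \<open>\<iota> = 0\<close> differ by 1 in the first coordinate, hence
  \<open>fourth_coord\<close> is also determined by four steps of the rotation about \<open>ctr lam\<close>.\<close>

lemma fourth_coord_polar: "fourth_coord (ctr lam + R *\<^sub>R polar lam \<alpha>) = \<kappa> + R * sin (\<alpha> + 5 * \<theta>) - 1"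
proof -
  define x y where "x = \<kappa> + R * cos \<alpha>" and "y = \<kappa> + R * sin (\<alpha> + \<theta>)"
  have z: "ctr lam + R *\<^sub>R polar lam \<alpha> = (x, y)" by (simp add: x_def y_def polar_def ctr_eq)
  have "G (ctr lam + R *\<^sub>R polar lam \<alpha>) = (y, x)" by (simp add: z)
  then have w: "R *\<^sub>R polar lam (pi / 2 - \<theta> - \<alpha>) = (y - \<kappa>, x - \<kappa>)"
    unfolding G_polar by (auto simp: ctr_eq prod_eq_iff)
  have C: "Cmap lam (u - \<kappa>, v - \<kappa>) = (lam * u - v + 1 - \<kappa>, u - \<kappa>)" for u v
    using kap_eq by (simp add: Cmap_def algebra_simps)
  have "fst ((Cmap lam ^^ 4) (y - \<kappa>, x - \<kappa>)) = fourth_coord (x, y) + 1 - \<kappa>"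
    unfolding funpow_4 C by (simp add: fourth_coord_def algebra_simps eval_nat_numeral)
  moreover have "fst ((Cmap lam ^^ 4) (y - \<kappa>, x - \<kappa>)) = R * sin (\<alpha> + 5 * \<theta>)"
  proof -
    have angle: "pi / 2 - \<theta> - \<alpha> - 4 * \<theta> = pi / 2 - (\<alpha> + 5 * \<theta>)" by simp
    have "cos (pi / 2 - (\<alpha> + 5 * \<theta>)) = sin (\<alpha> + 5 * \<theta>)" by (simp add: cos_diff)
    then show ?thesis unfolding w[symmetric] Cmap4_polar angle by (simp add: polar_def)
  qed
  ultimately show ?thesis by (simp add: z)
qed

text \<open>The two vertices of the inner atom that are not on the ray lie in the directions \<open>2 * \<theta>\<close> to either
  side of it, so the ray contains a diagonal of the quadrilateral.\<close>

lemma in_atom_member: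
  assumes n: "1 \<le> n" "(4 * real n + 5) * \<theta> \<le> pi / 2"
    and top: "\<kappa> + R * sin (in_angle n + \<theta>) < 1" and bottom: "1 < \<kappa> + R * sin (in_angle n + 5 * \<theta>)"
  shows "ctr lam + R *\<^sub>R polar lam (in_angle n) \<in> in_atom lam n"
    and "ctr lam + R *\<^sub>R polar lam (in_angle n) \<in> closed_segment (Qpt lam 0 (n - 1)) (Qpt lam 1 n)"
proof -
  let ?v = "polar lam (in_angle n)"
  define r0 r1 where "r0 = (1 - \<kappa>) / sin (in_angle n + \<theta>)" and "r1 = (1 - \<kappa>) / sin (in_angle n + 5 * \<theta>)"
  note Q = Qpt_in_angle[OF n]
  have R: "r1 < R" "R < r0"
    using top bottom Q(3,4) by (simp_all add: r0_def r1_def field_simps)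
  have le0: "(4 * (real 0 + real n) + 1) * \<theta> \<le> pi / 2"
    using n theta_bounds by (simp add: algebra_simps)
  have le1: "(4 * (real 1 + real (n - 1)) + 1) * \<theta> \<le> pi / 2"
    using n theta_bounds by (simp add: of_nat_diff algebra_simps)
  have \<alpha>: "pi / 4 - \<theta> / 2 + 2 * (real n - real 0) * \<theta> = in_angle n + 2 * \<theta>"
    "pi / 4 - \<theta> / 2 + 2 * (real (n - 1) - real 1) * \<theta> = in_angle n - 2 * \<theta>"
    using n(1) by (simp_all add: in_angle_def of_nat_diff algebra_simps)
  note Q0 = Qpt_eq[OF le0, unfolded \<alpha>] and Q1 = Qpt_eq[OF le1, unfolded \<alpha>]
  obtain \<rho>0 \<rho>1 where \<rho>: "0 < \<rho>0" "0 < \<rho>1" "Qpt lam 0 n = ctr lam + \<rho>0 *\<^sub>R polar lam (in_angle n + 2 * \<theta>)"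
    "Qpt lam 1 (n - 1) = ctr lam + \<rho>1 *\<^sub>R polar lam (in_angle n - 2 * \<theta>)"
  proof
    show "0 < (1 - \<kappa>) / cos (in_angle n + 2 * \<theta> - 4 * real n * \<theta>)"
      using kap_bounds Q0(2,3) by (intro divide_pos_pos cos_gt_zero_pi) linarith+
    show "0 < (1 - \<kappa>) / cos (in_angle n - 2 * \<theta> - 4 * real (n - 1) * \<theta>)"
      using kap_bounds Q1(2,3) by (intro divide_pos_pos cos_gt_zero_pi) linarith+
  qed (use Q0(1) Q1(1) in auto)
  have s2: "0 < sin (2 * \<theta>)" using theta_bounds pi_gt_zero by (intro sin_gt_zero) linarith+
  have cr: "cross ?v (ctr lam + \<rho> *\<^sub>R polar lam \<beta> - (ctr lam + r1 *\<^sub>R ?v)) = \<rho> * (sin (\<beta> - in_angle n) * cos \<theta>)" for \<rho> \<beta>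
  proof -
    have "cross ?v (ctr lam + \<rho> *\<^sub>R polar lam \<beta> - (ctr lam + r1 *\<^sub>R ?v)) = \<rho> * cross ?v (polar lam \<beta>)"
      by (simp add: cross_def algebra_simps)
    then show ?thesis by (simp only: cross_polar)
  qed
  have side: "0 < cross ?v (Qpt lam 0 n - (ctr lam + r1 *\<^sub>R ?v))" "cross ?v (Qpt lam 1 (n - 1) - (ctr lam + r1 *\<^sub>R ?v)) < 0"
    unfolding \<rho> cr using \<rho>(1,2) s2 cos_theta_pos by (simp_all add: mult_pos_neg)
  have eq0: "Qpt lam 0 (n - 1) = ctr lam + r0 *\<^sub>R ?v" and eq1: "Qpt lam 1 n = ctr lam + r1 *\<^sub>R ?v"
    using Q(1,2) by (simp_all only: r0_def r1_def)
  have "{Qpt lam 0 n, Qpt lam 0 (n - 1), Qpt lam 1 (n - 1), Qpt lam 1 n} =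
      {ctr lam + r1 *\<^sub>R ?v, Qpt lam 0 n, ctr lam + r0 *\<^sub>R ?v, Qpt lam 1 (n - 1)}"
    unfolding eq0 eq1 by blast
  then show "ctr lam + R *\<^sub>R ?v \<in> in_atom lam n"
    unfolding in_atom_def using diagonal_interior_hull_line(1)[OF R side] by simp
  show "ctr lam + R *\<^sub>R ?v \<in> closed_segment (Qpt lam 0 (n - 1)) (Qpt lam 1 n)"
    unfolding eq0 eq1 using diagonal_interior_hull_line(2)[OF R side] by (simp add: closed_segment_commute)
qed

text \<open>One vertex of the outer atom on either side of the segment of fixed points. For \<open>m = 2\<close> the atom has two
  more vertices.\<close>

definition upper_vertex :: "nat \<Rightarrow> point" where
  "upper_vertex m = (if m = 1 then (1, 1) else P0 lam (m - 1))"

definition lower_vertex :: "nat \<Rightarrow> point" where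
  "lower_vertex m = (if m = 1 then P' lam else P1 lam m)"

lemma out_atom_supset:
  assumes "1 \<le> m"
  shows "interior (convex hull {P0 lam m, upper_vertex m, P1 lam (m - 1), lower_vertex m}) \<subseteq> out_atom lam m"
  unfolding out_atom_def upper_vertex_def lower_vertex_def
  using assms by (intro interior_mono hull_mono) auto

text \<open>The segment of fixed points is a diagonal of the quadrilateral with the two further vertices
  \<open>upper_vertex\<close> and \<open>lower_vertex\<close>; the last two assumptions say that these lie on different sides of it.\<close>

lemma out_atom_member:
  assumes m: "1 \<le> m" "(2 * real m + 1) * \<theta> \<le> pi / 2"
    and B: "0 < B * sin ((2 * real m + 1) * \<theta>) - b" "0 < b - B * sin ((2 * real m - 3) * \<theta>)"
      "a + lam + B * cos ((2 * real m + 2) * \<theta>) < 1"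
    and upper: "fst (P0 lam m) < fst (upper_vertex m)"
    and lower: "(fst (lower_vertex m) - fst (P0 lam m)) * sin ((2 * real m + 1) * \<theta>)
      < (1 - snd (lower_vertex m)) * cos ((2 * real m + 2) * \<theta>)"
  shows "out_pt m B \<in> out_atom lam m" "out_pt m B \<in> closed_segment (P0 lam m) (P1 lam (m - 1))"
proof -
  define v where "v = (cos ((2 * real m + 2) * \<theta>), - sin ((2 * real m + 1) * \<theta>))"
  define c where "c = (a + lam, 1 + b)"
  have out: "out_pt m C = c + C *\<^sub>R v" for C by (simp add: out_pt_def c_def v_def)
  have sinm: "0 < sin ((2 * real m + 1) * \<theta>)"
    using sin_multiple_pos[OF m(2), of "2 * real m + 1"] by simp
  define B0 where "B0 = b / sin ((2 * real m + 1) * \<theta>)"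
  have P0: "P0 lam m = c + B0 *\<^sub>R v"
    using P0_eq[OF less_imp_neq[OF sinm, symmetric]] by (simp add: out B0_def)
  have B0: "B0 < B" using B(1) sinm by (simp add: B0_def field_simps)
  have "\<exists>B1. B < B1 \<and> P1 lam (m - 1) = c + B1 *\<^sub>R v"
  proof -
    consider "m = 1" | "m = 2" | "3 \<le> m" using m(1) by linarith
    then show ?thesis
    proof cases
      case 1
      then show ?thesis using P1_0_eq cos_4_pos B(3)
        by (intro exI[of _ "(1 - a - lam) / cos (4 * \<theta>)"]) (simp add: out[symmetric] field_simps)
    next
      case 2
      then show ?thesis using P1_1_eq cos_6_pos B(3)
        by (intro exI[of _ "(1 - a - lam) / cos (6 * \<theta>)"]) (simp add: out[symmetric] field_simps)
    next
      case 3
      have m1: "2 * real (m - 1) - 1 = 2 * real m - 3" "m - 1 + 1 = m" using 3 by (simp_all add: of_nat_diff)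
      have sins: "0 < sin ((2 * real m - 3) * \<theta>)" using 3 by (auto intro!: sin_multiple_pos[OF m(2)])
      have "P1 lam (m - 1) = out_pt m (b / sin ((2 * real m - 3) * \<theta>))"
        using P1_eq[of "m - 1"] sins 3 unfolding m1 by auto
      moreover have "B < b / sin ((2 * real m - 3) * \<theta>)" using B(2) sins by (simp add: pos_less_divide_eq)
      ultimately show ?thesis by (auto simp: out)
    qed
  qed
  then obtain B1 where B1: "B < B1" "P1 lam (m - 1) = c + B1 *\<^sub>R v" by blast
  have sndP0: "snd (P0 lam m) = 1" "snd (upper_vertex m) = 1" by (simp_all add: P0_def upper_vertex_def)
  have "0 < cross v (upper_vertex m - (c + B0 *\<^sub>R v))" "cross v (lower_vertex m - (c + B0 *\<^sub>R v)) < 0"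
    unfolding P0[symmetric] using upper lower sinm sndP0
    by (simp_all add: cross_def v_def algebra_simps mult_strict_left_mono)
  note diag = diagonal_interior_hull_line[OF B0 B1(1) this]
  show "out_pt m B \<in> out_atom lam m"
    unfolding out using diag(1) out_atom_supset[OF m(1)] by (auto simp: P0[symmetric] B1(2)[symmetric])
  show "out_pt m B \<in> closed_segment (P0 lam m) (P1 lam (m - 1))"
    unfolding out using diag(2) by (simp add: P0[symmetric] B1(2)[symmetric])
qed

end

text \<open>The inequalities of the cycle place \<open>z\<close> strictly between the end points of both segments of fixed
  points, and each segment is a diagonal of a quadrilateral in the atom.\<close>

lemma (in regular_cycle) regular:
  assumes "m \<le> M lam" "n + 1 \<le> N lam"
    and "fst (P0 lam m) < fst (upper_vertex m)"
    and "(fst (lower_vertex m) - fst (P0 lam m)) * sin ((2 * real m + 1) * \<theta>)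
      < (1 - snd (lower_vertex m)) * cos ((2 * real m + 2) * \<theta>)"
  shows "regular_fixed_point lam m n z"
proof -
  have "z \<in> out_atom lam m" "z \<in> closed_segment (P0 lam m) (P1 lam (m - 1))"
    using out_atom_member[OF m _ fourth_pos _ assms(3,4)] box(2,4) z_out by (simp_all add: height_def s_def)
  moreover have "z \<in> in_atom lam n" "z \<in> closed_segment (Qpt lam 0 (n - 1)) (Qpt lam 1 n)"
  proof -
    have "snd z = \<kappa> + R * sin (in_angle n + \<theta>)" by (simp add: z_in polar_def ctr_eq)
    then have top: "\<kappa> + R * sin (in_angle n + \<theta>) < 1" using box(4) z_eq by simp
    have "0 < fourth_coord z" using fourth_coord_out_pt[of m B] z_out fourth_pos by simp
    then have bottom: "1 < \<kappa> + R * sin (in_angle n + 5 * \<theta>)" unfolding z_in fourth_coord_polar by simp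
    show "z \<in> in_atom lam n" "z \<in> closed_segment (Qpt lam 0 (n - 1)) (Qpt lam 1 n)"
      using in_atom_member[OF n top bottom] by (simp_all add: z_in)
  qed
  ultimately show ?thesis
    unfolding regular_fixed_point_def using assms(1,2) m(1) n(1) z_in_Lambda L_fixed by blast
qed

section \<open>The total area as a double sum\<close>

lemma sin_ge_half: "x / 2 \<le> sin x" if "0 \<le> x" "x \<le> pi / 2" for x :: real
proof -
  have "\<bar>sin x - x\<bar> \<le> x ^ 3 / 6"
    using Maclaurin_sin_bound[of x 3] that
    by (simp add: sin_coeff_def numeral_3_eq_3 fact_numeral)
  moreover have "x ^ 3 / 6 \<le> x / 2"
  proof -
    have "x \<le> 1.6" using that pi_approx by simp
    then have "x * x \<le> 1.6 * 1.6" using that by (intro mult_mono) auto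
    then have "x * (x * x) \<le> x * 3" using that by (intro mult_left_mono) auto
    then show ?thesis by (simp add: power3_eq_cube)
  qed
  ultimately show ?thesis by linarith
qed

context admissible
begin

lemma theta_lam: "lam / 2 \<le> \<theta>" "\<theta> \<le> lam"
proof -
  show "lam / 2 \<le> \<theta>" using sin_x_le_x[of \<theta>] theta_bounds by (simp add: sin_theta)
  show "\<theta> \<le> lam" using sin_ge_half[of \<theta>] theta_bounds by (simp add: sin_theta)
qed

definition regular_pairs :: "(nat \<times> nat) set" where
  "regular_pairs = {(m, n). \<exists>z. regular_fixed_point lam m n z}"

lemma regular_pairsD:
  assumes "(m, n) \<in> regular_pairs"
  shows "regular_cycle lam m n (cycle_R lam m n) (cycle_B lam m n) (cycle_pt m n)"
    and "m \<le> M lam" "n < N lam"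
proof -
  obtain z where z: "regular_fixed_point lam m n z" using assms by (auto simp: regular_pairs_def)
  then obtain R B where "regular_cycle lam m n R B z" using regular_imp_cycle by blast
  then show "regular_cycle lam m n (cycle_R lam m n) (cycle_B lam m n) (cycle_pt m n)"
    using regular_cycle_unique by metis
  show "m \<le> M lam" "n < N lam" using z by (auto simp: regular_fixed_point_def)
qed

lemma regular_fixed_point_unique: "regular_fixed_point lam m n z \<Longrightarrow> z = cycle_pt m n"
  using regular_imp_cycle regular_cycle_unique by blast

lemma regular_orbits_eq: "regular_orbits lam = (\<lambda>(m, n). orbit lam (cycle_pt m n)) ` regular_pairs"
proof -
  have "S \<in> regular_orbits lam \<longleftrightarrow> (\<exists>m n. (m, n) \<in> regular_pairs \<and> S = orbit lam (cycle_pt m n))" for S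
    unfolding regular_orbits_def regular_pairs_def using regular_fixed_point_unique by blast
  then show ?thesis by (auto intro: rev_image_eqI)
qed

lemma inj_on_orbit: "inj_on (\<lambda>(m, n). orbit lam (cycle_pt m n)) regular_pairs"
proof (rule inj_onI)
  fix x y
  assume xy: "x \<in> regular_pairs" "y \<in> regular_pairs"
    "(case x of (m, n) \<Rightarrow> orbit lam (cycle_pt m n)) = (case y of (m, n) \<Rightarrow> orbit lam (cycle_pt m n))"
  obtain m n m' n' where eq: "x = (m, n)" "y = (m', n')" by (cases x; cases y)
  show "x = y"
    using orbit_determines[OF regular_pairsD(1) regular_pairsD(1), of m n m' n'] xy unfolding eq by simp
qed

text \<open>The total area of the islands of the cycle with indices \<open>m\<close> and \<open>n\<close>.\<close>

definition weight :: "nat \<Rightarrow> nat \<Rightarrow> real" where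
  "weight m n = (if (m, n) \<in> regular_pairs then real (4 * (m + n) - 1) *
     (pi * (island_radius (orbit lam (cycle_pt m n)))\<^sup>2 * (1 - lam\<^sup>2 / 4)) else 0)"

lemma total_island_area_pairs: "total_island_area lam = (\<Sum>(m, n)\<in>regular_pairs. weight m n)"
proof -
  have island: "(\<Sum>p\<in>orbit lam (cycle_pt m n). area lam (island lam (orbit lam (cycle_pt m n)) p)) = weight m n"
    if "(m, n) \<in> regular_pairs" for m n
  proof -
    interpret regular_cycle lam m n "cycle_R lam m n" "cycle_B lam m n" "cycle_pt m n"
      using regular_pairsD(1)[OF that] .
    have "0 \<le> island_radius (orbit lam (cycle_pt m n))"
      using island_radius_bounds(1) gap_pos by linarith
    then show ?thesis using that
      by (simp add: island_def area_Q_disc[OF lam_bounds(2)] card_orbit period_def weight_def)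
  qed
  show ?thesis
    unfolding total_island_area_def regular_orbits_eq sum.reindex[OF inj_on_orbit]
    using island by (intro sum.cong) auto
qed

lemma total_island_area_eq: "total_island_area lam = (\<Sum>m. \<Sum>n<N lam. weight m n)"
proof -
  have "total_island_area lam = (\<Sum>(m, n)\<in>{..M lam} \<times> {..<N lam}. weight m n)"
    unfolding total_island_area_pairs using regular_pairsD by (intro sum.mono_neutral_left) (auto simp: weight_def)
  also have "\<dots> = (\<Sum>m\<le>M lam. \<Sum>n<N lam. weight m n)" by (simp add: sum.cartesian_product)
  also have "\<dots> = (\<Sum>m. \<Sum>n<N lam. weight m n)"
    using regular_pairsD(2) by (intro suminf_finite[symmetric]) (auto simp: weight_def intro!: sum.neutral)
  finally show ?thesis .
qed

lemma N_lam: "n < N lam \<Longrightarrow> real n * lam \<le> 1"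
proof -
  assume "n < N lam"
  then have "(4 * real n + 5) * \<theta> \<le> pi / 2" by (intro N_bound) simp
  then have "4 * (real n * \<theta>) \<le> pi / 2" using theta_bounds by (simp add: algebra_simps)
  moreover have "real n * (lam / 2) \<le> real n * \<theta>" using theta_lam by (intro mult_left_mono) auto
  ultimately show ?thesis using pi_less_4 by simp
qed

end

context regular_cycle
begin

lemma period_le: "real period * lam \<le> 10"
proof -
  have "real period \<le> 4 * (real m + real n)" by (simp add: period_def)
  then have "real period * (lam / 2) \<le> 4 * (real m + real n) * \<theta>"
    using theta_lam lam_pos by (intro mult_mono) auto
  also have "\<dots> \<le> 3 * pi / 2" using m n theta_bounds by (simp add: algebra_simps)
  finally show ?thesis using pi_approx by simp
qed

text \<open>For \<open>m \<ge> 3\<close> the amplitude is eliminated from \<open>height\<close> and \<open>fourth\<close>, which both bound the radius: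
  the combination with the two sines as coefficients is \<open>b\<close> times the difference of the sines, and this is at most
  \<open>4 * \<theta>\<close>.\<close>

lemma island_radius_le: "real m * island_radius (orbit lam z) \<le> 5 * lam"
proof (cases "3 \<le> m")
  case True
  let ?r = "island_radius (orbit lam z)"
  let ?S1 = "sin ((2 * real m + 1) * \<theta>)" and ?S3 = "sin ((2 * real m - 3) * \<theta>)"
  have r: "0 \<le> ?r" using island_radius_bounds(1) gap_pos by linarith
  have "?S1 - ?S3 = 2 * sin (((2 * real m + 1) * \<theta> - (2 * real m - 3) * \<theta>) / 2)
      * cos (((2 * real m + 1) * \<theta> + (2 * real m - 3) * \<theta>) / 2)"
    by (rule sin_diff_sin)
  also have "((2 * real m + 1) * \<theta> - (2 * real m - 3) * \<theta>) / 2 = 2 * \<theta>" by (simp add: algebra_simps)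
  also have "2 * sin (2 * \<theta>) * cos (((2 * real m + 1) * \<theta> + (2 * real m - 3) * \<theta>) / 2) \<le> 2 * sin (2 * \<theta>) * 1"
    using theta_bounds pi_gt_zero by (intro mult_left_mono cos_le_one mult_nonneg_nonneg sin_ge_zero) linarith+
  also have "\<dots> \<le> 2 * (2 * \<theta>) * 1"
    using theta_bounds by (intro mult_right_mono mult_left_mono sin_x_le_x) auto
  finally have diff: "?S1 - ?S3 \<le> 4 * \<theta>" by simp
  have angle: "0 \<le> (2 * real m - 3) * \<theta>" "(2 * real m - 3) * \<theta> \<le> pi / 2"
    using True m theta_bounds by (simp_all add: algebra_simps)
  have "real m * \<theta> \<le> (2 * real m - 3) * \<theta>" using True theta_bounds by (intro mult_right_mono) auto
  then have S3: "real m * \<theta> / 2 \<le> ?S3" using sin_ge_half[OF angle] by linarith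
  have S1: "0 < ?S1" using sin_multiple_pos[OF m(2), of "2 * real m + 1"] by simp
  have "0 \<le> ?S3" using True by (intro less_imp_le sin_multiple_pos[OF m(2)]) auto
  then have "(real m * \<theta> / 2) * ?r \<le> ?S3 * height"
    using S3 r island_radius_bounds(2) theta_bounds by (intro mult_mono) auto
  also have "\<dots> \<le> ?S3 * height + ?S1 * fourth"
    using S1 fourth_pos by (simp add: fourth_def)
  also have "\<dots> = b * (?S1 - ?S3)" by (simp add: height_def fourth_def algebra_simps)
  also have "\<dots> \<le> b * (4 * \<theta>)" using diff b_bounds by (intro mult_left_mono) auto
  finally have "\<theta> * (real m * ?r) \<le> \<theta> * (8 * b)" by (simp add: algebra_simps)
  then have "real m * ?r \<le> 8 * b" using theta_bounds by simp
  also have "8 * b \<le> 5 * lam"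
  proof -
    have "lam * a \<le> lam * 1" using a_bounds lam_pos by (intro mult_left_mono) auto
    then show ?thesis using two_b lam_pos by linarith
  qed
  finally show ?thesis .
next
  case False
  have "height \<le> B * sin ((2 * real m + 1) * \<theta>)" using b_bounds by (simp add: height_def)
  also have "\<dots> \<le> 1 / 2 * (5 * lam)"
  proof (rule mult_mono)
    have "sin ((2 * real m + 1) * \<theta>) \<le> (2 * real m + 1) * \<theta>" using theta_bounds by (intro sin_x_le_x) simp
    also have "\<dots> \<le> 5 * lam" using False theta_lam theta_bounds by (intro mult_mono) auto
    finally show "sin ((2 * real m + 1) * \<theta>) \<le> 5 * lam" .
  qed (use B_less a_bounds B_pos sin_multiple_pos[OF m(2), of "2 * real m + 1"] in auto)
  finally have "island_radius (orbit lam z) \<le> 5 / 2 * lam" using island_radius_bounds(2) by linarith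
  then have "real m * island_radius (orbit lam z) \<le> 2 * (5 / 2 * lam)"
    using False island_radius_bounds(1) gap_pos by (intro mult_mono) auto
  then show ?thesis by simp
qed

end

context admissible
begin

lemma weight_nonneg: "0 \<le> weight m n"
  using discr_pos[OF lam_bounds(2)] by (simp add: weight_def)

lemma weight_le: "(real m)\<^sup>2 * weight m n \<le> 1000 * lam"
proof (cases "(m, n) \<in> regular_pairs")
  case True
  interpret regular_cycle lam m n "cycle_R lam m n" "cycle_B lam m n" "cycle_pt m n"
    using regular_pairsD(1)[OF True] .
  let ?r = "island_radius (orbit lam (cycle_pt m n))"
  have r: "0 \<le> ?r" using island_radius_bounds(1) gap_pos by linarith
  have "(real m * ?r)\<^sup>2 \<le> (5 * lam)\<^sup>2" using island_radius_le r by (intro power_mono) auto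
  moreover have "pi * (1 - lam\<^sup>2 / 4) \<le> 4 * 1"
    using pi_less_4 lam_sq by (intro mult_mono) auto
  \<comment> \<open>10 bounds the period times \<open>lam\<close>, 4 bounds \<open>pi\<close>\<close>
  ultimately have "(real period * lam) * ((pi * (1 - lam\<^sup>2 / 4)) * (real m * ?r)\<^sup>2) \<le> 10 * (4 * (5 * lam)\<^sup>2)"
    using period_le lam_pos lam_sq by (intro mult_mono) auto
  moreover have "(real period * lam) * ((pi * (1 - lam\<^sup>2 / 4)) * (real m * ?r)\<^sup>2) = lam * ((real m)\<^sup>2 * weight m n)"
    using True by (simp add: weight_def period_def power_mult_distrib mult_ac)
  moreover have "10 * (4 * (5 * lam)\<^sup>2) = lam * (1000 * lam)" by (simp add: power2_eq_square)
  ultimately have "lam * ((real m)\<^sup>2 * weight m n) \<le> lam * (1000 * lam)" by simp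
  then show ?thesis using lam_pos by simp
qed (use lam_pos in \<open>simp add: weight_def\<close>)

lemma weight_eq_0: "n \<ge> N lam \<Longrightarrow> weight m n = 0" "weight 0 n = 0"
proof -
  show "n \<ge> N lam \<Longrightarrow> weight m n = 0" using regular_pairsD(3) by (fastforce simp: weight_def)
  have "(0, n) \<notin> regular_pairs" by (auto simp: regular_pairs_def regular_fixed_point_def)
  then show "weight 0 n = 0" by (simp add: weight_def)
qed

end

section \<open>Riemann sums\<close>

lemma step_function_integral:
  fixes w :: "nat \<Rightarrow> real" and h c :: real
  assumes h: "0 < h" and K: "real K * h \<le> c" and w: "\<And>n. K \<le> n \<Longrightarrow> w n = 0"
  defines "f \<equiv> \<lambda>u. if 0 \<le> u \<and> u < c then w (nat \<lfloor>u / h\<rfloor>) / h else 0"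
  shows "f \<in> borel_measurable lborel" "integral\<^sup>L lborel f = (\<Sum>n<K. w n)"
proof -
  have cell: "u \<in> {real n * h..<(real n + 1) * h} \<longleftrightarrow> 0 \<le> u \<and> nat \<lfloor>u / h\<rfloor> = n" for u n
  proof -
    have "u \<in> {real n * h..<(real n + 1) * h} \<longleftrightarrow> real n \<le> u / h \<and> u / h < real n + 1"
      using h by (simp add: field_simps)
    also have "\<dots> \<longleftrightarrow> \<lfloor>u / h\<rfloor> = int n" by (simp add: floor_eq_iff)
    also have "\<dots> \<longleftrightarrow> 0 \<le> u \<and> nat \<lfloor>u / h\<rfloor> = n"
    proof -
      have "0 \<le> \<lfloor>u / h\<rfloor> \<longleftrightarrow> 0 \<le> u" using h by (simp add: zero_le_divide_iff)
      then show ?thesis by linarith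
    qed
    finally show ?thesis .
  qed
  have f: "f = (\<lambda>u. \<Sum>n<K. indicator {real n * h..<(real n + 1) * h} u *\<^sub>R (w n / h))"
  proof
    fix u
    have ind: "indicator {real n * h..<(real n + 1) * h} u *\<^sub>R (w n / h) =
        (if n = nat \<lfloor>u / h\<rfloor> then (if 0 \<le> u then w n / h else 0) else 0)" for n
      using cell[of u n] by (auto simp: indicator_def)
    have "u < c" if "0 \<le> u" "nat \<lfloor>u / h\<rfloor> < K"
    proof -
      have "u < (real (nat \<lfloor>u / h\<rfloor>) + 1) * h" using cell[of u "nat \<lfloor>u / h\<rfloor>"] that(1) by simp
      also have "\<dots> \<le> real K * h" using that(2) h by (intro mult_right_mono) auto
      finally show ?thesis using K by simp
    qed
    then show "f u = (\<Sum>n<K. indicator {real n * h..<(real n + 1) * h} u *\<^sub>R (w n / h))"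
      unfolding ind using w[of "nat \<lfloor>u / h\<rfloor>"] by (auto simp: f_def)
  qed
  show "f \<in> borel_measurable lborel" unfolding f by measurable
  have "emeasure lborel {real n * h..<(real n + 1) * h} < \<infinity>" for n
    using h by (simp add: emeasure_lborel_Ico)
  moreover have "measure lborel {real n * h..<(real n + 1) * h} = h" for n
    using h by (simp add: measure_lborel_Ico algebra_simps)
  ultimately show "integral\<^sup>L lborel f = (\<Sum>n<K. w n)"
    unfolding f using h by (subst Bochner_Integration.integral_sum) auto
qed

section \<open>Asymptotics for small parameters\<close>

lemma eventually_admissible: "eventually admissible (at_right 0)"
proof -
  have "0 < lam_plus" unfolding lam_plus_def using pi_gt_zero
    by (intro mult_pos_pos cos_gt_zero_pi) linarith+
  then have "eventually (\<lambda>lam. lam \<in> {0<..<lam_plus}) (at_right 0)" by (rule eventually_at_right_real)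
  then show ?thesis by eventually_elim (simp add: admissible_def)
qed

lemma lam_tendsto: "((\<lambda>lam::real. lam) \<longlongrightarrow> 0) (at_right 0)"
  by (rule tendsto_ident_at)

lemma sin_theta_quotient: "((\<lambda>lam. sin (k * theta lam) / lam) \<longlongrightarrow> k / 2) (at_right 0)"
proof -
  have "((\<lambda>lam::real. sin (k * arcsin (lam / 2))) has_real_derivative k / 2) (at 0)"
    by (auto intro!: derivative_eq_intros)
  then have "((\<lambda>lam::real. sin (k * arcsin (lam / 2))) has_real_derivative k / 2) (at_right 0)"
    by (rule has_field_derivative_at_within)
  then show ?thesis by (simp add: has_field_derivative_iff theta_def)
qed

lemma theta_quotient: "((\<lambda>lam. theta lam / lam) \<longlongrightarrow> 1 / 2) (at_right 0)"
proof -
  have "((\<lambda>lam::real. arcsin (lam / 2)) has_real_derivative 1 / 2) (at 0)"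
    by (auto intro!: derivative_eq_intros)
  then have "((\<lambda>lam::real. arcsin (lam / 2)) has_real_derivative 1 / 2) (at_right 0)"
    by (rule has_field_derivative_at_within)
  then show ?thesis by (simp add: has_field_derivative_iff theta_def)
qed

lemma lam_nonzero: "eventually (\<lambda>lam::real. lam \<noteq> 0) (at_right 0)"
  by (rule eventually_at_right_less[THEN eventually_mono]) auto

lemma theta_tendsto: "(theta \<longlongrightarrow> 0) (at_right 0)"
proof -
  have "((\<lambda>lam. lam * (theta lam / lam)) \<longlongrightarrow> 0 * (1 / 2)) (at_right 0)"
    by (intro tendsto_intros lam_tendsto theta_quotient)
  moreover have "eventually (\<lambda>lam. lam * (theta lam / lam) = theta lam) (at_right 0)"
    using lam_nonzero by eventually_elim simp
  ultimately show ?thesis by (simp add: tendsto_cong)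
qed

lemma kap_tendsto: "(kap \<longlongrightarrow> 1 / 2) (at_right 0)"
  and ea_tendsto: "(ea \<longlongrightarrow> 1 / 2) (at_right 0)"
  and eb_tendsto: "(eb \<longlongrightarrow> 0) (at_right 0)"
  and eb_quotient: "((\<lambda>lam. eb lam / lam) \<longlongrightarrow> 1 / 4) (at_right 0)"
proof -
  show "(kap \<longlongrightarrow> 1 / 2) (at_right 0)" "(ea \<longlongrightarrow> 1 / 2) (at_right 0)" "(eb \<longlongrightarrow> 0) (at_right 0)"
    unfolding kap_def[abs_def] ea_def[abs_def] eb_def[abs_def]
    by (auto intro!: tendsto_eq_intros lam_tendsto)
  have "((\<lambda>lam::real. 1 / (4 - lam\<^sup>2)) \<longlongrightarrow> 1 / 4) (at_right 0)"
    by (auto intro!: tendsto_eq_intros lam_tendsto)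
  moreover have "eventually (\<lambda>lam. 1 / (4 - lam\<^sup>2) = eb lam / lam) (at_right 0)"
    using lam_nonzero by eventually_elim (simp add: eb_def)
  ultimately show "((\<lambda>lam. eb lam / lam) \<longlongrightarrow> 1 / 4) (at_right 0)" by (rule Lim_transform_eventually)
qed

lemma sin_mult_tendsto: "((\<lambda>lam. sin (k * theta lam)) \<longlongrightarrow> 0) (at_right 0)"
  and cos_mult_tendsto: "((\<lambda>lam. cos (k * theta lam)) \<longlongrightarrow> 1) (at_right 0)"
  by (auto intro!: tendsto_eq_intros theta_tendsto)

lemma tan_quotient_tendsto:
  assumes "k \<noteq> 0"
  shows "((\<lambda>lam. tan (theta lam) / tan (k * theta lam)) \<longlongrightarrow> 1 / k) (at_right 0)"
proof -
  have "((\<lambda>lam. (sin (1 * theta lam) / lam) / cos (1 * theta lam) * (cos (k * theta lam) / (sin (k * theta lam) / lam)))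
      \<longlongrightarrow> (1 / 2) / 1 * (1 / (k / 2))) (at_right 0)"
    using assms by (intro tendsto_intros sin_theta_quotient cos_mult_tendsto) auto
  moreover have "eventually (\<lambda>lam. (sin (1 * theta lam) / lam) / cos (1 * theta lam) * (cos (k * theta lam) / (sin (k * theta lam) / lam))
      = tan (theta lam) / tan (k * theta lam)) (at_right 0)"
    using lam_nonzero by eventually_elim (simp add: tan_def)
  ultimately show ?thesis using assms by (simp add: tendsto_cong)
qed

subsection \<open>The vertices of the outer atoms\<close>

lemma fst_P0_tendsto: "((\<lambda>lam. fst (P0 lam m)) \<longlongrightarrow> (1 + 1 / (2 * real m + 1)) / 2) (at_right 0)"
proof -
  have "((\<lambda>lam. 1 / 2 * (1 + 2 * lam + tan (theta lam) / tan ((2 * real m + 1) * theta lam)))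
      \<longlongrightarrow> 1 / 2 * (1 + 2 * 0 + 1 / (2 * real m + 1))) (at_right 0)"
    by (intro tendsto_intros lam_tendsto tan_quotient_tendsto) simp
  then show ?thesis by (simp add: P0_def)
qed

lemma lower_vertex_tendsto:
  assumes "1 \<le> m"
  shows "((\<lambda>lam. fst (admissible.lower_vertex lam m)) \<longlongrightarrow> (1 + 1 / (2 * real m - 1)) / 2) (at_right 0)"
    and "((\<lambda>lam. (1 - snd (admissible.lower_vertex lam m)) / lam) \<longlongrightarrow> 1 / (2 * real m - 1)) (at_right 0)"
proof -
  have lv: "eventually (\<lambda>lam. admissible.lower_vertex lam m = (if m = 1 then P' lam else P1 lam m)) (at_right 0)"
    using eventually_admissible by eventually_elim (simp add: admissible.lower_vertex_def)
  have k: "2 * real m - 1 \<noteq> 0" using assms by linarith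
  have x: "((\<lambda>lam. fst (if m = 1 then P' lam else P1 lam m)) \<longlongrightarrow> (1 + 1 / (2 * real m - 1)) / 2) (at_right 0)"
  proof (cases "m = 1")
    case True
    have "((\<lambda>lam::real. 1 - 2 * lam^2 + 6 * lam^3 + lam^4 - 5 * lam^5 + lam^7) \<longlongrightarrow> 1 - 2 * 0^2 + 6 * 0^3 + 0^4 - 5 * 0^5 + 0^7) (at_right 0)"
      by (intro tendsto_intros lam_tendsto)
    then show ?thesis using True by (simp add: P'_def)
  next
    case False
    have "((\<lambda>lam. 1 / 2 * (1 + 2 * lam - lam^2 + lam^4 +
          (1 - 3 * lam^2 + lam^4) * (tan (theta lam) / tan ((2 * real m - 1) * theta lam))))
       \<longlongrightarrow> 1 / 2 * (1 + 2 * 0 - 0^2 + 0^4 + (1 - 3 * 0^2 + 0^4) * (1 / (2 * real m - 1)))) (at_right 0)"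
      by (intro tendsto_intros lam_tendsto tan_quotient_tendsto k)
    then show ?thesis using False assms by (simp add: P1_def)
  qed
  then show "((\<lambda>lam. fst (admissible.lower_vertex lam m)) \<longlongrightarrow> (1 + 1 / (2 * real m - 1)) / 2) (at_right 0)"
    by (rule Lim_transform_eventually) (use lv in \<open>eventually_elim, simp\<close>)
  have y: "((\<lambda>lam. (1 - snd (if m = 1 then P' lam else P1 lam m)) / lam) \<longlongrightarrow> 1 / (2 * real m - 1)) (at_right 0)"
  proof (cases "m = 1")
    case True
    have "((\<lambda>lam::real. 1 - 3 * lam - lam^2 + 4 * lam^3 - lam^5) \<longlongrightarrow> 1 - 3 * 0 - 0^2 + 4 * 0^3 - 0^5) (at_right 0)"
      by (intro tendsto_intros lam_tendsto)
    moreover have "eventually (\<lambda>lam. 1 - 3 * lam - lam^2 + 4 * lam^3 - lam^5 = (1 - snd (P' lam)) / lam) (at_right 0)"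
      using lam_nonzero by eventually_elim (simp add: P'_def field_simps eval_nat_numeral)
    ultimately show ?thesis using True by (simp add: tendsto_cong)
  next
    case False
    have "((\<lambda>lam. 1 / 2 * (2 - lam^2) * (tan (theta lam) / tan ((2 * real m - 1) * theta lam)) - lam^2 / 2)
        \<longlongrightarrow> 1 / 2 * (2 - 0^2) * (1 / (2 * real m - 1)) - 0^2 / 2) (at_right 0)"
      by (intro tendsto_intros lam_tendsto tan_quotient_tendsto k) simp
    moreover have "eventually (\<lambda>lam. 1 / 2 * (2 - lam^2) * (tan (theta lam) / tan ((2 * real m - 1) * theta lam)) - lam^2 / 2
        = (1 - snd (P1 lam m)) / lam) (at_right 0)"
      using lam_nonzero
    proof eventually_elim
      case (elim lam)
      define q where "q = tan (theta lam) / tan ((2 * real m - 1) * theta lam)"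
      have "snd (P1 lam m) = 1 + lam^3 / 2 + lam / 2 * (lam^2 - 2) * q"
        using False assms by (simp add: P1_def q_def)
      then show ?case unfolding q_def[symmetric] using elim by (simp add: field_simps eval_nat_numeral)
    qed
    ultimately show ?thesis using False by (simp add: tendsto_cong)
  qed
  then show "((\<lambda>lam. (1 - snd (admissible.lower_vertex lam m)) / lam) \<longlongrightarrow> 1 / (2 * real m - 1)) (at_right 0)"
    by (rule Lim_transform_eventually) (use lv in \<open>eventually_elim, simp\<close>)
qed

lemma eventually_less:
  fixes f g :: "'a \<Rightarrow> real"
  assumes "(f \<longlongrightarrow> l) net" "(g \<longlongrightarrow> k) net" "l < k"
  shows "eventually (\<lambda>x. f x < g x) net"
proof -
  have "l < (l + k) / 2" "(l + k) / 2 < k" using assms(3) by simp_all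
  then have "eventually (\<lambda>x. f x < (l + k) / 2) net" "eventually (\<lambda>x. (l + k) / 2 < g x) net"
    using order_tendstoD assms(1,2) by blast+
  then show ?thesis by eventually_elim simp
qed

text \<open>In the limit, with the second coordinate replaced by the distance from the side \<open>y = 1\<close> in units of
  \<open>lam\<close>, the upper vertex is \<open>(m / (2 * m - 1), 0)\<close>, the lower one is \<open>(m / (2 * m - 1), 1 / (2 * m - 1))\<close>, and the
  segment of fixed points starts at \<open>((m + 1) / (2 * m + 1), 0)\<close> with slope \<open>(2 * m + 1) / 2\<close>.\<close>

lemma eventually_vertices:
  assumes "1 \<le> m"
  shows "eventually (\<lambda>lam. fst (P0 lam m) < fst (admissible.upper_vertex lam m)) (at_right 0)"
    and "eventually (\<lambda>lam. (fst (admissible.lower_vertex lam m) - fst (P0 lam m)) * sin ((2 * real m + 1) * theta lam)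
      < (1 - snd (admissible.lower_vertex lam m)) * cos ((2 * real m + 2) * theta lam)) (at_right 0)"
proof -
  have "((\<lambda>lam. fst (admissible.upper_vertex lam m)) \<longlongrightarrow> (1 + 1 / (2 * real m - 1)) / 2) (at_right 0)"
  proof (cases "m = 1")
    case True
    have "eventually (\<lambda>lam. 1 = fst (admissible.upper_vertex lam m)) (at_right 0)"
      using eventually_admissible by eventually_elim (simp add: admissible.upper_vertex_def True)
    then show ?thesis using True tendsto_cong by fastforce
  next
    case False
    have "eventually (\<lambda>lam. fst (P0 lam (m - 1)) = fst (admissible.upper_vertex lam m)) (at_right 0)"
      using eventually_admissible by eventually_elim (use False in \<open>simp add: admissible.upper_vertex_def\<close>)
    moreover have "2 * real (m - 1) + 1 = 2 * real m - 1" using assms by (simp add: of_nat_diff)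
    ultimately show ?thesis using fst_P0_tendsto[of "m - 1"] by (simp add: tendsto_cong)
  qed
  moreover have "(1 + 1 / (2 * real m + 1)) / 2 < (1 + 1 / (2 * real m - 1)) / 2"
    using assms by (simp add: divide_strict_left_mono)
  ultimately show "eventually (\<lambda>lam. fst (P0 lam m) < fst (admissible.upper_vertex lam m)) (at_right 0)"
    by (intro eventually_less[OF fst_P0_tendsto])
  have "((\<lambda>lam. (fst (admissible.lower_vertex lam m) - fst (P0 lam m)) * (sin ((2 * real m + 1) * theta lam) / lam)) \<longlongrightarrow>
      ((1 + 1 / (2 * real m - 1)) / 2 - (1 + 1 / (2 * real m + 1)) / 2) * ((2 * real m + 1) / 2)) (at_right 0)"
    by (intro tendsto_intros lower_vertex_tendsto assms fst_P0_tendsto sin_theta_quotient)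
  moreover have "((\<lambda>lam. (1 - snd (admissible.lower_vertex lam m)) / lam * cos ((2 * real m + 2) * theta lam)) \<longlongrightarrow>
      1 / (2 * real m - 1) * 1) (at_right 0)"
    by (intro tendsto_intros lower_vertex_tendsto assms cos_mult_tendsto)
  moreover have "((1 + 1 / (2 * real m - 1)) / 2 - (1 + 1 / (2 * real m + 1)) / 2) * ((2 * real m + 1) / 2)
      < 1 / (2 * real m - 1) * 1"
  proof -
    define x where "x = 2 * real m - 1"
    have x: "0 < x" "2 * real m + 1 = x + 2" using assms by (simp_all add: x_def)
    have "((1 + 1 / x) / 2 - (1 + 1 / (x + 2)) / 2) * ((x + 2) / 2) = 1 / (2 * x)"
      using x(1) by (simp add: divide_simps) (simp add: algebra_simps)
    also have "\<dots> < 1 / x * 1" using x(1) by (simp add: divide_simps)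
    finally show ?thesis unfolding x(2) x_def[symmetric] .
  qed
  ultimately have "eventually (\<lambda>lam. (fst (admissible.lower_vertex lam m) - fst (P0 lam m)) * (sin ((2 * real m + 1) * theta lam) / lam)
      < (1 - snd (admissible.lower_vertex lam m)) / lam * cos ((2 * real m + 2) * theta lam)) (at_right 0)"
    by (rule eventually_less)
  then show "eventually (\<lambda>lam. (fst (admissible.lower_vertex lam m) - fst (P0 lam m)) * sin ((2 * real m + 1) * theta lam)
      < (1 - snd (admissible.lower_vertex lam m)) * cos ((2 * real m + 2) * theta lam)) (at_right 0)"
    using eventually_admissible
  proof eventually_elim
    case (elim lam)
    then have "0 < lam" by (simp add: admissible_def)
    then show ?case using elim by (simp add: divide_less_cancel)
  qed
qed

subsection \<open>Pointwise limit of the contributions\<close>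

text \<open>Twice the limit of the amplitude \<open>B\<close> if \<open>n * lam\<close> tends to \<open>u\<close>; the first coordinate of the
  regular fixed point then tends to \<open>(1 + slope u) / 2\<close>.\<close>

definition slope :: "real \<Rightarrow> real" where
  "slope u = cos (pi / 4 + u) / sin (pi / 4 + u)"

text \<open>The limits of \<open>height / lam\<close> and \<open>fourth / lam\<close>.\<close>

definition height_limit :: "nat \<Rightarrow> real \<Rightarrow> real" where
  "height_limit m u = ((2 * real m + 1) * slope u - 1) / 4"

definition fourth_limit :: "nat \<Rightarrow> real \<Rightarrow> real" where
  "fourth_limit m u = (1 - (2 * real m - 3) * slope u) / 4"

text \<open>The limit of \<open>weight m n / lam\<close>. The factor \<open>4 * u\<close> is the limit of the period times \<open>lam\<close>; the
  maximum with 0 accounts for the pairs \<open>(m, n)\<close> without a regular fixed point.\<close>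

definition density :: "nat \<Rightarrow> real \<Rightarrow> real" where
  "density m u = (if 0 < u \<and> u < pi / 4 \<and> 1 \<le> m
     then 4 * u * (pi * (max 0 (min (height_limit m u) (fourth_limit m u)))\<^sup>2 * 1) else 0)"

definition height_of :: "nat \<Rightarrow> nat \<Rightarrow> real \<Rightarrow> real" where
  "height_of m n lam = cycle_B lam m n * sin ((2 * real m + 1) * theta lam) - eb lam"

definition fourth_of :: "nat \<Rightarrow> nat \<Rightarrow> real \<Rightarrow> real" where
  "fourth_of m n lam = eb lam - cycle_B lam m n * sin ((2 * real m - 3) * theta lam)"

locale scaling =
  fixes u :: real and \<nu> :: "real \<Rightarrow> nat"
  assumes u: "0 < u" "u < pi / 4" and \<nu>: "((\<lambda>lam. real (\<nu> lam) * lam) \<longlongrightarrow> u) (at_right 0)"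
begin

lemma angle_tendsto: "((\<lambda>lam. pi / 4 + (2 * real (\<nu> lam) + c) * theta lam) \<longlongrightarrow> pi / 4 + u) (at_right 0)"
proof -
  have "((\<lambda>lam. pi / 4 + (2 * (real (\<nu> lam) * lam * (theta lam / lam)) + c * theta lam))
      \<longlongrightarrow> pi / 4 + (2 * (u * (1 / 2)) + c * 0)) (at_right 0)"
    by (intro tendsto_intros \<nu> theta_quotient theta_tendsto)
  moreover have "eventually (\<lambda>lam. pi / 4 + (2 * (real (\<nu> lam) * lam * (theta lam / lam)) + c * theta lam) =
      pi / 4 + (2 * real (\<nu> lam) + c) * theta lam) (at_right 0)"
    using lam_nonzero by eventually_elim (simp add: algebra_simps)
  ultimately have "((\<lambda>lam. pi / 4 + (2 * real (\<nu> lam) + c) * theta lam)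
      \<longlongrightarrow> pi / 4 + (2 * (u * (1 / 2)) + c * 0)) (at_right 0)" by (rule Lim_transform_eventually)
  then show ?thesis by simp
qed

lemma sin_limit_pos: "0 < sin (pi / 4 + u)" "sin (pi / 4 + u) < 1"
  and slope_bounds: "0 < slope u" "slope u < 1"
proof -
  show s: "0 < sin (pi / 4 + u)" using u by (intro sin_gt_zero) linarith+
  have c: "0 < cos (pi / 4 + u)" using u by (intro cos_gt_zero_pi) linarith+
  have "sin (pi / 4 + u) < sin (pi / 2)" using u by (intro sin_monotone_2pi) linarith+
  then show "sin (pi / 4 + u) < 1" by simp
  show "0 < slope u" using s c by (simp add: slope_def)
  have "cos (pi / 4 + u) < cos (pi / 4)" using u by (intro cos_monotone_0_pi) linarith+
  also have "\<dots> = sin (pi / 4)" by (simp add: sin_45 cos_45)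
  also have "\<dots> < sin (pi / 4 + u)" using u by (intro sin_monotone_2pi) linarith+
  finally show "slope u < 1" using s by (simp add: slope_def)
qed

lemma cycle_det_tendsto: "((\<lambda>lam. cycle_det lam m (\<nu> lam)) \<longlongrightarrow> sin (pi / 4 + u)) (at_right 0)"
proof -
  have "((\<lambda>lam. cos (1 * theta lam) * sin (pi / 4 + (2 * real (\<nu> lam) + (2 * real m - 1 / 2)) * theta lam))
      \<longlongrightarrow> 1 * sin (pi / 4 + u)) (at_right 0)"
    by (intro tendsto_intros cos_mult_tendsto angle_tendsto)
  then show ?thesis by (simp add: cycle_det_def algebra_simps)
qed

lemma cycle_R_tendsto: "((\<lambda>lam. cycle_R lam m (\<nu> lam)) \<longlongrightarrow> 1 / 2 / sin (pi / 4 + u)) (at_right 0)"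
proof -
  have "((\<lambda>lam. cycle_R lam m (\<nu> lam)) \<longlongrightarrow> ((1 / 2 + 0 - 1 / 2) * 0 + (1 + 0 - 1 / 2) * 1) / sin (pi / 4 + u)) (at_right 0)"
    unfolding cycle_R_def using sin_limit_pos
    by (intro tendsto_intros kap_tendsto ea_tendsto eb_tendsto lam_tendsto sin_mult_tendsto cos_mult_tendsto
        cycle_det_tendsto) auto
  then show ?thesis by simp
qed

lemma cycle_B_tendsto: "((\<lambda>lam. cycle_B lam m (\<nu> lam)) \<longlongrightarrow> slope u / 2) (at_right 0)"
proof -
  have angles: "((\<lambda>lam. pi / 4 + (2 * real (\<nu> lam) - 5 / 2) * theta lam) \<longlongrightarrow> pi / 4 + u) (at_right 0)"
    "((\<lambda>lam. pi / 4 + (2 * real (\<nu> lam) - 3 / 2) * theta lam) \<longlongrightarrow> pi / 4 + u) (at_right 0)"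
    using angle_tendsto[of "- (5 / 2)"] angle_tendsto[of "- (3 / 2)"] by simp_all
  have "((\<lambda>lam. cycle_B lam m (\<nu> lam)) \<longlongrightarrow>
      ((1 + 0 - 1 / 2) * cos (pi / 4 + u) - (1 / 2 + 0 - 1 / 2) * sin (pi / 4 + u)) / sin (pi / 4 + u)) (at_right 0)"
    unfolding cycle_B_def using sin_limit_pos
    by (intro tendsto_divide tendsto_diff tendsto_add tendsto_mult tendsto_const kap_tendsto ea_tendsto
        eb_tendsto lam_tendsto cycle_det_tendsto tendsto_cos[OF angles(1)] tendsto_sin[OF angles(2)]) auto
  then show ?thesis by (simp add: slope_def mult.commute)
qed

lemma height_tendsto: "((\<lambda>lam. height_of m (\<nu> lam) lam / lam) \<longlongrightarrow> height_limit m u) (at_right 0)"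
proof -
  have "((\<lambda>lam. cycle_B lam m (\<nu> lam) * (sin ((2 * real m + 1) * theta lam) / lam) - eb lam / lam)
      \<longlongrightarrow> slope u / 2 * ((2 * real m + 1) / 2) - 1 / 4) (at_right 0)"
    by (intro tendsto_intros cycle_B_tendsto sin_theta_quotient eb_quotient)
  moreover have "slope u / 2 * ((2 * real m + 1) / 2) - 1 / 4 = height_limit m u"
    by (simp add: height_limit_def field_simps)
  ultimately show ?thesis by (simp only: height_of_def diff_divide_distrib times_divide_eq_right)
qed

lemma fourth_tendsto: "((\<lambda>lam. fourth_of m (\<nu> lam) lam / lam) \<longlongrightarrow> fourth_limit m u) (at_right 0)"
proof -
  have "((\<lambda>lam. eb lam / lam - cycle_B lam m (\<nu> lam) * (sin ((2 * real m - 3) * theta lam) / lam))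
      \<longlongrightarrow> 1 / 4 - slope u / 2 * ((2 * real m - 3) / 2)) (at_right 0)"
    by (intro tendsto_intros cycle_B_tendsto sin_theta_quotient eb_quotient)
  moreover have "1 / 4 - slope u / 2 * ((2 * real m - 3) / 2) = fourth_limit m u"
    by (simp add: fourth_limit_def field_simps)
  ultimately show ?thesis by (simp only: fourth_of_def diff_divide_distrib times_divide_eq_right)
qed

lemma \<nu>_ge: "eventually (\<lambda>lam. 1 \<le> \<nu> lam) (at_right 0)"
proof -
  have "eventually (\<lambda>lam. 0 < real (\<nu> lam) * lam) (at_right 0)"
    using order_tendstoD(1)[OF \<nu>] u by blast
  then show ?thesis by eventually_elim (auto simp: zero_less_mult_iff)
qed

lemma eventually_indices:
  "eventually (\<lambda>lam. (2 * real m + 1) * theta lam \<le> pi / 2) (at_right 0)"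
  "eventually (\<lambda>lam. (4 * real (\<nu> lam) + 5) * theta lam \<le> pi / 2) (at_right 0)"
proof -
  have "((\<lambda>lam. (2 * real m + 1) * theta lam) \<longlongrightarrow> (2 * real m + 1) * 0) (at_right 0)"
    by (intro tendsto_intros theta_tendsto)
  then have "eventually (\<lambda>lam. (2 * real m + 1) * theta lam < pi / 2) (at_right 0)"
    by (rule order_tendstoD) simp
  then show "eventually (\<lambda>lam. (2 * real m + 1) * theta lam \<le> pi / 2) (at_right 0)"
    by eventually_elim simp
  have "eventually (\<lambda>lam. pi / 4 + (2 * real (\<nu> lam) + 5 / 2) * theta lam < pi / 2) (at_right 0)"
    using order_tendstoD(2)[OF angle_tendsto[of "5 / 2"], of "pi / 2"] u by simp
  then show "eventually (\<lambda>lam. (4 * real (\<nu> lam) + 5) * theta lam \<le> pi / 2) (at_right 0)"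
    by eventually_elim (simp add: algebra_simps)
qed

text \<open>The inequalities for the position of \<open>z\<close> are strict in the limit, those for \<open>height\<close> and
  \<open>fourth\<close> after division by \<open>lam\<close>.\<close>

lemma eventually_regular_cycle:
  assumes m: "1 \<le> m" and pos: "0 < height_limit m u" "0 < fourth_limit m u"
  shows "eventually (\<lambda>lam. regular_cycle lam m (\<nu> lam) (cycle_R lam m (\<nu> lam)) (cycle_B lam m (\<nu> lam))
    (admissible.cycle_pt lam m (\<nu> lam))) (at_right 0)"
proof -
  have h: "eventually (\<lambda>lam. 0 < height_of m (\<nu> lam) lam / lam) (at_right 0)"
    using order_tendstoD(1)[OF height_tendsto] pos by blast
  have f: "eventually (\<lambda>lam. 0 < fourth_of m (\<nu> lam) lam / lam) (at_right 0)"
    using order_tendstoD(1)[OF fourth_tendsto] pos by blast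
  have "((\<lambda>lam. height_of m (\<nu> lam) lam / lam * lam) \<longlongrightarrow> height_limit m u * 0) (at_right 0)"
    by (intro tendsto_intros height_tendsto lam_tendsto)
  then have h0: "((\<lambda>lam. height_of m (\<nu> lam) lam / lam * lam + lam / 2) \<longlongrightarrow> height_limit m u * 0 + 0 / 2) (at_right 0)"
    by (rule tendsto_add[OF _ tendsto_divide[OF lam_tendsto tendsto_const]]) simp
  have hs: "eventually (\<lambda>lam. height_of m (\<nu> lam) lam / lam * lam + lam / 2 < 1 / 2) (at_right 0)"
    using order_tendstoD(2)[OF h0, of "1 / 2"] by simp
  have s: "((\<lambda>lam. ea lam + lam + cycle_B lam m (\<nu> lam) * cos ((2 * real m + 2) * theta lam)) \<longlongrightarrow>
      1 / 2 + 0 + slope u / 2 * 1) (at_right 0)"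
    by (intro tendsto_intros ea_tendsto lam_tendsto cycle_B_tendsto cos_mult_tendsto)
  have s1: "eventually (\<lambda>lam. ea lam + lam + cycle_B lam m (\<nu> lam) * cos ((2 * real m + 2) * theta lam) < 1) (at_right 0)"
    using order_tendstoD(2)[OF s, of 1] slope_bounds by simp
  have "((\<lambda>lam::real. (1 + lam) / 2) \<longlongrightarrow> (1 + 0) / 2) (at_right 0)" by (intro tendsto_intros lam_tendsto) simp
  then have s0: "eventually (\<lambda>lam. (1 + lam) / 2 < ea lam + lam + cycle_B lam m (\<nu> lam) * cos ((2 * real m + 2) * theta lam)) (at_right 0)"
    using slope_bounds by (intro eventually_less[OF _ s]) auto
  have "((\<lambda>lam. 1 - kap lam) \<longlongrightarrow> 1 - 1 / 2) (at_right 0)" by (intro tendsto_intros kap_tendsto)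
  then have R: "eventually (\<lambda>lam. 1 - kap lam < cycle_R lam m (\<nu> lam)) (at_right 0)"
    using sin_limit_pos by (intro eventually_less[OF _ cycle_R_tendsto]) (auto simp: field_simps)
  show ?thesis
    using h f hs s1 s0 R \<nu>_ge eventually_indices(1)[of m] eventually_indices(2) eventually_admissible
  proof eventually_elim
    case (elim lam)
    interpret admissible lam by fact
    let ?n = "\<nu> lam"
    have det: "cycle_det lam m ?n \<noteq> 0" using cycle_det_pos[of m ?n] elim m by simp
    have z: "ctr lam + cycle_R lam m ?n *\<^sub>R polar lam (in_angle ?n) = out_pt m (cycle_B lam m ?n)"
      using position_iff[OF det] by blast
    have h: "0 < height_of m ?n lam" "height_of m ?n lam + lam / 2 < 1 / 2" "0 < fourth_of m ?n lam"
      using elim lam_pos by (simp_all add: zero_less_divide_iff)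
    have "0 \<le> cycle_R lam m ?n" using elim(6) kap_bounds by linarith
    then have "cycle_pt m ?n \<in> sector lam"
      unfolding cycle_pt_def z[symmetric]
    proof (subst polar_in_sector_iff)
      have "\<kappa> + cycle_R lam m ?n * cos (in_angle ?n) = fst (out_pt m (cycle_B lam m ?n))"
        "\<kappa> + cycle_R lam m ?n * sin (in_angle ?n + \<theta>) = snd (out_pt m (cycle_B lam m ?n))"
        unfolding z[symmetric] by (simp_all add: polar_def ctr_eq)
      then show "\<kappa> + cycle_R lam m ?n * cos (in_angle ?n) \<in> {(1 + lam) / 2<..<1} \<and>
          \<kappa> + cycle_R lam m ?n * sin (in_angle ?n + \<theta>) \<in> {(1 + lam) / 2<..<1} \<and> 1 - \<kappa> < cycle_R lam m ?n"
        using elim(4-6) h by (simp add: out_pt_def height_of_def field_simps)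
    qed
    then show ?case
      using elim m h(3) z by unfold_locales (auto simp: cycle_pt_def fourth_of_def)
  qed
qed

lemma period_tendsto: "1 \<le> m \<Longrightarrow> ((\<lambda>lam. real (4 * (m + \<nu> lam) - 1) * lam) \<longlongrightarrow> 4 * u) (at_right 0)"
proof -
  assume "1 \<le> m"
  then have "real (4 * (m + k) - 1) = 4 * real k + (4 * real m - 1)" for k by (simp add: of_nat_diff)
  then have eq: "real (4 * (m + \<nu> lam) - 1) * lam = 4 * (real (\<nu> lam) * lam) + (4 * real m - 1) * lam" for lam
    by (simp only: distrib_right mult.assoc)
  have "((\<lambda>lam. 4 * (real (\<nu> lam) * lam) + (4 * real m - 1) * lam) \<longlongrightarrow> 4 * u + (4 * real m - 1) * 0) (at_right 0)"
    by (intro tendsto_intros \<nu> lam_tendsto)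
  then show ?thesis unfolding eq by simp
qed

text \<open>The radius is at most the minimum of \<open>height\<close> and \<open>fourth\<close>, whether or not the limits are positive,
  and this alone gives the limit 0 if one of them is not. If both are positive, the pair eventually has a regular
  fixed point and the radius equals the minimum, because \<open>1 - a - B\<close> has a positive limit.\<close>

lemma weight_tendsto:
  assumes m: "1 \<le> m"
  shows "((\<lambda>lam. admissible.weight lam m (\<nu> lam) / lam) \<longlongrightarrow> density m u) (at_right 0)"
proof -
  define \<rho> where "\<rho> = (\<lambda>lam. min (height_of m (\<nu> lam) lam / lam) (fourth_of m (\<nu> lam) lam / lam))"
  define \<Phi> where "\<Phi> = (\<lambda>lam. real (4 * (m + \<nu> lam) - 1) * lam * (pi * (max 0 (\<rho> lam))\<^sup>2 * (1 - lam\<^sup>2 / 4)))"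
  have \<rho>: "(\<rho> \<longlongrightarrow> min (height_limit m u) (fourth_limit m u)) (at_right 0)"
    unfolding \<rho>_def by (intro tendsto_intros height_tendsto fourth_tendsto)
  have "(\<Phi> \<longlongrightarrow> 4 * u * (pi * (max 0 (min (height_limit m u) (fourth_limit m u)))\<^sup>2 * (1 - 0\<^sup>2 / 4))) (at_right 0)"
    unfolding \<Phi>_def by (intro tendsto_intros \<rho> period_tendsto m lam_tendsto) auto
  then have \<Phi>: "(\<Phi> \<longlongrightarrow> density m u) (at_right 0)" using u m by (simp add: density_def)
  have scaled: "admissible.weight lam m (\<nu> lam) / lam =
      real (4 * (m + \<nu> lam) - 1) * lam * (pi * (r / lam)\<^sup>2 * (1 - lam\<^sup>2 / 4))"
    if adm: "admissible lam" and "(m, \<nu> lam) \<in> admissible.regular_pairs lam"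
      and "r = island_radius (orbit lam (admissible.cycle_pt lam m (\<nu> lam)))" for lam r
    using that admissible.lam_pos[OF adm] by (simp add: admissible.weight_def power_divide power2_eq_square)
  have upper: "eventually (\<lambda>lam. admissible.weight lam m (\<nu> lam) / lam \<le> \<Phi> lam) (at_right 0)"
    using eventually_admissible
  proof eventually_elim
    case (elim lam)
    interpret admissible lam by fact
    have pos: "0 \<le> 1 - lam\<^sup>2 / 4" using discr_pos[OF lam_bounds(2)] by simp
    show ?case
    proof (cases "(m, \<nu> lam) \<in> regular_pairs")
      case True
      interpret regular_cycle lam m "\<nu> lam" "cycle_R lam m (\<nu> lam)" "cycle_B lam m (\<nu> lam)" "cycle_pt m (\<nu> lam)"
        using regular_pairsD(1)[OF True] .
      let ?r = "island_radius (orbit lam (cycle_pt m (\<nu> lam)))"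
      have "?r / lam \<le> \<rho> lam"
        using island_radius_bounds(2,3) lam_pos
        by (simp add: \<rho>_def height_of_def fourth_of_def height_def fourth_def divide_right_mono)
      moreover have "0 \<le> ?r / lam" using island_radius_bounds(1) gap_pos lam_pos by simp
      ultimately have "(?r / lam)\<^sup>2 \<le> (max 0 (\<rho> lam))\<^sup>2" by (intro power_mono) auto
      then show ?thesis
        unfolding scaled[OF elim True refl] \<Phi>_def using pos lam_pos
        by (intro mult_left_mono mult_right_mono) auto
    next
      case False
      then show ?thesis using pos lam_pos by (simp add: weight_def \<Phi>_def)
    qed
  qed
  show ?thesis
  proof (cases "0 < min (height_limit m u) (fourth_limit m u)")
    case False
    then have "max 0 (min (height_limit m u) (fourth_limit m u)) = 0"
      by (intro max_absorb1) (simp only: not_less)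
    then have "density m u = 0" by (simp add: density_def)
    then have \<Phi>0: "(\<Phi> \<longlongrightarrow> 0) (at_right 0)" using \<Phi> by simp
    have "eventually (\<lambda>lam. 0 \<le> admissible.weight lam m (\<nu> lam) / lam) (at_right 0)"
      using eventually_admissible
      by eventually_elim (simp add: admissible.weight_nonneg admissible.lam_pos less_imp_le)
    then have "((\<lambda>lam. admissible.weight lam m (\<nu> lam) / lam) \<longlongrightarrow> 0) (at_right 0)"
      by (rule tendsto_sandwich[OF _ upper tendsto_const \<Phi>0])
    then show ?thesis using \<open>density m u = 0\<close> by simp
  next
    case True
    then have pos: "0 < height_limit m u" "0 < fourth_limit m u" by auto
    have gap: "((\<lambda>lam. 1 - ea lam - cycle_B lam m (\<nu> lam)) \<longlongrightarrow> 1 - 1 / 2 - slope u / 2) (at_right 0)"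
      by (intro tendsto_intros ea_tendsto cycle_B_tendsto)
    have height: "((\<lambda>lam. height_of m (\<nu> lam) lam / lam * lam) \<longlongrightarrow> height_limit m u * 0) (at_right 0)"
      by (intro tendsto_intros height_tendsto lam_tendsto)
    have "eventually (\<lambda>lam. height_of m (\<nu> lam) lam / lam * lam < 1 - ea lam - cycle_B lam m (\<nu> lam)) (at_right 0)"
      using slope_bounds by (intro eventually_less[OF height gap]) simp
    then have "eventually (\<lambda>lam. \<Phi> lam = admissible.weight lam m (\<nu> lam) / lam) (at_right 0)"
      using eventually_regular_cycle[OF m pos] eventually_vertices[OF m] eventually_indices(1)[of m]
        eventually_indices(2)
    proof eventually_elim
      case (elim lam)
      interpret regular_cycle lam m "\<nu> lam" "cycle_R lam m (\<nu> lam)" "cycle_B lam m (\<nu> lam)" "admissible.cycle_pt lam m (\<nu> lam)"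
        using elim(2) .
      let ?r = "island_radius (orbit lam (cycle_pt m (\<nu> lam)))"
      have adm: "admissible lam" by unfold_locales
      have "m \<le> M lam" "\<nu> lam + 1 \<le> N lam" using le_M le_N elim m n by blast+
      then have "regular_fixed_point lam m (\<nu> lam) (cycle_pt m (\<nu> lam))"
        using elim(3,4) by (rule regular)
      then have pair: "(m, \<nu> lam) \<in> regular_pairs" unfolding regular_pairs_def by blast
      have hf: "height = height_of m (\<nu> lam) lam" "fourth = fourth_of m (\<nu> lam) lam"
        by (simp_all add: height_of_def fourth_of_def height_def fourth_def)
      have "gap = min height fourth" using elim(1) lam_pos by (auto simp: gap_def hf)
      then have r: "?r = min height fourth" using island_radius_bounds by simp
      then have "?r / lam = \<rho> lam" using lam_pos by (simp add: \<rho>_def hf min_divide_distrib_right)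
      moreover have "0 \<le> ?r / lam" using island_radius_bounds(1) gap_pos lam_pos by simp
      ultimately show ?case unfolding scaled[OF adm pair refl] \<Phi>_def by simp
    qed
    then show ?thesis using \<Phi> by (rule Lim_transform_eventually[rotated])
  qed
qed

end

section \<open>Convergence of the total area\<close>

lemma floor_scaling:
  assumes "0 \<le> u"
  shows "((\<lambda>lam. real (nat \<lfloor>u / lam\<rfloor>) * lam) \<longlongrightarrow> u) (at_right 0)"
proof (rule tendsto_sandwich)
  have pos: "eventually (\<lambda>lam::real. 0 < lam) (at_right 0)" by (rule eventually_at_right_less)
  show "eventually (\<lambda>lam. u - lam \<le> real (nat \<lfloor>u / lam\<rfloor>) * lam) (at_right 0)"
    using pos
  proof eventually_elim
    case (elim lam)
    have "u / lam - 1 \<le> real (nat \<lfloor>u / lam\<rfloor>)" by linarith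
    then have "(u / lam - 1) * lam \<le> real (nat \<lfloor>u / lam\<rfloor>) * lam" using elim by (intro mult_right_mono) auto
    then show ?case using elim by (simp add: left_diff_distrib)
  qed
  show "eventually (\<lambda>lam. real (nat \<lfloor>u / lam\<rfloor>) * lam \<le> u) (at_right 0)"
    using pos
  proof eventually_elim
    case (elim lam)
    have "0 \<le> u / lam" using assms elim by simp
    then have "real (nat \<lfloor>u / lam\<rfloor>) \<le> u / lam" by linarith
    then have "real (nat \<lfloor>u / lam\<rfloor>) * lam \<le> u / lam * lam" using elim by (intro mult_right_mono) auto
    then show ?case using elim by simp
  qed
  have "((\<lambda>lam. u - lam) \<longlongrightarrow> u - 0) (at_right 0)" by (intro tendsto_intros lam_tendsto)
  then show "((\<lambda>lam. u - lam) \<longlongrightarrow> u) (at_right 0)" by simp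
qed (rule tendsto_const)

text \<open>The step function of mesh \<open>lam\<close> whose integral is the sum of the weights over \<open>n\<close>. The interval
  from 0 to 2 contains all steps since \<open>N lam * lam \<le> 2\<close>.\<close>

definition step_density :: "nat \<Rightarrow> real \<Rightarrow> real \<Rightarrow> real" where
  "step_density m lam = (if admissible lam
     then (\<lambda>u. if 0 \<le> u \<and> u < 2 then admissible.weight lam m (nat \<lfloor>u / lam\<rfloor>) / lam else 0) else (\<lambda>u. 0))"

lemma (in admissible) N_lam_le: "real (N lam) * lam \<le> 2"
proof (cases "N lam")
  case (Suc k)
  then have "real k * lam \<le> 1" using N_lam[of k] by simp
  then show ?thesis using Suc lam_bounds by (simp add: algebra_simps)
qed simp

lemma (in admissible) step_density_integral:
  "step_density m lam \<in> borel_measurable lborel"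
  "integral\<^sup>L lborel (step_density m lam) = (\<Sum>n<N lam. weight m n)"
proof -
  have adm: "admissible lam" by unfold_locales
  note step = step_function_integral[where w = "weight m", OF lam_pos N_lam_le weight_eq_0(1)]
  show "step_density m lam \<in> borel_measurable lborel"
    "integral\<^sup>L lborel (step_density m lam) = (\<Sum>n<N lam. weight m n)"
    using step adm by (simp_all add: step_density_def)
qed

lemma step_density_measurable: "step_density m lam \<in> borel_measurable lborel"
  using admissible.step_density_integral(1) by (cases "admissible lam") (auto simp: step_density_def)

lemma step_density_bound:
  assumes "1 \<le> m"
  shows "\<bar>step_density m lam u\<bar> \<le> 1000 * indicator {0..2} u"
proof (cases "admissible lam \<and> 0 \<le> u \<and> u < 2")
  case True
  then interpret admissible lam by simp
  let ?w = "weight m (nat \<lfloor>u / lam\<rfloor>)"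
  have "1 * ?w \<le> (real m)\<^sup>2 * ?w"
    using assms weight_nonneg by (intro mult_right_mono) auto
  then have "?w \<le> 1000 * lam" using weight_le[of m "nat \<lfloor>u / lam\<rfloor>"] by linarith
  then show ?thesis using True weight_nonneg lam_pos by (simp add: step_density_def field_simps)
qed (auto simp: step_density_def)

lemma step_density_tendsto:
  assumes m: "1 \<le> m" and u: "u \<noteq> 0" "u \<noteq> pi / 4"
  shows "((\<lambda>lam. step_density m lam u) \<longlongrightarrow> density m u) (at_right 0)"
proof -
  consider "u < 0" | "0 < u" "u < pi / 4" | "pi / 4 < u" using u by linarith
  then show ?thesis
  proof cases
    case 1
    then show ?thesis by (simp add: step_density_def density_def if_distrib[of "\<lambda>f. f u"] cong: if_cong)
  next
    case 2
    interpret scaling u "\<lambda>lam. nat \<lfloor>u / lam\<rfloor>"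
      using 2 floor_scaling by unfold_locales auto
    have u2: "u < 2" using 2 pi_less_4 by linarith
    have "eventually (\<lambda>lam. admissible.weight lam m (nat \<lfloor>u / lam\<rfloor>) / lam = step_density m lam u) (at_right 0)"
      using eventually_admissible by eventually_elim (use 2 u2 in \<open>simp add: step_density_def\<close>)
    then show ?thesis by (rule Lim_transform_eventually[OF weight_tendsto[OF m]])
  next
    case 3
    then have "0 \<le> u" using pi_gt_zero by linarith
    have lim: "((\<lambda>lam. 4 * (real (nat \<lfloor>u / lam\<rfloor>) * lam * (theta lam / lam))) \<longlongrightarrow> 4 * (u * (1 / 2))) (at_right 0)"
      by (intro tendsto_intros floor_scaling theta_quotient \<open>0 \<le> u\<close>)
    have "eventually (\<lambda>lam. pi / 2 < 4 * (real (nat \<lfloor>u / lam\<rfloor>) * lam * (theta lam / lam))) (at_right 0)"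
      using order_tendstoD(1)[OF lim, of "pi / 2"] 3 by simp
    then have "eventually (\<lambda>lam. 0 = step_density m lam u) (at_right 0)"
      using eventually_admissible
    proof eventually_elim
      case (elim lam)
      interpret admissible lam by fact
      let ?n = "nat \<lfloor>u / lam\<rfloor>"
      have big: "pi / 2 < 4 * (real ?n * \<theta>)" using elim(1) lam_pos by simp
      have "N lam \<le> ?n"
      proof (rule ccontr)
        assume "\<not> N lam \<le> ?n"
        then have "(4 * real ?n + 5) * \<theta> \<le> pi / 2" by (intro N_bound) simp
        then have "4 * (real ?n * \<theta>) \<le> pi / 2" using theta_bounds by (simp add: algebra_simps)
        then show False using big by linarith
      qed
      then show ?case using elim(2) by (simp add: step_density_def weight_eq_0)
    qed
    moreover have "density m u = 0" using 3 by (simp add: density_def)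
    ultimately show ?thesis by (simp add: Lim_transform_eventually[OF tendsto_const])
  qed
qed

lemma density_measurable: "density m \<in> borel_measurable lborel"
  unfolding density_def height_limit_def fourth_limit_def slope_def by measurable

lemma density_nonneg: "0 \<le> density m u"
  by (simp add: density_def)

text \<open>Dominated convergence along sequences of parameters. The exceptional points 0 and \<open>pi / 4\<close> correspond to
  the ends of the range of \<open>n\<close>.\<close>

lemma row_tendsto:
  shows "((\<lambda>lam. \<Sum>n<N lam. admissible.weight lam m n) \<longlongrightarrow> integral\<^sup>L lborel (density m)) (at_right 0)"
    and "integrable lborel (density m)"
proof -
  have "((\<lambda>lam. \<Sum>n<N lam. admissible.weight lam m n) \<longlongrightarrow> integral\<^sup>L lborel (density m)) (at_right 0) \<and>
    integrable lborel (density m)"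
  proof (cases "m = 0")
    case True
    have "eventually (\<lambda>lam. 0 = (\<Sum>n<N lam. admissible.weight lam m n)) (at_right 0)"
      using eventually_admissible by eventually_elim (simp add: True admissible.weight_eq_0)
    moreover have "density m = (\<lambda>u. 0)" by (simp add: fun_eq_iff density_def True)
    ultimately show ?thesis by (simp add: Lim_transform_eventually[OF tendsto_const])
  next
    case False
    have ae: "AE u in lborel. u \<notin> {0, pi / 4}"
      by (rule AE_not_in) (simp add: finite_imp_null_set_lborel)
    have w: "integrable lborel (\<lambda>u. 1000 * indicator {0..2 :: real} u :: real)"
      by (intro integrable_mult_right integrable_real_indicator) auto
    have seq: "(\<lambda>i. integral\<^sup>L lborel (step_density m (X i))) \<longlonglongrightarrow> integral\<^sup>L lborel (density m) \<and> integrable lborel (density m)"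
      if X: "\<And>i. X i \<in> {0<..} - {0}" "X \<longlonglongrightarrow> 0" for X
    proof -
      have lim: "AE u in lborel. (\<lambda>i. step_density m (X i) u) \<longlonglongrightarrow> density m u"
        using ae
      proof eventually_elim
        case (elim u)
        then have "((\<lambda>lam. step_density m lam u) \<longlongrightarrow> density m u) (at_right 0)"
          using False by (intro step_density_tendsto) auto
        then show ?case using X unfolding tendsto_at_iff_sequentially by (auto simp: comp_def)
      qed
      have bound: "AE u in lborel. norm (step_density m (X i) u) \<le> 1000 * indicator {0..2} u" for i
        using False step_density_bound[of m "X i"] by (intro AE_I2) auto
      show ?thesis
        using integral_dominated_convergence[OF density_measurable step_density_measurable w lim bound]
          integrable_dominated_convergence[OF density_measurable step_density_measurable w lim bound] by blast
    qed
    have "((\<lambda>lam. integral\<^sup>L lborel (step_density m lam)) \<longlongrightarrow> integral\<^sup>L lborel (density m)) (at_right 0)"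
      unfolding tendsto_at_iff_sequentially using seq by (auto simp: comp_def)
    moreover have "eventually (\<lambda>lam. integral\<^sup>L lborel (step_density m lam) = (\<Sum>n<N lam. admissible.weight lam m n)) (at_right 0)"
      using eventually_admissible by eventually_elim (rule admissible.step_density_integral)
    ultimately have "((\<lambda>lam. \<Sum>n<N lam. admissible.weight lam m n) \<longlongrightarrow> integral\<^sup>L lborel (density m)) (at_right 0)"
      by (rule Lim_transform_eventually)
    moreover have "integrable lborel (density m)"
      using seq[of "\<lambda>i. 1 / real (Suc i)"] LIMSEQ_Suc[OF lim_1_over_n] by auto
    ultimately show ?thesis by blast
  qed
  then show "((\<lambda>lam. \<Sum>n<N lam. admissible.weight lam m n) \<longlongrightarrow> integral\<^sup>L lborel (density m)) (at_right 0)"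
    "integrable lborel (density m)" by blast+
qed

lemma (in admissible) row_bound: "norm (\<Sum>n<N lam. weight m n) \<le> 2000 * inverse ((real m)\<^sup>2)"
proof (cases "m = 0")
  case True
  then show ?thesis by (simp add: weight_eq_0)
next
  case False
  have "weight m n \<le> 1000 * lam * inverse ((real m)\<^sup>2)" for n
    using weight_le[of m n] False by (simp add: field_simps)
  then have "(\<Sum>n<N lam. weight m n) \<le> real (card {..<N lam}) * (1000 * lam * inverse ((real m)\<^sup>2))"
    by (rule sum_bounded_above)
  also have "\<dots> = 1000 * (real (N lam) * lam) * inverse ((real m)\<^sup>2)" by simp
  also have "\<dots> \<le> 1000 * 2 * inverse ((real m)\<^sup>2)"
    using N_lam_le by (intro mult_right_mono mult_left_mono) auto
  finally show ?thesis using weight_nonneg by (simp add: sum_nonneg)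
qed

lemma total_island_area_tendsto:
  "(total_island_area \<longlongrightarrow> (\<Sum>m. integral\<^sup>L lborel (density m))) (at_right 0)"
  "summable (\<lambda>m. norm (integral\<^sup>L lborel (density m)))"
proof -
  have "eventually (\<lambda>lam. \<forall>m. norm (\<Sum>n<N lam. admissible.weight lam m n) \<le> 2000 * inverse ((real m)\<^sup>2)) (at_right 0)"
    using eventually_admissible by eventually_elim (blast intro: admissible.row_bound)
  then have bound: "eventually (\<lambda>(m, lam). norm (\<Sum>n<N lam. admissible.weight lam m n) \<le> 2000 * inverse ((real m)\<^sup>2))
      (at_top \<times>\<^sub>F at_right 0)"
    unfolding eventually_prod_filter by (intro exI[of _ "\<lambda>_. True"] exI conjI) auto
  have "summable (\<lambda>m. 2000 * inverse ((real m)\<^sup>2))"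
    by (intro summable_mult inverse_power_summable) simp
  note tannery = tannerys_theorem[OF row_tendsto(1) bound this trivial_limit_at_right_real]
  then show "summable (\<lambda>m. norm (integral\<^sup>L lborel (density m)))" by blast
  have "eventually (\<lambda>lam. (\<Sum>m. \<Sum>n<N lam. admissible.weight lam m n) = total_island_area lam) (at_right 0)"
    using eventually_admissible by eventually_elim (simp add: admissible.total_island_area_eq)
  then show "(total_island_area \<longlongrightarrow> (\<Sum>m. integral\<^sup>L lborel (density m))) (at_right 0)"
    using tannery by (blast intro: Lim_transform_eventually)
qed

text \<open>For \<open>m = 1\<close> a regular fixed point exists if \<open>slope u\<close> exceeds \<open>1 / 3\<close>, which holds near
  \<open>u = 0\<close>.\<close>

lemma density_pos: "0 < u \<Longrightarrow> u < pi / 12 \<Longrightarrow> 0 < density 1 u"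
proof -
  assume less: "0 < u" "u < pi / 12"
  then interpret scaling u "\<lambda>lam. nat \<lfloor>u / lam\<rfloor>"
    using floor_scaling[of u] by unfold_locales auto
  \<comment> \<open>\<open>pi / 4 + pi / 12 = pi / 3\<close>, where the cosine is still one half\<close>
  have "cos (pi / 3) < cos (pi / 4 + u)" using less by (intro cos_monotone_0_pi) linarith+
  then have "1 / 2 * sin (pi / 4 + u) < cos (pi / 4 + u)" using sin_limit_pos by (simp add: cos_60)
  then have "1 / 2 < slope u" using sin_limit_pos by (simp add: slope_def field_simps)
  define q where "q = min (height_limit 1 u) (fourth_limit 1 u)"
  have "0 < q" using \<open>1 / 2 < slope u\<close> by (simp add: q_def height_limit_def fourth_limit_def)
  moreover have "density 1 u = 4 * u * (pi * (max 0 q)\<^sup>2 * 1)"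
    using less by (simp add: density_def q_def)
  ultimately show ?thesis using less by simp
qed

lemma area_limit_pos: "0 < (\<Sum>m. integral\<^sup>L lborel (density m))"
proof (rule suminf_pos2)
  show "summable (\<lambda>m. integral\<^sup>L lborel (density m))"
    using total_island_area_tendsto(2) by (rule summable_norm_cancel)
  show nonneg: "0 \<le> integral\<^sup>L lborel (density m)" for m
    by (simp add: density_nonneg)
  show "0 < integral\<^sup>L lborel (density 1)"
  proof (rule ccontr)
    assume "\<not> 0 < integral\<^sup>L lborel (density 1)"
    then have "integral\<^sup>L lborel (density 1) = 0" using nonneg[of 1] by linarith
    then have "AE u in lborel. density 1 u = 0"
      using integral_nonneg_eq_0_iff_AE[OF row_tendsto(2)[of 1]] density_nonneg by simp
    then have "AE u in lborel. u \<notin> {0<..<pi / 12}"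
      by eventually_elim (use density_pos in force)
    then have "emeasure lborel {0<..<pi / 12} = 0"
      by (subst (asm) AE_iff_measurable[of "{0<..<pi / 12}"]) auto
    then show False using pi_gt_zero by simp
  qed
qed

text \<open>A bounded number of cycles, each with island area at most \<open>1000 * lam\<close>, could not fill a positive
  area in the limit.\<close>

lemma card_regular_orbits_tendsto: "filterlim (\<lambda>lam. card (regular_orbits lam)) at_top (at_right 0)"
proof -
  define A where "A = (\<Sum>m. integral\<^sup>L lborel (density m))"
  have A: "0 < A" unfolding A_def by (rule area_limit_pos)
  have area: "eventually (\<lambda>lam. A / 2 < total_island_area lam) (at_right 0)"
    using order_tendstoD(1)[OF total_island_area_tendsto(1), of "A / 2"] A by (simp add: A_def)
  have "eventually (\<lambda>lam. k \<le> card (regular_orbits lam)) (at_right 0)" for k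
  proof -
    have "((\<lambda>lam. real k * (1000 * lam)) \<longlongrightarrow> real k * (1000 * 0)) (at_right 0)"
      by (intro tendsto_intros lam_tendsto)
    then have "eventually (\<lambda>lam. real k * (1000 * lam) < A / 2) (at_right 0)"
      using A by (intro order_tendstoD) auto
    then show ?thesis
      using area eventually_admissible
    proof eventually_elim
      case (elim lam)
      interpret admissible lam by fact
      have "weight m n \<le> 1000 * lam" if "(m, n) \<in> regular_pairs" for m n
      proof -
        have "1 \<le> m" using that by (auto simp: regular_pairs_def regular_fixed_point_def)
        then have "1 * weight m n \<le> (real m)\<^sup>2 * weight m n"
          using weight_nonneg by (intro mult_right_mono) auto
        then show ?thesis using weight_le[of m n] by linarith
      qed
      then have "total_island_area lam \<le> real (card regular_pairs) * (1000 * lam)"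
        unfolding total_island_area_pairs by (intro sum_bounded_above) auto
      also have "card regular_pairs = card (regular_orbits lam)"
        unfolding regular_orbits_eq by (rule card_image[OF inj_on_orbit, symmetric])
      finally have "real k * (1000 * lam) < real (card (regular_orbits lam)) * (1000 * lam)"
        using elim by linarith
      then show ?case using lam_pos by simp
    qed
  qed
  then show ?thesis by (simp add: filterlim_at_top)
qed

lemma (in admissible) regular_orbit_stable:
  assumes "S \<in> regular_orbits lam"
  shows "stable_symmetric_cycle lam S"
proof -
  obtain m n where "(m, n) \<in> regular_pairs" "S = orbit lam (cycle_pt m n)"
    using assms unfolding regular_orbits_eq by auto
  then show ?thesis using regular_cycle.stable[OF regular_pairsD(1)] by simp
qed

theorem theoremB:
  shows "(\<forall>lam. 0 < lam \<and> lam < lam_plus \<longrightarrow>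
            (\<forall>S\<in>regular_orbits lam. stable_symmetric_cycle lam S)) \<and>
         filterlim (\<lambda>lam. card (regular_orbits lam)) at_top (at_right 0) \<and>
         (\<exists>A>0. (total_island_area \<longlongrightarrow> A) (at_right 0))"
proof (intro conjI allI impI ballI)
  fix lam S assume "0 < lam \<and> lam < lam_plus" "S \<in> regular_orbits lam"
  then show "stable_symmetric_cycle lam S"
    by (intro admissible.regular_orbit_stable) (simp_all add: admissible_def)
qed (use card_regular_orbits_tendsto area_limit_pos total_island_area_tendsto(1) in blast)+

end
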